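(* Any $\mathcal{K}$-manifold $(M^{2n+s},\phi,\xi_i,\eta_j,g)$ with $s\ge1$ admits a unique almost metric $\phi$-connection $\nabla$ with skew-torsion $T$. This connection is given by $\nabla=\nabla^g+\frac12\sum_{j=1}^{s}\eta_j\wedge d\eta_j$.
   Context: Manifolds are smooth and connected. A metric $f$-manifold $(M^{2n+s},\phi,\xi_i,\eta_j,g)$ is a $(2n+s)$-dimensional manifold $M$ with a $(1,1)$-tensor field $\phi$ of constant rank $2n$ satisfying $\phi^3+\phi=0$, global vector fields $\xi_1,\dots,\xi_s$ and 1-forms $\eta_1,\dots,\eta_s$ with $\ker\phi=\langle\xi_1,\dots,\xi_s\rangle$, $\eta_i(\xi_j)=\delta_{ij}$, $\eta_i\circ\phi=0$, $\phi^2=-\mathrm{Id}+\sum_i\eta_i\otimes\xi_i$, and a Riemannian metric $g$ with $g(\phi X,\phi Y)=g(X,Y)-\sum_i\eta_i(X)\eta_i(Y)$. $\nabla^g$ is the Levi-Civita connection. The fundamental 2-form is $F(X,Y)=g(X,\phi Y)$. Convention: $d\eta(X,Y)=X\eta(Y)-Y\eta(X)-\eta([X,Y])$; for a 1-form $\eta$ and a 2-form $\omega$, $(\eta\wedge\omega)(X,Y,Z)=\eta(X)\omega(Y,Z)-\eta(Y)\omega(X,Z)+\eta(Z)\omega(X,Y)$. The Nijenhuis tensor is $N^{(1)}=N_\phi+\sum_i d\eta_i\otimes\xi_i$ with $N_\phi(X,Y)=[\phi X,\phi Y]+\phi^2[X,Y]-\phi[X,\phi Y]-\phi[\phi X,Y]$.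 A $\mathcal{K}$-manifold is a metric $f$-manifold with $N^{(1)}=0$ (normality) and $dF=0$. An affine connection $\nabla$ is an almost metric $\phi$-connection if $\nabla g=0$, $\nabla\phi=0$, $\nabla\xi_i=0$, $\nabla\eta_i=0$ for all $i$. It has skew-torsion if $T(X,Y,Z):=g(T(X,Y),Z)$ is a 3-form, where $T(X,Y)=\nabla_XY-\nabla_YX-[X,Y]$. The notation $\nabla=\nabla^g+\frac12T$ means $g(\nabla_XY,Z)=g(\nabla^g_XY,Z)+\frac12T(X,Y,Z)$. *)

theory Defs
  imports "HOL-Analysis.Analysis" "HOL-Library.Function_Algebras"
begin

section \<open>Smooth manifolds\<close>

text \<open>
  The predicates below are meant for open \<^term>\<open>S\<close>, where \<^term>\<open>at x\<close> agrees with
  \<^term>\<open>at x within S\<close>.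
\<close>

primrec Ck_on :: "nat \<Rightarrow> 'e::euclidean_space set \<Rightarrow> ('e \<Rightarrow> 'b::real_normed_vector) \<Rightarrow> bool" where
  "Ck_on 0 S f \<longleftrightarrow> continuous_on S f"
| "Ck_on (Suc k) S f \<longleftrightarrow>
     (\<forall>x\<in>S. f differentiable (at x)) \<and>
     (\<forall>v. Ck_on k S (\<lambda>x. frechet_derivative f (at x) v))"

definition smooth_on :: "'e::euclidean_space set \<Rightarrow> ('e \<Rightarrow> 'b::real_normed_vector) \<Rightarrow> bool" where
  "smooth_on S f \<longleftrightarrow> (\<forall>k. Ck_on k S f)"

text \<open>
  The underlying space of the manifold is the whole type \<^typ>\<open>'a\<close>. A chart is a pair
  \<open>(U, x)\<close>; only the values of \<open>x\<close> on \<open>U\<close> matter, and its inverse is \<^term>\<open>inv_into U x\<close>.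
\<close>

type_synonym ('a, 'e) chart = "'a set \<times> ('a \<Rightarrow> 'e)"

definition is_chart :: "('a::topological_space, 'e::euclidean_space) chart \<Rightarrow> bool" where
  "is_chart = (\<lambda>(U, x). open U \<and> open (x ` U) \<and> inj_on x U \<and>
     homeomorphism U (x ` U) x (inv_into U x))"

definition smooth_atlas :: "('a::topological_space, 'e::euclidean_space) chart set \<Rightarrow> bool" where
  "smooth_atlas A \<longleftrightarrow>
     (\<forall>c\<in>A. is_chart c) \<and> (\<Union>(U, x)\<in>A. U) = UNIV \<and>
     (\<forall>(U, x)\<in>A. \<forall>(V, y)\<in>A. smooth_on (x ` (U \<inter> V)) (y \<circ> inv_into U x))"

locale smooth_manifold =
  fixes A :: "('a::{t2_space, second_countable_topology}, 'e::euclidean_space) chart set"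
  assumes atlas: "smooth_atlas A"
    and connected: "connected (UNIV :: 'a set)"

definition smooth_functions ::
  "('a::topological_space, 'e::euclidean_space) chart set \<Rightarrow> ('a \<Rightarrow> real) set" where
  "smooth_functions A = {f. \<forall>(U, x)\<in>A. smooth_on (x ` U) (f \<circ> inv_into U x)}"


section \<open>Tangent vectors, vector fields, tensor fields\<close>

text \<open>
  Sums, differences and zero of functions, tangent vectors and vector fields are the pointwise
  ones of \<^theory>\<open>HOL-Library.Function_Algebras\<close>.
\<close>

type_synonym 'a tvec = "('a \<Rightarrow> real) \<Rightarrow> real"
type_synonym 'a vfield = "'a \<Rightarrow> 'a tvec"
type_synonym 'a form1 = "'a \<Rightarrow> 'a tvec \<Rightarrow> real"
type_synonym 'a form2 = "'a \<Rightarrow> 'a tvec \<Rightarrow> 'a tvec \<Rightarrow> real"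
type_synonym 'a endo = "'a \<Rightarrow> 'a tvec \<Rightarrow> 'a tvec"
type_synonym 'a connection = "'a vfield \<Rightarrow> 'a vfield \<Rightarrow> 'a vfield"

definition tscale :: "real \<Rightarrow> 'a tvec \<Rightarrow> 'a tvec" where
  "tscale c v = (\<lambda>f. c * v f)"

global_interpretation tv: vector_space "tscale :: real \<Rightarrow> 'a tvec \<Rightarrow> 'a tvec"
  by unfold_locales (auto simp: tscale_def algebra_simps)

text \<open>
  Tangent vectors at \<open>p\<close> are the derivations at \<open>p\<close> of the algebra of smooth functions. They are
  total HOL functions, so the value outside this algebra is fixed to be \<open>0\<close>.
\<close>

definition tangent_space ::
  "('a::topological_space, 'e::euclidean_space) chart set \<Rightarrow> 'a \<Rightarrow> 'a tvec set" where
  "tangent_space A p = {v.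
     (\<forall>f\<in>smooth_functions A. \<forall>h\<in>smooth_functions A. v (\<lambda>q. f q + h q) = v f + v h) \<and>
     (\<forall>c. \<forall>f\<in>smooth_functions A. v (\<lambda>q. c * f q) = c * v f) \<and>
     (\<forall>f\<in>smooth_functions A. \<forall>h\<in>smooth_functions A.
        v (\<lambda>q. f q * h q) = f p * v h + h p * v f) \<and>
     (\<forall>f. f \<notin> smooth_functions A \<longrightarrow> v f = 0)}"

definition deriv_along :: "'a vfield \<Rightarrow> ('a \<Rightarrow> real) \<Rightarrow> ('a \<Rightarrow> real)" where
  "deriv_along X f = (\<lambda>p. X p f)"

definition vector_fields ::
  "('a::topological_space, 'e::euclidean_space) chart set \<Rightarrow> 'a vfield set" where
  "vector_fields A = {X. (\<forall>p. X p \<in> tangent_space A p) \<and>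
     (\<forall>f\<in>smooth_functions A. deriv_along X f \<in> smooth_functions A)}"

definition fscale :: "('a \<Rightarrow> real) \<Rightarrow> 'a vfield \<Rightarrow> 'a vfield" where
  "fscale f X = (\<lambda>p. tscale (f p) (X p))"

definition lie_bracket :: "'a vfield \<Rightarrow> 'a vfield \<Rightarrow> 'a vfield" where
  "lie_bracket X Y = (\<lambda>p f. X p (deriv_along Y f) - Y p (deriv_along X f))"

definition app1 :: "'a form1 \<Rightarrow> 'a vfield \<Rightarrow> ('a \<Rightarrow> real)" where
  "app1 \<eta> X = (\<lambda>p. \<eta> p (X p))"

definition app2 :: "'a form2 \<Rightarrow> 'a vfield \<Rightarrow> 'a vfield \<Rightarrow> ('a \<Rightarrow> real)" where
  "app2 b X Y = (\<lambda>p. b p (X p) (Y p))"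

definition appE :: "'a endo \<Rightarrow> 'a vfield \<Rightarrow> 'a vfield" where
  "appE \<phi> X = (\<lambda>p. \<phi> p (X p))"

definition one_form ::
  "('a::topological_space, 'e::euclidean_space) chart set \<Rightarrow> 'a form1 \<Rightarrow> bool" where
  "one_form A \<eta> \<longleftrightarrow>
     (\<forall>p. \<forall>u\<in>tangent_space A p. \<forall>v\<in>tangent_space A p. \<eta> p (u + v) = \<eta> p u + \<eta> p v) \<and>
     (\<forall>p c. \<forall>u\<in>tangent_space A p. \<eta> p (tscale c u) = c * \<eta> p u) \<and>
     (\<forall>X\<in>vector_fields A. app1 \<eta> X \<in> smooth_functions A)"

definition endo_field ::
  "('a::topological_space, 'e::euclidean_space) chart set \<Rightarrow> 'a endo \<Rightarrow> bool" where
  "endo_field A \<phi> \<longleftrightarrow>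
     (\<forall>p. \<forall>u\<in>tangent_space A p. \<phi> p u \<in> tangent_space A p) \<and>
     (\<forall>p. \<forall>u\<in>tangent_space A p. \<forall>v\<in>tangent_space A p. \<phi> p (u + v) = \<phi> p u + \<phi> p v) \<and>
     (\<forall>p c. \<forall>u\<in>tangent_space A p. \<phi> p (tscale c u) = tscale c (\<phi> p u)) \<and>
     (\<forall>X\<in>vector_fields A. appE \<phi> X \<in> vector_fields A)"

definition riemannian_metric ::
  "('a::topological_space, 'e::euclidean_space) chart set \<Rightarrow> 'a form2 \<Rightarrow> bool" where
  "riemannian_metric A g \<longleftrightarrow>
     (\<forall>p. \<forall>u\<in>tangent_space A p. \<forall>v\<in>tangent_space A p. \<forall>w\<in>tangent_space A p.
        g p (u + v) w = g p u w + g p v w) \<and>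
     (\<forall>p c. \<forall>u\<in>tangent_space A p. \<forall>v\<in>tangent_space A p. g p (tscale c u) v = c * g p u v) \<and>
     (\<forall>p. \<forall>u\<in>tangent_space A p. \<forall>v\<in>tangent_space A p. g p u v = g p v u) \<and>
     (\<forall>p. \<forall>u\<in>tangent_space A p. u \<noteq> 0 \<longrightarrow> g p u u > 0) \<and>
     (\<forall>X\<in>vector_fields A. \<forall>Y\<in>vector_fields A. app2 g X Y \<in> smooth_functions A)"


section \<open>Exterior calculus\<close>

definition d1 :: "'a form1 \<Rightarrow> 'a vfield \<Rightarrow> 'a vfield \<Rightarrow> ('a \<Rightarrow> real)" where
  "d1 \<eta> X Y = deriv_along X (app1 \<eta> Y) - deriv_along Y (app1 \<eta> X) - app1 \<eta> (lie_bracket X Y)"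

definition d2 :: "'a form2 \<Rightarrow> 'a vfield \<Rightarrow> 'a vfield \<Rightarrow> 'a vfield \<Rightarrow> ('a \<Rightarrow> real)" where
  "d2 \<omega> X Y Z =
     deriv_along X (app2 \<omega> Y Z) - deriv_along Y (app2 \<omega> X Z) + deriv_along Z (app2 \<omega> X Y)
     - app2 \<omega> (lie_bracket X Y) Z + app2 \<omega> (lie_bracket X Z) Y - app2 \<omega> (lie_bracket Y Z) X"

text \<open>The 2-form \<^term>\<open>\<omega>\<close> is given here by its action on vector fields, as \<^term>\<open>d1 \<eta>\<close> is.\<close>

definition wedge12 ::
  "'a form1 \<Rightarrow> ('a vfield \<Rightarrow> 'a vfield \<Rightarrow> ('a \<Rightarrow> real)) \<Rightarrow>
   'a vfield \<Rightarrow> 'a vfield \<Rightarrow> 'a vfield \<Rightarrow> ('a \<Rightarrow> real)" where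
  "wedge12 \<eta> \<omega> X Y Z = app1 \<eta> X * \<omega> Y Z - app1 \<eta> Y * \<omega> X Z + app1 \<eta> Z * \<omega> X Y"

text \<open>
  3-forms as alternating maps on vector fields that are multilinear over the smooth functions;
  linearity in the first argument is enough because of the antisymmetry in both adjacent pairs.
\<close>

definition three_form ::
  "('a::topological_space, 'e::euclidean_space) chart set \<Rightarrow>
   ('a vfield \<Rightarrow> 'a vfield \<Rightarrow> 'a vfield \<Rightarrow> ('a \<Rightarrow> real)) \<Rightarrow> bool" where
  "three_form A t \<longleftrightarrow>
     (\<forall>X\<in>vector_fields A. \<forall>Y\<in>vector_fields A. \<forall>Z\<in>vector_fields A.
        t X Y Z \<in> smooth_functions A \<and>
        t X Y Z = - t Y X Z \<and> t X Y Z = - t X Z Y \<and>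
        (\<forall>W\<in>vector_fields A. t (X + W) Y Z = t X Y Z + t W Y Z) \<and>
        (\<forall>f\<in>smooth_functions A. t (fscale f X) Y Z = f * t X Y Z))"


section \<open>Connections\<close>

text \<open>
  Connections act on global smooth vector fields. The last clause only fixes the value of the total HOL function \<^term>\<open>D\<close> on arguments that are
  not vector fields, so that equality of connections is equality as maps on vector fields.
\<close>

definition affine_connection ::
  "('a::topological_space, 'e::euclidean_space) chart set \<Rightarrow> 'a connection \<Rightarrow> bool" where
  "affine_connection A D \<longleftrightarrow>
     (\<forall>X\<in>vector_fields A. \<forall>Y\<in>vector_fields A. D X Y \<in> vector_fields A) \<and>
     (\<forall>X\<in>vector_fields A. \<forall>X'\<in>vector_fields A. \<forall>Y\<in>vector_fields A.
        D (X + X') Y = D X Y + D X' Y) \<and>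
     (\<forall>f\<in>smooth_functions A. \<forall>X\<in>vector_fields A. \<forall>Y\<in>vector_fields A.
        D (fscale f X) Y = fscale f (D X Y)) \<and>
     (\<forall>X\<in>vector_fields A. \<forall>Y\<in>vector_fields A. \<forall>Y'\<in>vector_fields A.
        D X (Y + Y') = D X Y + D X Y') \<and>
     (\<forall>f\<in>smooth_functions A. \<forall>X\<in>vector_fields A. \<forall>Y\<in>vector_fields A.
        D X (fscale f Y) = fscale (deriv_along X f) Y + fscale f (D X Y)) \<and>
     (\<forall>X Y. X \<notin> vector_fields A \<or> Y \<notin> vector_fields A \<longrightarrow> D X Y = 0)"

definition torsion :: "'a connection \<Rightarrow> 'a vfield \<Rightarrow> 'a vfield \<Rightarrow> 'a vfield" where
  "torsion D X Y = D X Y - D Y X - lie_bracket X Y"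

definition cov_form1 :: "'a connection \<Rightarrow> 'a form1 \<Rightarrow> 'a vfield \<Rightarrow> 'a vfield \<Rightarrow> ('a \<Rightarrow> real)" where
  "cov_form1 D \<eta> X Y = deriv_along X (app1 \<eta> Y) - app1 \<eta> (D X Y)"

definition cov_form2 ::
  "'a connection \<Rightarrow> 'a form2 \<Rightarrow> 'a vfield \<Rightarrow> 'a vfield \<Rightarrow> 'a vfield \<Rightarrow> ('a \<Rightarrow> real)" where
  "cov_form2 D b X Y Z = deriv_along X (app2 b Y Z) - app2 b (D X Y) Z - app2 b Y (D X Z)"

definition cov_endo :: "'a connection \<Rightarrow> 'a endo \<Rightarrow> 'a vfield \<Rightarrow> 'a vfield \<Rightarrow> 'a vfield" where
  "cov_endo D \<phi> X Y = D X (appE \<phi> Y) - appE \<phi> (D X Y)"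

definition metric_connection ::
  "('a::topological_space, 'e::euclidean_space) chart set \<Rightarrow> 'a form2 \<Rightarrow> 'a connection \<Rightarrow> bool" where
  "metric_connection A g D \<longleftrightarrow> affine_connection A D \<and>
     (\<forall>X\<in>vector_fields A. \<forall>Y\<in>vector_fields A. \<forall>Z\<in>vector_fields A. cov_form2 D g X Y Z = 0)"

definition levi_civita ::
  "('a::topological_space, 'e::euclidean_space) chart set \<Rightarrow> 'a form2 \<Rightarrow> 'a connection" where
  "levi_civita A g = (THE D. metric_connection A g D \<and>
     (\<forall>X\<in>vector_fields A. \<forall>Y\<in>vector_fields A. torsion D X Y = 0))"

definition has_skew_torsion ::
  "('a::topological_space, 'e::euclidean_space) chart set \<Rightarrow> 'a form2 \<Rightarrow> 'a connection \<Rightarrow> bool" where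
  "has_skew_torsion A g D \<longleftrightarrow> three_form A (\<lambda>X Y Z. app2 g (torsion D X Y) Z)"


section \<open>Metric f-manifolds\<close>

locale metric_f_manifold = smooth_manifold A
  for A :: "('a::{t2_space, second_countable_topology}, 'e::euclidean_space) chart set" +
  fixes n s :: nat
    and \<phi> :: "'a endo"
    and \<xi> :: "nat \<Rightarrow> 'a vfield"
    and \<eta> :: "nat \<Rightarrow> 'a form1"
    and g :: "'a form2"
  assumes dimension: "DIM('e) = 2 * n + s"
    and phi_tensor: "endo_field A \<phi>"
    and xi_vfield: "\<And>i. i \<in> {1..s} \<Longrightarrow> \<xi> i \<in> vector_fields A"
    and eta_form: "\<And>i. i \<in> {1..s} \<Longrightarrow> one_form A (\<eta> i)"
    and metric: "riemannian_metric A g"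
    and phi_rank: "\<And>p. tv.dim (\<phi> p ` tangent_space A p) = 2 * n"
    and phi_cubed: "\<And>p v. v \<in> tangent_space A p \<Longrightarrow> \<phi> p (\<phi> p (\<phi> p v)) + \<phi> p v = 0"
    and phi_kernel: "\<And>p. {v \<in> tangent_space A p. \<phi> p v = 0} = tv.span ((\<lambda>i. \<xi> i p) ` {1..s})"
    and eta_xi: "\<And>p i j. i \<in> {1..s} \<Longrightarrow> j \<in> {1..s} \<Longrightarrow> \<eta> i p (\<xi> j p) = (if i = j then 1 else 0)"
    and eta_phi: "\<And>p i v. i \<in> {1..s} \<Longrightarrow> v \<in> tangent_space A p \<Longrightarrow> \<eta> i p (\<phi> p v) = 0"
    and phi_squared: "\<And>p v. v \<in> tangent_space A p \<Longrightarrow>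
          \<phi> p (\<phi> p v) = - v + (\<Sum>i=1..s. tscale (\<eta> i p v) (\<xi> i p))"
    and phi_metric: "\<And>p u v. u \<in> tangent_space A p \<Longrightarrow> v \<in> tangent_space A p \<Longrightarrow>
          g p (\<phi> p u) (\<phi> p v) = g p u v - (\<Sum>i=1..s. \<eta> i p u * \<eta> i p v)"

definition fundamental_form :: "'a endo \<Rightarrow> 'a form2 \<Rightarrow> 'a form2" where
  "fundamental_form \<phi> g = (\<lambda>p u v. g p u (\<phi> p v))"

definition nijenhuis :: "'a endo \<Rightarrow> 'a vfield \<Rightarrow> 'a vfield \<Rightarrow> 'a vfield" where
  "nijenhuis \<phi> X Y = lie_bracket (appE \<phi> X) (appE \<phi> Y) + appE \<phi> (appE \<phi> (lie_bracket X Y))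
     - appE \<phi> (lie_bracket X (appE \<phi> Y)) - appE \<phi> (lie_bracket (appE \<phi> X) Y)"

definition normality_tensor ::
  "nat \<Rightarrow> 'a endo \<Rightarrow> (nat \<Rightarrow> 'a vfield) \<Rightarrow> (nat \<Rightarrow> 'a form1) \<Rightarrow> 'a vfield \<Rightarrow> 'a vfield \<Rightarrow> 'a vfield" where
  "normality_tensor s \<phi> \<xi> \<eta> X Y = nijenhuis \<phi> X Y + (\<Sum>i=1..s. fscale (d1 (\<eta> i) X Y) (\<xi> i))"

locale K_manifold = metric_f_manifold +
  assumes normal: "\<And>X Y. X \<in> vector_fields A \<Longrightarrow> Y \<in> vector_fields A \<Longrightarrow>
      normality_tensor s \<phi> \<xi> \<eta> X Y = 0"
    and fundamental_closed: "\<And>X Y Z. X \<in> vector_fields A \<Longrightarrow> Y \<in> vector_fields A \<Longrightarrow>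
      Z \<in> vector_fields A \<Longrightarrow> d2 (fundamental_form \<phi> g) X Y Z = 0"

definition almost_metric_phi_connection ::
  "('a::topological_space, 'e::euclidean_space) chart set \<Rightarrow> nat \<Rightarrow> 'a endo \<Rightarrow>
   (nat \<Rightarrow> 'a vfield) \<Rightarrow> (nat \<Rightarrow> 'a form1) \<Rightarrow> 'a form2 \<Rightarrow> 'a connection \<Rightarrow> bool" where
  "almost_metric_phi_connection A s \<phi> \<xi> \<eta> g D \<longleftrightarrow>
     metric_connection A g D \<and>
     (\<forall>X\<in>vector_fields A. \<forall>Y\<in>vector_fields A. cov_endo D \<phi> X Y = 0) \<and>
     (\<forall>i\<in>{1..s}. \<forall>X\<in>vector_fields A. D X (\<xi> i) = 0) \<and>
     (\<forall>i\<in>{1..s}. \<forall>X\<in>vector_fields A. \<forall>Y\<in>vector_fields A. cov_form1 D (\<eta> i) X Y = 0)"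

end

theory Submission
  imports Defs
begin

text \<open>
  \<^bold>\<open>Uniqueness.\<close> A metric connection whose torsion is a 3-form \<open>t\<close> satisfies a Koszul formula in
  which \<open>t\<close> enters linearly. Hence the connection is \<open>\<nabla>\<^sup>g + t/2\<close>, it is determined by \<open>t\<close>, and
  every 3-form \<open>t\<close> occurs. Only the torsion of an almost metric \<open>\<phi>\<close>-connection has to be identified. Parallelism of
  \<open>\<eta>\<^sub>i\<close> gives \<open>t(X, Y, \<xi>\<^sub>i) = d\<eta>\<^sub>i(X, Y)\<close>. Parallelism of \<open>\<phi>\<close> turns \<open>N\<^sup>(\<^sup>1\<^sup>) = 0\<close> and \<open>dF = 0\<close> into
  two algebraic identities for \<open>t\<close>, which together give
  \<open>t(\<phi>X, \<phi>Y, Z) = \<Sum>\<^sub>i \<eta>\<^sub>i(Z) d\<eta>\<^sub>i(X, Y)\<close>. The form \<open>\<Sum>\<^sub>j \<eta>\<^sub>j \<and> d\<eta>\<^sub>j\<close> has the same two properties, and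
  a 3-form is determined by them because \<open>X = - \<phi>\<^sup>2X + \<Sum>\<^sub>i \<eta>\<^sub>i(X) \<xi>\<^sub>i\<close> (lemma \<open>skew_torsion_eq\<close>).

  \<^bold>\<open>Existence.\<close> Let \<open>D\<close> be the metric connection with torsion \<open>\<Sum>\<^sub>j \<eta>\<^sub>j \<and> d\<eta>\<^sub>j\<close>. Normality and \<open>dF = 0\<close>
  make every \<open>\<xi>\<^sub>i\<close> a Killing field, which forces \<open>D\<xi>\<^sub>i = 0\<close> and hence \<open>D\<eta>\<^sub>i = 0\<close>
  (lemma \<open>parallel_xi\<close>). The defect \<open>b(X, Y, Z) = g((D\<^sub>X\<phi>)Y, Z)\<close> then satisfies the symmetries known
  from the proof that a Hermitian manifold with closed fundamental form is a Kaehler manifold, and these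
  leave only \<open>b = 0\<close> (lemma \<open>parallel_phi\<close>).

  \<^bold>\<open>Foundations.\<close> Both halves rest on the existence of connections given by a Koszul formula, that is, on
  representing a form on the module of vector fields, linear over the smooth functions, as \<open>g(W, _)\<close>
  for a smooth field \<open>W\<close> (lemma \<open>riesz_vfield\<close>). This holds because such forms are local, which
  follows from cutoff functions, and because coordinate fields span every nearby tangent space, which for
  tangent vectors in the sense of derivations is Hadamard's lemma; Gram--Schmidt turns these fields into
  an orthogonal frame, from which \<open>W\<close> is read off.
\<close>

section \<open>Calculus of functions of class C^k\<close>

lemma Ck_on_cong:
  assumes "open S" "Ck_on k S f" "\<And>x. x \<in> S \<Longrightarrow> f x = g x"
  shows "Ck_on k S g"
  using assms(2,3)
proof (induction k arbitrary: f g)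
  case 0
  then show ?case by (auto cong: continuous_on_cong)
next
  case (Suc k)
  have D: "(g has_derivative frechet_derivative f (at x)) (at x)" if x: "x \<in> S" for x
  proof (rule has_derivative_transform_within_open[OF _ \<open>open S\<close> x])
    show "(f has_derivative frechet_derivative f (at x)) (at x)"
      using Suc.prems(1) x frechet_derivative_works by auto
  qed (use Suc.prems(2) in auto)
  have "Ck_on k S (\<lambda>x. frechet_derivative g (at x) v)" for v
  proof (rule Suc.IH)
    show "Ck_on k S (\<lambda>x. frechet_derivative f (at x) v)" using Suc.prems(1) by simp
    show "frechet_derivative f (at x) v = frechet_derivative g (at x) v" if "x \<in> S" for x
      using frechet_derivative_at[OF D[OF that]] by simp
  qed
  moreover have "\<forall>x\<in>S. g differentiable (at x)"
    using D differentiableI by blast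
  ultimately show ?case by simp
qed

lemma Ck_on_SucI:
  assumes "open S" "\<And>x. x \<in> S \<Longrightarrow> (f has_derivative f' x) (at x)"
    "\<And>v. Ck_on k S (\<lambda>x. f' x v)"
  shows "Ck_on (Suc k) S f"
proof -
  have D: "frechet_derivative f (at x) = f' x" if "x \<in> S" for x
    using frechet_derivative_at[OF assms(2)[OF that]] by simp
  have "Ck_on k S (\<lambda>x. frechet_derivative f (at x) v)" for v
    by (rule Ck_on_cong[OF assms(1) assms(3)[of v]]) (simp add: D)
  moreover have "\<forall>x\<in>S. f differentiable (at x)"
    using assms(2) differentiableI by blast
  ultimately show ?thesis by simp
qed

lemma Ck_on_SucD:
  assumes "Ck_on (Suc k) S f"
  shows "x \<in> S \<Longrightarrow> (f has_derivative frechet_derivative f (at x)) (at x)"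
    "Ck_on k S (\<lambda>x. frechet_derivative f (at x) v)"
  using assms frechet_derivative_works by auto

lemma Ck_on_imp_continuous_on: "Ck_on k S f \<Longrightarrow> continuous_on S f"
  by (cases k) (auto intro!: differentiable_imp_continuous_on
      simp: differentiable_on_def differentiable_at_withinI)

lemma Ck_on_Suc_imp: "Ck_on (Suc k) S f \<Longrightarrow> Ck_on k S f"
proof (induction k arbitrary: f)
  case 0
  then show ?case using Ck_on_imp_continuous_on[OF 0] by simp
next
  case (Suc k)
  have "\<forall>x\<in>S. f differentiable (at x)" using Suc.prems by simp
  moreover have "Ck_on (Suc k) S (\<lambda>x. frechet_derivative f (at x) v)" for v
    using Suc.prems Ck_on.simps(2)[of "Suc k" S f] by blast
  ultimately show ?case using Suc.IH Ck_on.simps(2)[of k S f] by blast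
qed

lemma Ck_on_subset: "Ck_on k S f \<Longrightarrow> T \<subseteq> S \<Longrightarrow> Ck_on k T f"
  by (induction k arbitrary: f) (auto intro: continuous_on_subset)

lemma Ck_on_local:
  assumes "\<And>x. x \<in> S \<Longrightarrow> \<exists>V. open V \<and> x \<in> V \<and> Ck_on k V f"
  shows "Ck_on k S f"
  using assms
proof (induction k arbitrary: f)
  case 0
  have "isCont f x" if "x \<in> S" for x
    using 0[OF that] continuous_on_eq_continuous_at by fastforce
  then show ?case by (simp add: continuous_at_imp_continuous_on)
next
  case (Suc k)
  then show ?case
    by (force intro!: Suc.IH)
qed

lemma Ck_on_const:
  assumes "open S" shows "Ck_on k S (\<lambda>x. c)"
proof (induction k arbitrary: c)
  case (Suc k)
  show ?case
    by (rule Ck_on_SucI[where f' = "\<lambda>x v. 0"]) (use assms Suc.IH in auto)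
qed simp

lemma Ck_on_linear:
  assumes "open S" "bounded_linear f" shows "Ck_on k S f"
proof (cases k)
  case 0
  then show ?thesis using linear_continuous_on[OF assms(2)] by simp
next
  case (Suc j)
  show ?thesis
    unfolding Suc
    by (rule Ck_on_SucI[where f' = "\<lambda>x. f"])
       (use assms Ck_on_const[OF assms(1)] in \<open>auto simp: bounded_linear_imp_has_derivative\<close>)
qed

lemma Ck_on_bounded_linear:
  assumes "open S" "bounded_linear h" "Ck_on k S f"
  shows "Ck_on k S (\<lambda>x. h (f x))"
  using assms(3)
proof (induction k arbitrary: f)
  case 0
  then show ?case using assms(2) by (simp add: bounded_linear.continuous_on)
next
  case (Suc k)
  show ?case
    by (rule Ck_on_SucI[where f' = "\<lambda>x v. h (frechet_derivative f (at x) v)"])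
       (use Ck_on_SucD[OF Suc.prems] assms(1,2) Suc.IH in
         \<open>auto simp: bounded_linear.has_derivative simp del: Ck_on.simps\<close>)
qed

lemma Ck_on_add:
  assumes "open S" "Ck_on k S f" "Ck_on k S g"
  shows "Ck_on k S (\<lambda>x. f x + g x)"
  using assms(2,3)
proof (induction k arbitrary: f g)
  case 0
  then show ?case by (simp add: continuous_on_add)
next
  case (Suc k)
  show ?case
    by (rule Ck_on_SucI[where f' = "\<lambda>x v. frechet_derivative f (at x) v + frechet_derivative g (at x) v"])
       (use Ck_on_SucD[OF Suc.prems(1)] Ck_on_SucD[OF Suc.prems(2)] assms(1) Suc.IH in
         \<open>auto intro: has_derivative_add simp del: Ck_on.simps\<close>)
qed

lemma Ck_on_sum:
  assumes "open S" "\<And>i. i \<in> I \<Longrightarrow> Ck_on k S (f i)"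
  shows "Ck_on k S (\<lambda>x. \<Sum>i\<in>I. f i x)"
  using assms(2)
  by (induction I rule: infinite_finite_induct)
     (auto intro: Ck_on_const[OF assms(1)] Ck_on_add[OF assms(1)])

lemma Ck_on_mult:
  fixes f g :: "'e::euclidean_space \<Rightarrow> real"
  assumes "open S" "Ck_on k S f" "Ck_on k S g"
  shows "Ck_on k S (\<lambda>x. f x * g x)"
  using assms(2,3)
proof (induction k arbitrary: f g)
  case 0
  then show ?case by (simp add: continuous_on_mult)
next
  case (Suc k)
  note f = Ck_on_SucD[OF Suc.prems(1)] Ck_on_Suc_imp[OF Suc.prems(1)]
  note g = Ck_on_SucD[OF Suc.prems(2)] Ck_on_Suc_imp[OF Suc.prems(2)]
  show ?case
    by (rule Ck_on_SucI[where f' = "\<lambda>x v. f x * frechet_derivative g (at x) v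
          + frechet_derivative f (at x) v * g x"])
       (use f g assms(1) Suc.IH in \<open>auto intro!: has_derivative_mult Ck_on_add simp del: Ck_on.simps\<close>)
qed

lemma Ck_on_inverse:
  fixes f :: "'e::euclidean_space \<Rightarrow> real"
  assumes "open S" "Ck_on k S f" "\<And>x. x \<in> S \<Longrightarrow> f x \<noteq> 0"
  shows "Ck_on k S (\<lambda>x. inverse (f x))"
  using assms(2)
proof (induction k)
  case 0
  then show ?case using assms(3) by (simp add: continuous_on_inverse)
next
  case (Suc k)
  note f = Ck_on_SucD[OF Suc.prems(1)] Ck_on_Suc_imp[OF Suc.prems(1)]
  have "((\<lambda>x. inverse (f x)) has_derivative
      (\<lambda>v. (- 1) * ((inverse (f x) * frechet_derivative f (at x) v) * inverse (f x)))) (at x)"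
    if "x \<in> S" for x
    using Deriv.has_derivative_inverse[OF assms(3)[OF that] f(1)[OF that]] by (simp add: mult.commute)
  then show ?case
    by (intro Ck_on_SucI[where f' = "\<lambda>x v. (- 1) * ((inverse (f x) * frechet_derivative f (at x) v)
          * inverse (f x))"] Ck_on_mult Ck_on_const assms(1) f Suc.IH)
qed

text \<open>
  Expanding the outer derivative in the standard basis makes the derivative of the composite a finite sum
  of products, so that the induction on \<open>k\<close> runs over real-valued outer functions only.
\<close>

lemma Ck_on_compose:
  fixes f :: "'d::euclidean_space \<Rightarrow> real" and g :: "'e::euclidean_space \<Rightarrow> 'd"
  assumes "open S" "open T" "Ck_on k S g" "Ck_on k T f" "g ` S \<subseteq> T"
  shows "Ck_on k S (\<lambda>x. f (g x))"
  using assms(3,4)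
proof (induction k arbitrary: f)
  case 0
  then show ?case using continuous_on_compose2[of T f S g] assms(5) by simp
next
  case (Suc k)
  note f = Ck_on_SucD[OF Suc.prems(2)] Ck_on_Suc_imp[OF Suc.prems(2)]
  note g = Ck_on_SucD[OF Suc.prems(1)] Ck_on_Suc_imp[OF Suc.prems(1)]
  let ?f' = "\<lambda>y. frechet_derivative f (at y)" and ?g' = "\<lambda>x. frechet_derivative g (at x)"
  have D: "((\<lambda>x. f (g x)) has_derivative (\<lambda>v. \<Sum>b\<in>Basis. (?g' x v \<bullet> b) * ?f' (g x) b)) (at x)"
    if x: "x \<in> S" for x
  proof -
    have fx: "(f has_derivative ?f' (g x)) (at (g x))" using f(1) x assms(5) by blast
    then interpret bounded_linear "?f' (g x)" by (rule has_derivative_bounded_linear)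
    have "?f' (g x) w = (\<Sum>b\<in>Basis. (w \<bullet> b) * ?f' (g x) b)" for w
      by (subst euclidean_representation[of w, symmetric], subst sum) (simp add: scaleR)
    then show ?thesis
      by (intro has_derivative_eq_rhs[OF has_derivative_compose[OF g(1)[OF x] fx]] ext)
  qed
  show ?case
    by (intro Ck_on_SucI[where f' = "\<lambda>x v. \<Sum>b\<in>Basis. (?g' x v \<bullet> b) * ?f' (g x) b"]
          Ck_on_sum Ck_on_mult assms(1) D Suc.IH[OF g(3) f(2)]
          Ck_on_bounded_linear[OF assms(1) bounded_linear_inner_left g(2)])
qed

section \<open>Cutoff functions\<close>

text \<open>
  The functions \<open>P(1/t) exp(-1/t)\<close>, extended by \<open>0\<close> to \<open>t \<le> 0\<close>. Allowing all polynomials \<open>P\<close> makes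
  the family closed under differentiation, so that smoothness follows by induction.
\<close>

definition flat :: "real poly \<Rightarrow> real \<Rightarrow> real" where
  "flat P t = (if t > 0 then poly P (inverse t) * exp (- inverse t) else 0)"

lemma tendsto_poly_div_exp_at_top: "((\<lambda>u. poly P u * exp (- u)) \<longlongrightarrow> (0::real)) at_top"
proof -
  have "((\<lambda>u. \<Sum>i\<le>degree P. coeff P i * (u ^ i / exp u)) \<longlongrightarrow> (\<Sum>i\<le>degree P. coeff P i * 0)) at_top"
    by (intro tendsto_intros tendsto_power_div_exp_0)
  moreover have "(\<lambda>u. poly P u * exp (- u)) = (\<lambda>u. \<Sum>i\<le>degree P. coeff P i * (u ^ i / exp u))"
    by (auto simp: poly_altdef sum_distrib_right exp_minus divide_inverse mult.assoc)
  ultimately show ?thesis by simp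
qed

lemma flat_tendsto_0: "(flat P \<longlongrightarrow> 0) (at 0)"
proof -
  have "((\<lambda>t. poly P (inverse t) * exp (- inverse t)) \<longlongrightarrow> 0) (at_right 0)"
    using filterlim_compose[OF tendsto_poly_div_exp_at_top filterlim_inverse_at_top_right] .
  then have "(flat P \<longlongrightarrow> 0) (at_right 0)"
    by (rule Lim_transform_eventually) (auto simp: eventually_at_filter flat_def)
  moreover have "(flat P \<longlongrightarrow> 0) (at_left 0)"
    by (rule Lim_transform_eventually[of "\<lambda>_. 0"]) (auto simp: eventually_at_filter flat_def)
  ultimately show ?thesis using filterlim_split_at by blast
qed

lemma flat_has_derivative:
  "(flat P has_real_derivative flat (monom 1 2 * (P - pderiv P)) t) (at t)"
proof (cases t "0::real" rule: linorder_cases)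
  case less
  have "(flat P has_real_derivative 0) (at t)"
    by (rule DERIV_cong[OF has_field_derivative_transform_within_open[of "\<lambda>_. 0" _ _ "{..<0}"]])
       (use less in \<open>auto simp: flat_def\<close>)
  then show ?thesis using less by (simp add: flat_def)
next
  case equal
  have "((\<lambda>h. flat (monom 1 1 * P) h) \<longlongrightarrow> 0) (at 0)" by (rule flat_tendsto_0)
  then have "((\<lambda>h. (flat P h - flat P 0) / (h - 0)) \<longlongrightarrow> 0) (at 0)"
    by (rule Lim_transform_eventually)
       (auto simp: flat_def eventually_at_filter poly_monom field_simps)
  then show ?thesis
    using equal by (simp add: flat_def has_field_derivative_iff)
next
  case greater
  have "((\<lambda>t. poly P (inverse t) * exp (- inverse t)) has_real_derivative
     flat (monom 1 2 * (P - pderiv P)) t) (at t)"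
    using greater
    by (auto intro!: derivative_eq_intros simp: flat_def poly_monom algebra_simps power2_eq_square)
  then show ?thesis
    by (rule has_field_derivative_transform_within_open[of _ _ _ "{0<..}"])
       (use greater in \<open>auto simp: flat_def\<close>)
qed

lemma Ck_on_flat: "Ck_on k UNIV (flat P)"
proof (induction k arbitrary: P)
  case 0
  then show ?case
    using DERIV_isCont[OF flat_has_derivative] by (auto simp: continuous_on_eq_continuous_at)
next
  case (Suc k)
  show ?case
    using flat_has_derivative
    by (intro Ck_on_SucI[where f' = "\<lambda>t v. flat (monom 1 2 * (P - pderiv P)) t * v"] Ck_on_mult Suc
        Ck_on_const) (auto simp: has_field_derivative_def)
qed

text \<open>
  With \<open>u\<close> the square of \<open>dist z z0 / r\<close>, the quotient is a smooth step: it is \<open>1\<close> for \<open>u \<le> 1\<close> and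
  \<open>0\<close> for \<open>u \<ge> 2\<close>, in particular outside the ball of radius \<open>2 * r\<close>.
\<close>

definition cutoff :: "'e::euclidean_space \<Rightarrow> real \<Rightarrow> 'e \<Rightarrow> real" where
  "cutoff z0 r z = (let u = (z - z0) \<bullet> (z - z0) / r\<^sup>2 in
     flat 1 (2 - u) * inverse (flat 1 (2 - u) + flat 1 (u - 1)))"

lemma flat_one_sign: "flat 1 t \<ge> 0" "flat 1 t = 0 \<longleftrightarrow> t \<le> 0"
  by (auto simp: flat_def)

lemma cutoff_denominator: "flat 1 (2 - u) + flat 1 (u - 1) > 0"
  using flat_one_sign[of "2 - u"] flat_one_sign[of "u - 1"] by (smt (verit))

lemma cutoff_bounds: "0 \<le> cutoff z0 r z" "cutoff z0 r z \<le> 1"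
  using cutoff_denominator flat_one_sign(1)
  by (auto simp: cutoff_def Let_def divide_inverse[symmetric] intro!: divide_nonneg_pos)

lemma cutoff_eq_1:
  assumes "r > 0" "dist z z0 \<le> r"
  shows "cutoff z0 r z = 1"
proof -
  have "(z - z0) \<bullet> (z - z0) / r\<^sup>2 \<le> 1"
    using assms power_mono[of "norm (z - z0)" r 2]
    by (simp add: dist_norm power2_norm_eq_inner)
  then show ?thesis
    using flat_one_sign(2)[of "(z - z0) \<bullet> (z - z0) / r\<^sup>2 - 1"] flat_one_sign(2)[of "2 - (z - z0) \<bullet> (z - z0) / r\<^sup>2"]
    by (simp add: cutoff_def Let_def)
qed

lemma cutoff_eq_0:
  assumes "r > 0" "dist z z0 \<ge> 2 * r"
  shows "cutoff z0 r z = 0"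
proof -
  have "(z - z0) \<bullet> (z - z0) / r\<^sup>2 \<ge> 4"
    using assms power_mono[of "2 * r" "norm (z - z0)" 2]
    by (simp add: dist_norm power2_norm_eq_inner field_simps)
  then show ?thesis
    using flat_one_sign(2)[of "2 - (z - z0) \<bullet> (z - z0) / r\<^sup>2"]
    by (simp add: cutoff_def Let_def)
qed

lemma Ck_on_cutoff: "Ck_on k UNIV (cutoff z0 r)"
proof -
  have c: "Ck_on k UNIV (\<lambda>z. (z - z0) \<bullet> b)" for b
    using Ck_on_add[OF open_UNIV Ck_on_linear[OF open_UNIV bounded_linear_inner_left[of b]]
        Ck_on_const[OF open_UNIV], of k "- (z0 \<bullet> b)"]
    by (simp add: inner_diff_left)
  have "Ck_on k UNIV (\<lambda>z. \<Sum>b\<in>Basis. ((z - z0) \<bullet> b) * ((z - z0) \<bullet> b))"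
    by (intro Ck_on_sum Ck_on_mult c open_UNIV)
  moreover have "(z - z0) \<bullet> (z - z0) = (\<Sum>b\<in>Basis. ((z - z0) \<bullet> b) * ((z - z0) \<bullet> b))" for z
    by (rule euclidean_inner)
  ultimately have q: "Ck_on k UNIV (\<lambda>z. (z - z0) \<bullet> (z - z0))" by presburger
  have aff: "Ck_on k UNIV (\<lambda>z. a + b * ((z - z0) \<bullet> (z - z0)))" for a b
    by (intro Ck_on_add Ck_on_mult Ck_on_const q open_UNIV)
  have "Ck_on k UNIV (\<lambda>z. flat 1 (a + b * ((z - z0) \<bullet> (z - z0))))" for a b
    by (rule Ck_on_compose[OF open_UNIV open_UNIV aff Ck_on_flat]) auto
  from this[of 2 "- inverse (r\<^sup>2)"] this[of "- 1" "inverse (r\<^sup>2)"]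
  have f: "Ck_on k UNIV (\<lambda>z. flat 1 (2 - (z - z0) \<bullet> (z - z0) / r\<^sup>2))"
    "Ck_on k UNIV (\<lambda>z. flat 1 ((z - z0) \<bullet> (z - z0) / r\<^sup>2 - 1))"
    by (simp_all add: field_simps)
  show ?thesis
    unfolding cutoff_def Let_def
    by (intro Ck_on_mult Ck_on_inverse Ck_on_add f open_UNIV) (metis cutoff_denominator less_irrefl)
qed

section \<open>Hadamard's lemma\<close>

text \<open>
  The factor \<open>t ^ m\<close> is there for the induction: each differentiation under the integral sign yields an
  integral of the same shape for a directional derivative of \<open>F\<close>, with one more factor \<open>t\<close>.
\<close>

lemma Ck_on_ray_integral:
  fixes F :: "'e::euclidean_space \<Rightarrow> real"
  assumes S: "open S" "convex S" "z0 \<in> S" and "smooth_on S F"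
  shows "Ck_on k S (\<lambda>x. integral (cbox 0 1) (\<lambda>t. t ^ m * F (z0 + t *\<^sub>R (x - z0))))"
  using assms(4)
proof (induction k arbitrary: m F)
  case 0
  have in_S: "z0 + t *\<^sub>R (x - z0) \<in> S" if "x \<in> S" "t \<in> cbox 0 1" for x and t :: real
    using convexD_alt[OF S(2,3) that(1), of t] that(2) by (auto simp: algebra_simps)
  have "continuous_on S F" using 0 Ck_on_imp_continuous_on unfolding smooth_on_def by blast
  then have "continuous_on (S \<times> cbox 0 1) (\<lambda>(x, t). t ^ m * F (z0 + t *\<^sub>R (x - z0)))"
    unfolding split_beta
    by (auto intro!: continuous_intros continuous_on_compose2[of S F] in_S)
  then show ?case
    by (simp only: Ck_on.simps(1)) (rule integral_continuous_on_param)
next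
  case (Suc k)
  have in_S: "z0 + t *\<^sub>R (x - z0) \<in> S" if "x \<in> S" "t \<in> cbox 0 1" for x and t :: real
    using convexD_alt[OF S(2,3) that(1), of t] that(2) by (auto simp: algebra_simps)
  let ?F' = "\<lambda>y. frechet_derivative F (at y)"
  have F: "Ck_on (Suc j) S F" for j using Suc.prems unfolding smooth_on_def by blast
  have smooth': "smooth_on S (\<lambda>y. ?F' y v)" for v
    using Ck_on_SucD(2)[OF F] unfolding smooth_on_def by blast
  have cont: "continuous_on S (\<lambda>y. ?F' y v)" "continuous_on S F" for v
    using Ck_on_imp_continuous_on[OF Ck_on_SucD(2)[OF F]] Ck_on_imp_continuous_on[OF F[of 0]] by auto
  define fx where "fx x t = (\<Sum>b\<in>Basis. (t ^ Suc m * ?F' (z0 + t *\<^sub>R (x - z0)) b) *\<^sub>R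
      (blinfun_inner_left b :: 'e \<Rightarrow>\<^sub>L real))" for x t
  have fx: "blinfun_apply (fx x t) v = t ^ Suc m * ?F' (z0 + t *\<^sub>R (x - z0)) v"
    if "x \<in> S" "t \<in> cbox 0 1" for x t v
  proof -
    interpret bounded_linear "?F' (z0 + t *\<^sub>R (x - z0))"
      using Ck_on_SucD(1)[OF F in_S[OF that]] by (rule has_derivative_bounded_linear)
    have "?F' (z0 + t *\<^sub>R (x - z0)) v = (\<Sum>b\<in>Basis. (v \<bullet> b) * ?F' (z0 + t *\<^sub>R (x - z0)) b)"
      by (subst euclidean_representation[of v, symmetric], subst sum) (simp add: scaleR)
    then show ?thesis
      by (simp add: fx_def blinfun.sum_left blinfun.scaleR_left sum_distrib_left algebra_simps
          inner_commute)
  qed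
  have cfx: "continuous_on (S \<times> cbox 0 1) (\<lambda>(x, t). fx x t)"
    unfolding split_beta fx_def
    by (intro continuous_intros continuous_on_compose2[OF cont(1)]) (use in_S in auto)
  have int: "(\<lambda>t. t ^ m * F (z0 + t *\<^sub>R (x - z0))) integrable_on cbox 0 1" if "x \<in> S" for x
    by (intro integrable_continuous continuous_intros continuous_on_compose2[OF cont(2)])
       (use in_S that in auto)
  have D: "((\<lambda>x. integral (cbox 0 1) (\<lambda>t. t ^ m * F (z0 + t *\<^sub>R (x - z0)))) has_derivative
      (\<lambda>v. integral (cbox 0 1) (\<lambda>t. t ^ Suc m * ?F' (z0 + t *\<^sub>R (x - z0)) v))) (at x)"
    if x: "x \<in> S" for x
  proof -
    have "((\<lambda>x. t ^ m * F (z0 + t *\<^sub>R (x - z0))) has_derivative blinfun_apply (fx x t)) (at x within S)"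
      if "x \<in> S" "t \<in> cbox 0 1" for x t
    proof -
      have fx': "blinfun_apply (fx x t) = (\<lambda>v. t ^ m * ?F' (z0 + t *\<^sub>R (x - z0)) (t *\<^sub>R v))"
        using fx[OF that] linear_cmul[OF has_derivative_linear[OF Ck_on_SucD(1)[OF F in_S[OF that]]]]
        by (auto simp: fun_eq_iff)
      have "((\<lambda>x. z0 + t *\<^sub>R (x - z0)) has_derivative (\<lambda>v. t *\<^sub>R v)) (at x)"
        by (auto intro!: derivative_eq_intros)
      from has_derivative_compose[OF this Ck_on_SucD(1)[OF F in_S[OF that]]]
      have "((\<lambda>x. F (z0 + t *\<^sub>R (x - z0))) has_derivative (\<lambda>v. ?F' (z0 + t *\<^sub>R (x - z0)) (t *\<^sub>R v))) (at x)" .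
      from has_derivative_mult_right[OF this, of "t ^ m"]
      show ?thesis unfolding fx' by (rule has_derivative_at_withinI)
    qed
    from leibniz_rule[OF this int cfx x S(2)]
    have *: "((\<lambda>x. integral (cbox 0 1) (\<lambda>t. t ^ m * F (z0 + t *\<^sub>R (x - z0)))) has_derivative
      blinfun_apply (integral (cbox 0 1) (fx x))) (at x)"
      using at_within_open[OF x S(1)] by simp
    have "continuous_on (cbox 0 1) (fx x)"
      using continuous_on_compose2[OF cfx continuous_on_Pair[OF continuous_on_const continuous_on_id]] x
      by auto
    then have "fx x integrable_on cbox 0 1" by (rule integrable_continuous)
    from integral_linear[OF this, of "\<lambda>h. blinfun_apply h v" for v]
    have "blinfun_apply (integral (cbox 0 1) (fx x)) v = integral (cbox 0 1) (\<lambda>t. blinfun_apply (fx x t) v)" for v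
      by (simp add: o_def blinfun.bounded_linear_left)
    also have "\<dots> v = integral (cbox 0 1) (\<lambda>t. t ^ Suc m * ?F' (z0 + t *\<^sub>R (x - z0)) v)" for v
      by (rule integral_cong) (rule fx[OF x])
    finally show ?thesis by (intro has_derivative_eq_rhs[OF *] ext)
  qed
  show ?case
    by (rule Ck_on_SucI[OF S(1) D]) (assumption, rule Suc.IH[OF smooth'])
qed

text \<open>
  The fundamental theorem of calculus along the segment from \<open>z0\<close> to \<open>x\<close>; \<open>h b\<close> is the integral of the
  \<open>b\<close>-th partial derivative over the segment.
\<close>

lemma hadamard_lemma:
  fixes F :: "'e::euclidean_space \<Rightarrow> real"
  assumes S: "open S" "convex S" "z0 \<in> S" and F: "smooth_on S F"
  obtains h where "\<And>b. smooth_on S (h b)" "\<And>b. h b z0 = frechet_derivative F (at z0) b"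
    "\<And>x. x \<in> S \<Longrightarrow> F x = F z0 + (\<Sum>b\<in>Basis. ((x - z0) \<bullet> b) * h b x)"
proof
  let ?F' = "\<lambda>y. frechet_derivative F (at y)"
  let ?h = "\<lambda>b x. integral (cbox 0 1) (\<lambda>t. t ^ 0 * ?F' (z0 + t *\<^sub>R (x - z0)) b)"
  have F1: "Ck_on (Suc j) S F" for j using F unfolding smooth_on_def by blast
  have smooth': "smooth_on S (\<lambda>y. ?F' y v)" for v
    using Ck_on_SucD(2)[OF F1] unfolding smooth_on_def by blast
  show "smooth_on S (?h b)" for b
    unfolding smooth_on_def using Ck_on_ray_integral[OF S smooth'] by blast
  show "?h b z0 = ?F' z0 b" for b by simp
  show "F x = F z0 + (\<Sum>b\<in>Basis. ((x - z0) \<bullet> b) * ?h b x)" if x: "x \<in> S" for x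
  proof -
    have in_S: "z0 + t *\<^sub>R (x - z0) \<in> S" if "t \<in> {0..1}" for t :: real
      using convexD_alt[OF S(2,3) x, of t] that by (auto simp: algebra_simps)
    have cont: "continuous_on S (\<lambda>y. ?F' y v)" for v
      using Ck_on_imp_continuous_on[OF Ck_on_SucD(2)[OF F1]] by auto
    have "((\<lambda>t. F (z0 + t *\<^sub>R (x - z0))) has_vector_derivative ?F' (z0 + t *\<^sub>R (x - z0)) (x - z0))
        (at t within {0..1})" if "t \<in> {0..1}" for t
    proof -
      have "((\<lambda>t. z0 + t *\<^sub>R (x - z0)) has_derivative (\<lambda>d. d *\<^sub>R (x - z0))) (at t)"
        by (auto intro!: derivative_eq_intros)
      from has_derivative_compose[OF this Ck_on_SucD(1)[OF F1 in_S[OF that]]]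
      show ?thesis
        using linear_cmul[OF has_derivative_linear[OF Ck_on_SucD(1)[OF F1 in_S[OF that]]]]
        by (auto simp: has_vector_derivative_def intro: has_derivative_at_withinI)
    qed
    from fundamental_theorem_of_calculus[OF _ this]
    have "integral {0..1} (\<lambda>t. ?F' (z0 + t *\<^sub>R (x - z0)) (x - z0)) = F x - F z0"
      by (intro integral_unique) auto
    moreover have "integral {0..1} (\<lambda>t. ?F' (z0 + t *\<^sub>R (x - z0)) (x - z0)) =
      integral {0..1} (\<lambda>t. \<Sum>b\<in>Basis. ((x - z0) \<bullet> b) * ?F' (z0 + t *\<^sub>R (x - z0)) b)"
    proof (rule integral_cong)
      fix t :: real assume "t \<in> {0..1}"
      then interpret bounded_linear "?F' (z0 + t *\<^sub>R (x - z0))"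
        using has_derivative_bounded_linear[OF Ck_on_SucD(1)[OF F1 in_S]] by blast
      show "?F' (z0 + t *\<^sub>R (x - z0)) (x - z0) =
          (\<Sum>b\<in>Basis. ((x - z0) \<bullet> b) * ?F' (z0 + t *\<^sub>R (x - z0)) b)"
        by (subst euclidean_representation[of "x - z0", symmetric], subst sum) (simp add: scaleR)
    qed
    moreover have "\<dots> = (\<Sum>b\<in>Basis. ((x - z0) \<bullet> b) * ?h b x)"
    proof -
      have "(\<lambda>t. ?F' (z0 + t *\<^sub>R (x - z0)) b) integrable_on {0..1}" for b
        by (intro integrable_continuous_interval continuous_intros continuous_on_compose2[OF cont])
           (use in_S in auto)
      then show ?thesis
        by (subst integral_sum) (auto intro!: integrable_on_mult_right)
    qed
    ultimately show ?thesis by simp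
  qed
qed

section \<open>Smooth functions and tangent vectors\<close>

lemma sum_fun_apply: "(\<Sum>i\<in>I. f i) x = (\<Sum>i\<in>I. f i x)"
  by (induction I rule: infinite_finite_induct) auto

context smooth_manifold
begin

abbreviation (input) "C \<equiv> smooth_functions A"
abbreviation (input) "VF \<equiv> vector_fields A"
abbreviation (input) "T \<equiv> tangent_space A"

lemma chart_at:
  obtains U x where "(U, x) \<in> A" "p \<in> U"
  using atlas unfolding smooth_atlas_def by blast

lemma chartD:
  assumes "(U, x) \<in> A"
  shows "open U" "open (x ` U)" "inj_on x U" "continuous_on U x"
    "continuous_on (x ` U) (inv_into U x)"
  using assms atlas by (auto simp: smooth_atlas_def is_chart_def homeomorphism_def)

lemma chart_open_image:
  assumes "(U, x) \<in> A" "open W" "W \<subseteq> U"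
  shows "open (x ` W)"
proof -
  have "x ` W = x ` U \<inter> inv_into U x -` W"
    using assms(3) chartD(3)[OF assms(1)] by (auto simp: inv_into_f_f)
  then show ?thesis
    using continuous_open_preimage[OF chartD(5,2)[OF assms(1)] assms(2)] by simp
qed

lemma smooth_functionsI:
  assumes "\<And>U x k. (U, x) \<in> A \<Longrightarrow> Ck_on k (x ` U) (f \<circ> inv_into U x)"
  shows "f \<in> C"
  using assms by (auto simp: smooth_functions_def smooth_on_def)

lemma smooth_functionsD:
  assumes "f \<in> C" "(U, x) \<in> A"
  shows "Ck_on k (x ` U) (f \<circ> inv_into U x)"
  using assms by (auto simp: smooth_functions_def smooth_on_def)

lemma smooth_const [simp, intro]: "(\<lambda>q. c) \<in> C"
  by (rule smooth_functionsI) (auto simp: o_def chartD intro: Ck_on_const)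

lemma smooth_zero [simp, intro]: "0 \<in> C"
  unfolding zero_fun_def by (rule smooth_const)

lemma smooth_add [simp, intro]: "f \<in> C \<Longrightarrow> h \<in> C \<Longrightarrow> f + h \<in> C"
  using Ck_on_add[OF chartD(2) smooth_functionsD smooth_functionsD]
  by (intro smooth_functionsI) (auto simp: o_def)

lemma smooth_mult [simp, intro]: "f \<in> C \<Longrightarrow> h \<in> C \<Longrightarrow> f * h \<in> C"
  using Ck_on_mult[OF chartD(2) smooth_functionsD smooth_functionsD]
  by (intro smooth_functionsI) (auto simp: o_def)

lemma smooth_uminus [simp, intro]: "f \<in> C \<Longrightarrow> - f \<in> C"
  using smooth_mult[OF smooth_const[of "-1"]] by (simp add: times_fun_def fun_Compl_def)

lemma smooth_diff [simp, intro]: "f \<in> C \<Longrightarrow> h \<in> C \<Longrightarrow> f - h \<in> C"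
  using smooth_add[OF _ smooth_uminus] by fastforce

lemma smooth_sum [intro]: "(\<And>i. i \<in> I \<Longrightarrow> f i \<in> C) \<Longrightarrow> (\<Sum>i\<in>I. f i) \<in> C"
  by (induction I rule: infinite_finite_induct) auto

lemma smooth_inverse:
  assumes "f \<in> C" "\<And>q. f q \<noteq> 0"
  shows "(\<lambda>q. inverse (f q)) \<in> C"
  using Ck_on_inverse[OF chartD(2) smooth_functionsD[OF assms(1)]] assms(2)
  by (intro smooth_functionsI) (auto simp: o_def)

lemma smooth_local:
  assumes "\<And>p. \<exists>V h. open V \<and> p \<in> V \<and> h \<in> C \<and> (\<forall>q\<in>V. f q = h q)"
  shows "f \<in> C"
proof (rule smooth_functionsI, rule Ck_on_local)
  fix U x k z
  assume U: "(U, x) \<in> A" and "z \<in> x ` U"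
  then obtain p where p: "p \<in> U" "z = x p" by auto
  obtain V h where V: "open V" "p \<in> V" "h \<in> C" "\<forall>q\<in>V. f q = h q" using assms by metis
  have o: "open (x ` (U \<inter> V))" using chart_open_image[OF U] V(1) chartD(1)[OF U] by auto
  have "Ck_on k (x ` (U \<inter> V)) (h \<circ> inv_into U x)"
    by (rule Ck_on_subset[OF smooth_functionsD[OF V(3) U]]) auto
  then have "Ck_on k (x ` (U \<inter> V)) (f \<circ> inv_into U x)"
    by (rule Ck_on_cong[OF o]) (use V(4) chartD(3)[OF U] in auto)
  then show "\<exists>V. open V \<and> z \<in> V \<and> Ck_on k V (f \<circ> inv_into U x)" using o p V(2) by blast
qed

text \<open>
  The Hausdorff property enters here: \<open>K\<close> is compact, so its preimage in the manifold is closed and its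
  complement is a neighbourhood of every point outside it, whether or not that point lies in the chart.
\<close>

lemma extend_by_zero:
  assumes U: "(U, x) \<in> A" and S: "open S" "S \<subseteq> x ` U" and K: "compact K" "K \<subseteq> S"
    and h: "\<And>k. Ck_on k S h" and 0: "\<And>z. z \<in> x ` U \<Longrightarrow> z \<notin> K \<Longrightarrow> h z = 0"
  shows "(\<lambda>q. if q \<in> U then h (x q) else 0) \<in> C" (is "?f \<in> C")
proof (rule smooth_functionsI, rule Ck_on_local)
  fix V y k w
  assume V: "(V, y) \<in> A" and "w \<in> y ` V"
  then obtain q where q: "q \<in> V" "w = y q" by auto
  have cl: "closed (inv_into U x ` K)"
    using K S chartD(5)[OF U] continuous_on_subset
    by (intro compact_imp_closed compact_continuous_image) blast+
  show "\<exists>W. open W \<and> w \<in> W \<and> Ck_on k W (?f \<circ> inv_into V y)"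
  proof (cases "q \<in> U \<and> x q \<in> S")
    case True
    define W where "W = V \<inter> (U \<inter> x -` S)"
    have "open W" unfolding W_def
      using continuous_open_preimage[OF chartD(4,1)[OF U] S(1)] chartD(1)[OF V] by auto
    then have o: "open (y ` W)" by (intro chart_open_image[OF V]) (auto simp: W_def)
    have "Ck_on k (y ` (V \<inter> U)) (x \<circ> inv_into V y)"
      using atlas U V unfolding smooth_atlas_def smooth_on_def by fastforce
    then have g: "Ck_on k (y ` W) (x \<circ> inv_into V y)"
      by (rule Ck_on_subset) (auto simp: W_def)
    have "Ck_on k (y ` W) (\<lambda>z. h ((x \<circ> inv_into V y) z))"
      by (rule Ck_on_compose[OF o S(1) g h]) (use chartD(3)[OF V] in \<open>auto simp: W_def\<close>)
    then have "Ck_on k (y ` W) (?f \<circ> inv_into V y)"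
      by (rule Ck_on_cong[OF o]) (use chartD(3)[OF V] in \<open>auto simp: W_def\<close>)
    then show ?thesis using o q True by (auto simp: W_def)
  next
    case False
    define W where "W = V - inv_into U x ` K"
    have q': "q \<notin> inv_into U x ` K"
    proof
      assume "q \<in> inv_into U x ` K"
      then obtain z where "z \<in> K" "q = inv_into U x z" by auto
      then show False using False K(2) S(2) inv_into_into f_inv_into_f by (metis subsetD)
    qed
    have o: "open (y ` W)"
      by (intro chart_open_image[OF V]) (auto simp: W_def intro: open_Diff chartD(1)[OF V] cl)
    have "?f q = 0" if "q \<in> W" for q
    proof (cases "q \<in> U")
      case True
      then have "x q \<notin> K"
        using that chartD(3)[OF U] inv_into_f_f unfolding W_def by (metis DiffE image_eqI)
      then show ?thesis using True 0 by simp
    qed simp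
    then have "0 = (?f \<circ> inv_into V y) z" if z: "z \<in> y ` W" for z
    proof -
      obtain q where q: "q \<in> W" "z = y q" using z by auto
      then have "inv_into V y z = q" using chartD(3)[OF V] by (simp add: W_def)
      then show ?thesis using \<open>\<And>q. q \<in> W \<Longrightarrow> ?f q = 0\<close>[OF q(1)] by (simp only: o_def)
    qed
    then have "Ck_on k (y ` W) (?f \<circ> inv_into V y)"
      by (rule Ck_on_cong[OF o Ck_on_const[OF o, of _ 0]])
    then show ?thesis using o q q' by (auto simp: W_def)
  qed
qed

lemma chart_ball:
  assumes "(U, x) \<in> A" "p \<in> U" "open V" "p \<in> V"
  obtains r where "r > 0" "cball (x p) (2 * r) \<subseteq> x ` (U \<inter> V)"
proof -
  have "open (x ` (U \<inter> V))"
    by (intro chart_open_image[OF assms(1)] open_Int chartD(1)[OF assms(1)] assms(3)) simp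
  moreover have "x p \<in> x ` (U \<inter> V)" using assms by simp
  ultimately obtain e where "e > 0" "cball (x p) e \<subseteq> x ` (U \<inter> V)"
    using open_contains_cball[of "x ` (U \<inter> V)"] by blast
  then show thesis using that[of "e / 2"] by auto
qed

lemma open_chart_preimage:
  assumes "(U, x) \<in> A" "open S"
  shows "open {q \<in> U. x q \<in> S}"
  using continuous_open_preimage[OF chartD(4,1)[OF assms(1)] assms(2)]
  by (simp add: vimage_def Int_def)

text \<open>
  Cutoff functions in a chart, extended by zero, separate points from closed sets.
\<close>

lemma bump:
  assumes "open V" "p \<in> V"
  obtains \<psi> W where "\<psi> \<in> C" "\<And>q. 0 \<le> \<psi> q" "\<And>q. \<psi> q \<le> 1" "\<And>q. q \<notin> V \<Longrightarrow> \<psi> q = 0"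
    "open W" "p \<in> W" "\<And>q. q \<in> W \<Longrightarrow> \<psi> q = 1"
proof -
  obtain U x where U: "(U, x) \<in> A" "p \<in> U" by (rule chart_at)
  obtain r where r: "r > 0" "cball (x p) (2 * r) \<subseteq> x ` (U \<inter> V)"
    by (rule chart_ball[OF U assms])
  show thesis
  proof
    show "(\<lambda>q. if q \<in> U then cutoff (x p) r (x q) else 0) \<in> C"
      by (rule extend_by_zero[OF U(1) chartD(2)[OF U(1)] order_refl compact_cball[of "x p" "2 * r"]])
         (use r in \<open>auto intro: Ck_on_subset[OF Ck_on_cutoff] simp: cutoff_eq_0 dist_commute\<close>)
    show "open {q \<in> U. x q \<in> ball (x p) r}" by (rule open_chart_preimage[OF U(1) open_ball])
    show "(if q \<in> U then cutoff (x p) r (x q) else 0) = 0" if "q \<notin> V" for q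
    proof -
      have "x q \<notin> cball (x p) (2 * r)" if "q \<in> U"
      proof
        assume "x q \<in> cball (x p) (2 * r)"
        then obtain q' where "x q = x q'" "q' \<in> U \<inter> V" using r(2) by blast
        then show False
          using \<open>q \<notin> V\<close> that inj_onD[OF chartD(3)[OF U(1)]] by blast
      qed
      then show ?thesis using r(1) by (auto simp: cutoff_eq_0 dist_commute)
    qed
  qed (use U r in \<open>auto simp: cutoff_bounds cutoff_eq_1 dist_commute\<close>)
qed

lemma tangent_add: "v \<in> T p \<Longrightarrow> f \<in> C \<Longrightarrow> h \<in> C \<Longrightarrow> v (f + h) = v f + v h"
  by (simp add: tangent_space_def plus_fun_def)

lemma tangent_mult: "v \<in> T p \<Longrightarrow> f \<in> C \<Longrightarrow> h \<in> C \<Longrightarrow> v (f * h) = f p * v h + h p * v f"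
  by (simp add: tangent_space_def times_fun_def)

lemma tangent_nonsmooth: "v \<in> T p \<Longrightarrow> f \<notin> C \<Longrightarrow> v f = 0"
  by (simp add: tangent_space_def)

lemma tangent_const: 
  assumes "v \<in> T p" shows "v (\<lambda>q. c) = 0"
proof -
  have "v (\<lambda>q. 1) = v (\<lambda>q. 1 * 1)" by simp
  also have "\<dots> = 1 * v (\<lambda>q. 1) + 1 * v (\<lambda>q. 1)"
    using tangent_mult[OF assms, of "\<lambda>q. 1" "\<lambda>q. 1"] by (simp add: times_fun_def)
  finally have "v (\<lambda>q. 1) = 0" by simp
  moreover have "v (\<lambda>q. c * f q) = c * v f" if "f \<in> C" for f
    using assms that by (simp add: tangent_space_def)
  from this[OF smooth_const[of 1]] have "v (\<lambda>q. c) = c * v (\<lambda>q. 1)" by simp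
  ultimately show ?thesis by simp
qed

lemma tangent_zero: "v \<in> T p \<Longrightarrow> v 0 = 0"
  using tangent_const[of v p 0] by (simp add: zero_fun_def)

lemma tangent_uminus:
  assumes "v \<in> T p" "f \<in> C" shows "v (- f) = - v f"
  using tangent_add[OF assms smooth_uminus[OF assms(2)]] tangent_zero[OF assms(1)] by simp

lemma tangent_diff: "v \<in> T p \<Longrightarrow> f \<in> C \<Longrightarrow> h \<in> C \<Longrightarrow> v (f - h) = v f - v h"
  using tangent_add[of v p f "- h"] tangent_uminus[of v p h] by simp

lemma tangent_sum:
  assumes "v \<in> T p" "\<And>i. i \<in> I \<Longrightarrow> f i \<in> C"
  shows "v (\<Sum>i\<in>I. f i) = (\<Sum>i\<in>I. v (f i))"
  using assms(2)
  by (induction I rule: infinite_finite_induct)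
     (auto simp: tangent_zero[OF assms(1)] tangent_add[OF assms(1)] smooth_sum)

text \<open>
  Homogeneity is a consequence of the product rule with a constant factor.
\<close>

lemma tangentI:
  assumes "\<And>f h. f \<in> C \<Longrightarrow> h \<in> C \<Longrightarrow> v (f + h) = v f + v h"
    "\<And>c. v (\<lambda>q. c) = 0"
    "\<And>f h. f \<in> C \<Longrightarrow> h \<in> C \<Longrightarrow> v (f * h) = f p * v h + h p * v f"
    "\<And>f. f \<notin> C \<Longrightarrow> v f = 0"
  shows "v \<in> T p"
proof -
  have "v (\<lambda>q. c * f q) = c * v f" if "f \<in> C" for c f
    using assms(3)[OF smooth_const[of c] that] assms(2) by (simp add: times_fun_def)
  then show ?thesis using assms unfolding tangent_space_def plus_fun_def times_fun_def by simp
qed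

lemma tangent_space_add [simp, intro]: "u \<in> T p \<Longrightarrow> v \<in> T p \<Longrightarrow> u + v \<in> T p"
  by (rule tangentI)
     (auto simp: tangent_add tangent_mult tangent_const tangent_nonsmooth algebra_simps)

lemma tangent_space_scale [simp, intro]: "v \<in> T p \<Longrightarrow> tscale c v \<in> T p"
  by (rule tangentI)
     (auto simp: tscale_def tangent_add tangent_mult tangent_const tangent_nonsmooth algebra_simps)

lemma tangent_space_0 [simp, intro]: "0 \<in> T p"
  by (rule tangentI) auto

lemma tscale_minus1: "tscale (- 1) v = - v"
  by (auto simp: tscale_def fun_Compl_def)

lemma tangent_space_uminus [simp, intro]: "v \<in> T p \<Longrightarrow> - v \<in> T p"
  using tangent_space_scale[of v p "-1"] by (simp add: tscale_minus1)

lemma tangent_space_diff [simp, intro]: "u \<in> T p \<Longrightarrow> v \<in> T p \<Longrightarrow> u - v \<in> T p"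
  using tangent_space_add[of u p "- v"] by simp

lemma tangent_space_sum [intro]: "(\<And>i. i \<in> I \<Longrightarrow> v i \<in> T p) \<Longrightarrow> (\<Sum>i\<in>I. v i) \<in> T p"
  by (induction I rule: infinite_finite_induct) auto

section \<open>Coordinate frames\<close>

lemma coordinate_vector_tangent:
  assumes U: "(U, x) \<in> A" and q: "q \<in> U"
  shows "(\<lambda>f. if f \<in> C then c * frechet_derivative (f \<circ> inv_into U x) (at (x q)) b else 0) \<in> T q"
proof (rule tangentI)
  let ?D = "\<lambda>f. frechet_derivative (f \<circ> inv_into U x) (at (x q))"
  have D: "((f \<circ> inv_into U x) has_derivative ?D f) (at (x q))" if "f \<in> C" for f
    using Ck_on_SucD(1)[OF smooth_functionsD[OF that U]] q by blast
  have inv: "inv_into U x (x q) = q" using chartD(3)[OF U] q by simp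
  have "?D (f + h) b = ?D f b + ?D h b" if "f \<in> C" "h \<in> C" for f h
    using fun_cong[OF frechet_derivative_at[OF has_derivative_add[OF D[OF that(1)] D[OF that(2)]]], of b]
    by (simp add: o_def)
  then show "\<And>f h. f \<in> C \<Longrightarrow> h \<in> C \<Longrightarrow> (if f + h \<in> C then c * ?D (f + h) b else 0) =
      (if f \<in> C then c * ?D f b else 0) + (if h \<in> C then c * ?D h b else 0)"
    by (simp add: distrib_left)
  have "?D (f * h) b = f q * ?D h b + h q * ?D f b" if "f \<in> C" "h \<in> C" for f h
    using fun_cong[OF frechet_derivative_at[OF has_derivative_mult[OF D[OF that(1)] D[OF that(2)]]], of b]
    by (simp add: o_def inv mult.commute)
  then show "\<And>f h. f \<in> C \<Longrightarrow> h \<in> C \<Longrightarrow> (if f * h \<in> C then c * ?D (f * h) b else 0) =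
      f q * (if h \<in> C then c * ?D h b else 0) + h q * (if f \<in> C then c * ?D f b else 0)"
    by (simp add: algebra_simps)
qed (simp_all add: o_def)

text \<open>
  Coordinate functions \<open>X b\<close> and coordinate fields \<open>E b\<close>, made global by one cutoff function that is
  \<open>1\<close> near \<open>p\<close>. A derivation \<open>v\<close> at \<open>q\<close> is a combination of the \<open>E b q\<close> by Hadamard's
  lemma: after multiplication by a cutoff function \<open>\<gamma>\<close> at \<open>q\<close>, the expansion of a smooth function
  becomes an identity of global smooth functions to which \<open>v\<close> can be applied.
\<close>

lemma coordinate_frame:
  obtains V X E where "open V" "p \<in> V" "\<And>b. X b \<in> C" "\<And>b. E b \<in> VF"
    "\<And>q b c. q \<in> V \<Longrightarrow> b \<in> Basis \<Longrightarrow> c \<in> Basis \<Longrightarrow> E (b::'e) q (X c) = (if b = c then 1 else 0)"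
    "\<And>q v. q \<in> V \<Longrightarrow> v \<in> T q \<Longrightarrow> v = (\<Sum>b\<in>Basis. tscale (v (X b)) (E b q))"
proof -
  obtain U x where U: "(U, x) \<in> A" "p \<in> U" by (rule chart_at)
  obtain r where r: "r > 0" "cball (x p) (2 * r) \<subseteq> x ` U"
    using chart_ball[OF U open_UNIV] by auto
  let ?B = "ball (x p) r" and ?i = "inv_into U x"
  have B: "?B \<subseteq> x ` U" using r by (auto simp: subset_iff)
  note oU = chartD(2)[OF U(1)]
  have inv: "?i (x q) = q" if "q \<in> U" for q using chartD(3)[OF U(1)] that by simp
  have ext: "(\<lambda>q. if q \<in> U then cutoff (x p) r (x q) * h (x q) else 0) \<in> C"
    if "\<And>k. Ck_on k (x ` U) h" for h
    by (rule extend_by_zero[OF U(1) oU order_refl compact_cball[of "x p" "2 * r"]])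
       (use r that in \<open>auto intro!: Ck_on_mult oU intro: Ck_on_subset[OF Ck_on_cutoff]
          simp: cutoff_eq_0 dist_commute\<close>)
  define X where "X b = (\<lambda>q. if q \<in> U then cutoff (x p) r (x q) * (x q \<bullet> b) else 0)" for b
  define E where "E b q = (if q \<in> U then (\<lambda>f. if f \<in> C then cutoff (x p) r (x q) *
      frechet_derivative (f \<circ> ?i) (at (x q)) b else 0) else 0)" for b q
  have X: "X b \<in> C" for b
    unfolding X_def by (rule ext) (rule Ck_on_linear[OF oU bounded_linear_inner_left])
  have E: "E b \<in> VF" for b
  proof -
    have "E b q \<in> T q" for q
      using coordinate_vector_tangent[OF U(1), of q "cutoff (x p) r (x q)" b] by (simp add: E_def)
    moreover have "deriv_along (E b) f \<in> C" if "f \<in> C" for f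
    proof -
      have "deriv_along (E b) f = (\<lambda>q. if q \<in> U then cutoff (x p) r (x q) *
          frechet_derivative (f \<circ> ?i) (at (x q)) b else 0)"
        using that by (auto simp: deriv_along_def E_def)
      then show ?thesis using ext[OF Ck_on_SucD(2)[OF smooth_functionsD[OF that U(1)]], of b] by simp
    qed
    ultimately show ?thesis by (simp add: vector_fields_def)
  qed
  have X_eq: "X b q = x q \<bullet> b" if "q \<in> U" "x q \<in> ?B" for b q
    using that r(1) by (simp add: X_def cutoff_eq_1 dist_commute)
  have E_eq: "E b q f = frechet_derivative (f \<circ> ?i) (at (x q)) b"
    if "q \<in> U" "x q \<in> ?B" "f \<in> C" for b q f
    using that r(1) by (simp add: E_def cutoff_eq_1 dist_commute)
  show thesis
  proof (rule that[of "{q \<in> U. x q \<in> ?B}" X E])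
    show "open {q \<in> U. x q \<in> ?B}" by (rule open_chart_preimage[OF U(1) open_ball])
    fix q assume q: "q \<in> {q \<in> U. x q \<in> ?B}"
    show "E b q (X c) = (if b = c then 1 else 0)" if "b \<in> Basis" "c \<in> Basis" for b c
    proof -
      have "((X c \<circ> ?i) has_derivative (\<lambda>v. v \<bullet> c)) (at (x q))"
      proof (rule has_derivative_transform_within_open[where f = "\<lambda>z. z \<bullet> c" and s = ?B])
        show "z \<bullet> c = (X c \<circ> ?i) z" if z: "z \<in> ?B" for z
        proof -
          obtain q' where "q' \<in> U" "z = x q'" using B z by auto
          then show ?thesis using X_eq[of q' c] inv z by simp
        qed
      qed (use q in \<open>auto intro!: derivative_eq_intros\<close>)
      then have "frechet_derivative (X c \<circ> ?i) (at (x q)) = (\<lambda>v. v \<bullet> c)"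
        using frechet_derivative_at by metis
      then show ?thesis using q X that by (simp add: E_eq inner_Basis)
    qed
    fix v assume v: "v \<in> T q"
    show "v = (\<Sum>b\<in>Basis. tscale (v (X b)) (E b q))"
    proof
      fix f
      have "v f = (\<Sum>b\<in>Basis. v (X b) * E b q f)"
      proof (cases "f \<in> C")
        case False
        then have "E b q f = 0" for b by (simp add: E_def)
        then show ?thesis using v False by (simp add: tangent_nonsmooth)
      next
        case True
        let ?F = "f \<circ> ?i"
        have "smooth_on ?B ?F"
          using smooth_functionsD[OF True U(1)] B Ck_on_subset unfolding smooth_on_def by blast
        then obtain h where h: "\<And>b. smooth_on ?B (h b)"
          "\<And>b. h b (x q) = frechet_derivative ?F (at (x q)) b"
          "\<And>z. z \<in> ?B \<Longrightarrow> ?F z = ?F (x q) + (\<Sum>b\<in>Basis. ((z - x q) \<bullet> b) * h b z)"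
          using hadamard_lemma[OF open_ball convex_ball, of "x q" "x p" r ?F] q by blast
        obtain e where e: "e > 0" "cball (x q) e \<subseteq> ?B"
          using q open_contains_cball[of ?B] open_ball by blast
        define \<rho> where "\<rho> = e / 2"
        have \<rho>: "\<rho> > 0" "cball (x q) (2 * \<rho>) \<subseteq> ?B" using e by (auto simp: \<rho>_def)
        have ext': "(\<lambda>q'. if q' \<in> U then cutoff (x q) \<rho> (x q') * w (x q') else 0) \<in> C"
          if "\<And>k. Ck_on k ?B w" for w
          by (rule extend_by_zero[OF U(1) open_ball B compact_cball \<rho>(2)])
             (use \<rho> that in \<open>auto intro!: Ck_on_mult intro: Ck_on_subset[OF Ck_on_cutoff]
                simp: cutoff_eq_0 dist_commute\<close>)
        define \<gamma> where "\<gamma> = (\<lambda>q'. if q' \<in> U then cutoff (x q) \<rho> (x q') * 1 else 0)"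
        define H where "H b = (\<lambda>q'. if q' \<in> U then cutoff (x q) \<rho> (x q') * h b (x q') else 0)" for b
        have \<gamma>: "\<gamma> \<in> C" unfolding \<gamma>_def by (rule ext') (rule Ck_on_const[OF open_ball])
        have H: "H b \<in> C" for b
          unfolding H_def by (rule ext') (use h(1) in \<open>simp add: smooth_on_def\<close>)
        have \<gamma>q: "\<gamma> q = 1" using q \<rho> by (simp add: \<gamma>_def cutoff_eq_1)
        \<comment> \<open>The square of \<open>\<gamma>\<close> supplies one cutoff factor to each of the two factors on the right.\<close>
        have "(\<gamma> * \<gamma>) * (f - (\<lambda>_. f q)) = (\<Sum>b\<in>Basis. (\<gamma> * (X b - (\<lambda>_. X b q))) * H b)"
        proof
          fix q'
          show "((\<gamma> * \<gamma>) * (f - (\<lambda>_. f q))) q' = (\<Sum>b\<in>Basis. (\<gamma> * (X b - (\<lambda>_. X b q))) * H b) q'"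
          proof (cases "q' \<in> U \<and> x q' \<in> ?B")
            case True
            then have "f q' - f q = (\<Sum>b\<in>Basis. ((x q' - x q) \<bullet> b) * h b (x q'))"
              using h(3)[of "x q'"] inv q by simp
            then have "(\<gamma> q' * \<gamma> q') * (f q' - f q) =
                (\<Sum>b\<in>Basis. (\<gamma> q' * (X b q' - X b q)) * H b q')"
              using True q by (auto simp: X_eq H_def \<gamma>_def inner_diff_left sum_distrib_left
                intro!: sum.cong)
            then show ?thesis by (simp add: sum_fun_apply)
          next
            case False
            then have "q' \<in> U \<Longrightarrow> x q' \<notin> cball (x q) (2 * \<rho>)" using \<rho>(2) by blast
            then have "\<gamma> q' = 0"
              using cutoff_eq_0[OF \<rho>(1), of "x q" "x q'"] cutoff_eq_0[OF \<rho>(1), of "x q'" "x q"] by (auto simp: \<gamma>_def dist_commute)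
            then show ?thesis by (simp add: sum_fun_apply)
          qed
        qed
        then have "v ((\<gamma> * \<gamma>) * (f - (\<lambda>_. f q))) = v (\<Sum>b\<in>Basis. (\<gamma> * (X b - (\<lambda>_. X b q))) * H b)"
          by simp
        moreover have "v ((\<gamma> * \<gamma>) * (f - (\<lambda>_. f q))) = v f"
          using True \<gamma> by (simp add: tangent_mult[OF v] tangent_diff[OF v] tangent_const[OF v] \<gamma>q)
        moreover have "v (\<Sum>b\<in>Basis. (\<gamma> * (X b - (\<lambda>_. X b q))) * H b) = (\<Sum>b\<in>Basis. H b q * v (X b))"
          using X \<gamma> H by (simp add: tangent_sum[OF v] tangent_mult[OF v] tangent_diff[OF v]
            tangent_const[OF v] \<gamma>q)
        moreover have "H b q = E b q f" for b
          using q \<rho> True by (simp add: H_def cutoff_eq_1 h(2) E_eq)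
        ultimately show ?thesis by (simp add: mult.commute)
      qed
      then show "v f = (\<Sum>b\<in>Basis. tscale (v (X b)) (E b q)) f"
        by (simp add: sum_fun_apply tscale_def)
    qed
  qed (use U r X E in auto)
qed

end

section \<open>Vector fields and the Lie bracket\<close>

lemma deriv_along_apply [simp]: "deriv_along X f p = X p f"
  by (simp add: deriv_along_def)

lemma fscale_apply [simp]: "fscale f X p = tscale (f p) (X p)"
  by (simp add: fscale_def)

lemma app1_apply [simp]: "app1 \<eta> X p = \<eta> p (X p)"
  by (simp add: app1_def)

lemma app2_apply [simp]: "app2 b X Y p = b p (X p) (Y p)"
  by (simp add: app2_def)

lemma appE_apply [simp]: "appE \<phi> X p = \<phi> p (X p)"
  by (simp add: appE_def)

lemma deriv_along_add_left: "deriv_along (X + Y) f = deriv_along X f + deriv_along Y f"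
  by (simp add: fun_eq_iff)

lemma deriv_along_fscale: "deriv_along (fscale f X) h = f * deriv_along X h"
  by (simp add: fun_eq_iff tscale_def)

lemma lie_bracket_antisym: "lie_bracket Y X = - lie_bracket X Y"
  by (simp add: fun_eq_iff lie_bracket_def)

context smooth_manifold
begin

lemma vfieldI: "(\<And>p. X p \<in> T p) \<Longrightarrow> (\<And>f. f \<in> C \<Longrightarrow> deriv_along X f \<in> C) \<Longrightarrow> X \<in> VF"
  by (simp add: vector_fields_def)

lemma deriv_along_smooth [simp, intro]: "X \<in> VF \<Longrightarrow> f \<in> C \<Longrightarrow> deriv_along X f \<in> C"
  by (simp add: vector_fields_def)

lemma vfield_tangent [simp, intro]: "X \<in> VF \<Longrightarrow> X p \<in> T p"
  unfolding vector_fields_def by blast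

lemma vfield_add [simp, intro]: "X \<in> VF \<Longrightarrow> Y \<in> VF \<Longrightarrow> X + Y \<in> VF"
  by (rule vfieldI) (auto simp: deriv_along_add_left)

lemma vfield_fscale [simp, intro]: "f \<in> C \<Longrightarrow> X \<in> VF \<Longrightarrow> fscale f X \<in> VF"
  by (rule vfieldI) (auto simp: deriv_along_fscale)

lemma vfield_zero [simp, intro]: "0 \<in> VF"
proof (rule vfieldI)
  have "deriv_along 0 f = 0" for f :: "'a \<Rightarrow> real" by (simp add: fun_eq_iff)
  then show "deriv_along 0 f \<in> C" for f by simp
qed auto

lemma fscale_minus1: "fscale (\<lambda>_. - 1) X = - X"
  by (simp add: fun_eq_iff tscale_def)

lemma vfield_uminus [simp, intro]: "X \<in> VF \<Longrightarrow> - X \<in> VF"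
  using vfield_fscale[OF smooth_const[of "-1"]] by (simp add: fscale_minus1)

lemma vfield_diff [simp, intro]: "X \<in> VF \<Longrightarrow> Y \<in> VF \<Longrightarrow> X - Y \<in> VF"
  using vfield_add[of X "- Y"] by simp

lemma vfield_sum [intro]: "(\<And>i. i \<in> I \<Longrightarrow> X i \<in> VF) \<Longrightarrow> (\<Sum>i\<in>I. X i) \<in> VF"
  by (induction I rule: infinite_finite_induct) auto

lemma vfield_local:
  assumes "\<And>p. \<exists>V Y. open V \<and> p \<in> V \<and> Y \<in> VF \<and> (\<forall>q\<in>V. X q = Y q)"
  shows "X \<in> VF"
proof (rule vfieldI)
  show "X p \<in> T p" for p using assms[of p] by (metis vfield_tangent)
  show "deriv_along X f \<in> C" if f: "f \<in> C" for f
  proof (rule smooth_local)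
    fix p
    obtain V Y where "open V" "p \<in> V" "Y \<in> VF" "\<forall>q\<in>V. X q = Y q" using assms by metis
    then show "\<exists>V h. open V \<and> p \<in> V \<and> h \<in> C \<and> (\<forall>q\<in>V. deriv_along X f q = h q)"
      using f by (intro exI[of _ V] exI[of _ "deriv_along Y f"]) auto
  qed
qed

lemma deriv_along_add:
  "X \<in> VF \<Longrightarrow> f \<in> C \<Longrightarrow> h \<in> C \<Longrightarrow> deriv_along X (f + h) = deriv_along X f + deriv_along X h"
  by (simp add: fun_eq_iff tangent_add[OF vfield_tangent])

lemma deriv_along_mult:
  "X \<in> VF \<Longrightarrow> f \<in> C \<Longrightarrow> h \<in> C \<Longrightarrow>
    deriv_along X (f * h) = f * deriv_along X h + h * deriv_along X f"
  by (simp add: fun_eq_iff tangent_mult[OF vfield_tangent])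

lemma deriv_along_const: "X \<in> VF \<Longrightarrow> deriv_along X (\<lambda>_. c) = 0"
  by (simp add: fun_eq_iff tangent_const[OF vfield_tangent])

lemma deriv_along_nonsmooth: "X \<in> VF \<Longrightarrow> f \<notin> C \<Longrightarrow> deriv_along X f = 0"
  by (simp add: fun_eq_iff tangent_nonsmooth[OF vfield_tangent])

lemma vfield_lie_bracket [simp, intro]:
  assumes "X \<in> VF" "Y \<in> VF"
  shows "lie_bracket X Y \<in> VF"
proof (rule vfieldI)
  note t = assms[THEN vfield_tangent]
  show "lie_bracket X Y p \<in> T p" for p
    by (rule tangentI)
       (simp_all add: lie_bracket_def assms deriv_along_add deriv_along_mult deriv_along_const
         deriv_along_nonsmooth tangent_add[OF t(1)] tangent_add[OF t(2)] tangent_mult[OF t(1)]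
         tangent_mult[OF t(2)] tangent_zero[OF t(1)] tangent_zero[OF t(2)] algebra_simps)
  have "deriv_along (lie_bracket X Y) f = deriv_along X (deriv_along Y f) - deriv_along Y (deriv_along X f)" for f
    by (simp add: fun_eq_iff lie_bracket_def)
  then show "deriv_along (lie_bracket X Y) f \<in> C" if "f \<in> C" for f
    using assms that by simp
qed

lemma lie_bracket_add_right:
  assumes "X \<in> VF" "Y \<in> VF" "Z \<in> VF"
  shows "lie_bracket X (Y + Z) = lie_bracket X Y + lie_bracket X Z"
proof (intro ext)
  note t = assms[THEN vfield_tangent]
  show "lie_bracket X (Y + Z) p f = (lie_bracket X Y + lie_bracket X Z) p f" for p f
    using assms
    by (cases "f \<in> C")
       (simp_all add: lie_bracket_def deriv_along_add_left tangent_add[OF t(1)]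
         deriv_along_nonsmooth tangent_zero[OF t(1)] tangent_nonsmooth[OF t(2)]
         tangent_zero[OF t(2)] tangent_zero[OF t(3)])
qed

lemma lie_bracket_add_left:
  assumes "X \<in> VF" "Y \<in> VF" "Z \<in> VF"
  shows "lie_bracket (X + Y) Z = lie_bracket X Z + lie_bracket Y Z"
proof -
  have "- lie_bracket (X + Y) Z = - (lie_bracket X Z + lie_bracket Y Z)"
    using lie_bracket_add_right[OF assms(3,1,2)] lie_bracket_antisym[of Z] by simp
  then show ?thesis by (simp only: neg_equal_iff_equal)
qed

lemma lie_bracket_fscale_right:
  assumes "X \<in> VF" "Y \<in> VF" "h \<in> C"
  shows "lie_bracket X (fscale h Y) = fscale h (lie_bracket X Y) + fscale (deriv_along X h) Y"
proof (intro ext)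
  note t = assms(1,2)[THEN vfield_tangent]
  show "lie_bracket X (fscale h Y) p f = (fscale h (lie_bracket X Y) + fscale (deriv_along X h) Y) p f" for p f
    using assms
    by (cases "f \<in> C")
       (simp_all add: lie_bracket_def deriv_along_fscale tangent_mult[OF t(1)] tscale_def
         deriv_along_nonsmooth tangent_zero[OF t(1)] tangent_nonsmooth[OF t(2)]
         tangent_zero[OF t(2)] algebra_simps)
qed

lemma lie_bracket_fscale_left:
  assumes "X \<in> VF" "Y \<in> VF" "h \<in> C"
  shows "lie_bracket (fscale h X) Y = fscale h (lie_bracket X Y) - fscale (deriv_along Y h) X"
  using lie_bracket_fscale_right[OF assms(2,1,3)] lie_bracket_antisym[of Y]
  by (simp add: fun_eq_iff lie_bracket_def tscale_def algebra_simps)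

lemma deriv_along_0: "X \<in> VF \<Longrightarrow> deriv_along X 0 = 0"
  using deriv_along_const[of X 0] by (simp add: zero_fun_def)

lemma lie_bracket_zero:
  assumes "X \<in> VF"
  shows "lie_bracket X 0 = 0" "lie_bracket 0 X = 0"
proof -
  have "deriv_along 0 f = 0" for f :: "'a \<Rightarrow> real" by (simp add: fun_eq_iff)
  then show "lie_bracket X 0 = 0" "lie_bracket 0 X = 0"
    using tangent_zero[OF vfield_tangent[OF assms]] by (intro ext; simp add: lie_bracket_def)+
qed

lemma vfield_additive_sum:
  fixes \<omega> :: "'a vfield \<Rightarrow> 'b::ab_group_add"
  assumes add: "\<And>X Y. X \<in> VF \<Longrightarrow> Y \<in> VF \<Longrightarrow> \<omega> (X + Y) = \<omega> X + \<omega> Y"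
    and "\<And>i. i \<in> I \<Longrightarrow> X i \<in> VF"
  shows "\<omega> (\<Sum>i\<in>I. X i) = (\<Sum>i\<in>I. \<omega> (X i))"
proof -
  have "\<omega> 0 = 0" using add[OF vfield_zero vfield_zero] by simp
  then show ?thesis using assms(2)
    by (induction I rule: infinite_finite_induct) (auto simp: add vfield_sum)
qed

lemma smooth_open_nonzero:
  assumes "f \<in> C"
  shows "open {q. f q \<noteq> 0}"
proof -
  have "isCont f p" for p
  proof -
    obtain U x where U: "(U, x) \<in> A" "p \<in> U" by (rule chart_at)
    have "continuous_on U (\<lambda>q. (f \<circ> inv_into U x) (x q))"
      using Ck_on_imp_continuous_on[OF smooth_functionsD[OF assms U(1), of 0]] chartD(4)[OF U(1)]
      by (rule continuous_on_compose2) simp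
    then have "continuous_on U f"
      by (rule continuous_on_eq) (use chartD(3)[OF U(1)] in auto)
    then show ?thesis using U chartD(1)[OF U(1)] continuous_on_eq_continuous_at by blast
  qed
  then have "continuous_on UNIV f" by (simp add: continuous_at_imp_continuous_on)
  then show ?thesis by (intro open_Collect_neq) auto
qed

text \<open>
  The witness is \<open>a / (a\<^sup>2 + (1 - \<psi>))\<close> for a bump function \<open>\<psi>\<close> supported where \<open>a \<noteq> 0\<close>; its denominator
  vanishes nowhere, and it is \<open>1 / a\<close> where \<open>\<psi> = 1\<close>.
\<close>

lemma local_inverse:
  assumes "a \<in> C" "a p \<noteq> 0"
  obtains c V where "c \<in> C" "open V" "p \<in> V" "\<And>q. q \<in> V \<Longrightarrow> c q * a q = 1"
proof -
  obtain \<psi> W where \<psi>: "\<psi> \<in> C" "\<And>q. 0 \<le> \<psi> q" "\<And>q. \<psi> q \<le> 1"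
    "\<And>q. q \<notin> {q. a q \<noteq> 0} \<Longrightarrow> \<psi> q = 0" "open W" "p \<in> W" "\<And>q. q \<in> W \<Longrightarrow> \<psi> q = 1"
    using bump[OF smooth_open_nonzero[OF assms(1)]] assms(2) by blast
  let ?d = "a * a + ((\<lambda>_. 1) - \<psi>)"
  have d: "?d q \<noteq> 0" for q
  proof (cases "a q = 0")
    case False
    then have "a q * a q > 0" using not_real_square_gt_zero by blast
    then show ?thesis using \<psi>(3)[of q] by simp
  qed (use \<psi>(4) in simp)
  have "?d \<in> C" using assms(1) \<psi>(1) by simp
  then have "a * (\<lambda>q. inverse (?d q)) \<in> C"
    using assms(1) d by (intro smooth_mult smooth_inverse)
  moreover have "(a * (\<lambda>q. inverse (?d q))) q * a q = 1" if "q \<in> W" for q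
    using d[of q] \<psi>(7)[OF that] by (simp add: divide_simps)
  ultimately show thesis using that \<psi>(5,6) by blast
qed

text \<open>
  If \<open>\<psi>\<close> is a bump function supported in \<open>V\<close> with \<open>\<psi>(p) = 1\<close>, then \<open>\<psi> X = 0\<close>, hence \<open>\<psi> \<omega>(X) = 0\<close>.
\<close>

lemma linear_form_vanishes_locally:
  assumes scale: "\<And>f X. f \<in> C \<Longrightarrow> X \<in> VF \<Longrightarrow> \<omega> (fscale f X) = f * \<omega> X"
    and X: "X \<in> VF" and V: "open V" "p \<in> V" "\<And>q. q \<in> V \<Longrightarrow> X q = 0"
  shows "\<omega> X p = 0"
proof -
  obtain \<psi> W where \<psi>: "\<psi> \<in> C" "\<And>q. q \<notin> V \<Longrightarrow> \<psi> q = 0" "p \<in> W" "\<And>q. q \<in> W \<Longrightarrow> \<psi> q = 1"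
    using bump[OF V(1,2)] by metis
  have "fscale \<psi> X = fscale 0 0"
  proof
    show "fscale \<psi> X q = fscale 0 0 q" for q
      by (cases "q \<in> V") (use V(3) \<psi>(2) in \<open>auto simp: fun_eq_iff tscale_def\<close>)
  qed
  then have "\<psi> * \<omega> X = 0 * \<omega> 0" using scale \<psi>(1) X smooth_zero vfield_zero by metis
  then have "(\<psi> * \<omega> X) p = (0 * \<omega> 0) p" by (rule fun_cong)
  then show ?thesis using \<psi>(4)[OF \<psi>(3)] by simp
qed

end

section \<open>Riemannian metrics and the representation of forms\<close>

locale riemannian_manifold = smooth_manifold A
  for A :: "('a::{t2_space, second_countable_topology}, 'e::euclidean_space) chart set" +
  fixes g :: "'a form2"
  assumes riemannian: "riemannian_metric A g"
begin

lemma g_add_left: "u \<in> T p \<Longrightarrow> v \<in> T p \<Longrightarrow> w \<in> T p \<Longrightarrow> g p (u + v) w = g p u w + g p v w"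
  using riemannian[unfolded riemannian_metric_def, THEN conjunct1] by blast

lemma g_scale_left: "u \<in> T p \<Longrightarrow> v \<in> T p \<Longrightarrow> g p (tscale c u) v = c * g p u v"
  using riemannian[unfolded riemannian_metric_def, THEN conjunct2, THEN conjunct1] by blast

lemma g_sym: "u \<in> T p \<Longrightarrow> v \<in> T p \<Longrightarrow> g p u v = g p v u"
  using riemannian[unfolded riemannian_metric_def, THEN conjunct2, THEN conjunct2, THEN conjunct1] by blast

lemma g_pos: "u \<in> T p \<Longrightarrow> u \<noteq> 0 \<Longrightarrow> g p u u > 0"
  using riemannian by (simp add: riemannian_metric_def)

lemma g_smooth [simp, intro]: "X \<in> VF \<Longrightarrow> Y \<in> VF \<Longrightarrow> app2 g X Y \<in> C"
  using riemannian by (simp add: riemannian_metric_def)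

lemma g_add_right: "u \<in> T p \<Longrightarrow> v \<in> T p \<Longrightarrow> w \<in> T p \<Longrightarrow> g p u (v + w) = g p u v + g p u w"
  by (metis g_add_left g_sym tangent_space_add)

lemma g_scale_right: "u \<in> T p \<Longrightarrow> v \<in> T p \<Longrightarrow> g p u (tscale c v) = c * g p u v"
  by (metis g_scale_left g_sym tangent_space_scale)

lemma g_uminus_left: "u \<in> T p \<Longrightarrow> v \<in> T p \<Longrightarrow> g p (- u) v = - g p u v"
  using g_scale_left[of u p v "-1"] by (simp add: tscale_minus1)

lemma g_uminus_right: "u \<in> T p \<Longrightarrow> v \<in> T p \<Longrightarrow> g p u (- v) = - g p u v"
  using g_scale_right[of u p v "-1"] by (simp add: tscale_minus1)

lemma g_diff_left: "u \<in> T p \<Longrightarrow> v \<in> T p \<Longrightarrow> w \<in> T p \<Longrightarrow> g p (u - v) w = g p u w - g p v w"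
  using g_add_left[of u p "- v" w] by (simp add: g_uminus_left)

lemma g_diff_right: "u \<in> T p \<Longrightarrow> v \<in> T p \<Longrightarrow> w \<in> T p \<Longrightarrow> g p u (v - w) = g p u v - g p u w"
  using g_add_right[of u p v "- w"] by (simp add: g_uminus_right)

lemma g_zero_left: "u \<in> T p \<Longrightarrow> g p 0 u = 0"
  using g_diff_left[of u p u u] by simp

lemma g_zero_right: "u \<in> T p \<Longrightarrow> g p u 0 = 0"
  using g_diff_right[of u p u u] by simp

lemma g_sum_left:
  assumes "\<And>i. i \<in> I \<Longrightarrow> u i \<in> T p" "v \<in> T p"
  shows "g p (\<Sum>i\<in>I. u i) v = (\<Sum>i\<in>I. g p (u i) v)"
  using assms
  by (induction I rule: infinite_finite_induct) (auto simp: g_zero_left g_add_left tangent_space_sum)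

lemmas g_linear = g_add_left g_add_right g_scale_left g_scale_right g_uminus_left g_uminus_right
  g_diff_left g_diff_right g_zero_left g_zero_right

lemma app2_g_sym: "X \<in> VF \<Longrightarrow> Y \<in> VF \<Longrightarrow> app2 g X Y = app2 g Y X"
  by (simp add: fun_eq_iff g_sym)

lemma g_nondegenerate:
  assumes "X \<in> VF" "Y \<in> VF" "\<And>Z. Z \<in> VF \<Longrightarrow> app2 g X Z = app2 g Y Z"
  shows "X = Y"
proof
  fix p
  have "app2 g X (X - Y) = app2 g Y (X - Y)" using assms(1,2) by (intro assms(3) vfield_diff)
  from fun_cong[OF this, of p] have "g p (X p - Y p) (X p - Y p) = 0"
    using assms(1,2) by (simp add: g_diff_left)
  then show "X p = Y p"
    using g_pos[of "X p - Y p" p] assms(1,2) by fastforce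
qed

text \<open>
  Orthogonalization of a family of fields near \<open>p\<close>. Instead of dividing by \<open>g(F\<^sub>j, F\<^sub>j)\<close>, which may vanish
  away from \<open>p\<close>, the coefficients use global smooth functions \<open>c j\<close> inverse to it near \<open>p\<close>, so that all
  fields stay globally smooth. The neighbourhood shrinks at each step to a set where the new field
  is nonzero; at \<open>p\<close> this is guaranteed by linear independence.
\<close>

lemma gram_schmidt:
  fixes m :: nat
  assumes "\<forall>i<m. E i \<in> VF" "\<forall>i<m. E i p \<notin> tv.span ((\<lambda>j. E j p) ` {..<i})"
  shows "\<exists>F c V. open V \<and> p \<in> V \<and>
    (\<forall>j<m. F j \<in> VF \<and> c j \<in> C \<and> F j p \<in> tv.span ((\<lambda>j. E j p) ` {..<m})) \<and>
    (\<forall>q\<in>V. \<forall>i<m. E i q = (\<Sum>j<m. tscale (c j q * g q (E i q) (F j q)) (F j q))) \<and>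
    (\<forall>q\<in>V. \<forall>i<m. \<forall>j<m. i \<noteq> j \<longrightarrow> g q (F i q) (F j q) = 0) \<and>
    (\<forall>q\<in>V. \<forall>j<m. c j q * g q (F j q) (F j q) = 1)"
  using assms
proof (induction m)
  case 0
  then show ?case by (auto intro!: exI[of _ UNIV])
next
  case (Suc m)
  have "\<exists>F c V. open V \<and> p \<in> V \<and>
    (\<forall>j<m. F j \<in> VF \<and> c j \<in> C \<and> F j p \<in> tv.span ((\<lambda>j. E j p) ` {..<m})) \<and>
    (\<forall>q\<in>V. \<forall>i<m. E i q = (\<Sum>j<m. tscale (c j q * g q (E i q) (F j q)) (F j q))) \<and>
    (\<forall>q\<in>V. \<forall>i<m. \<forall>j<m. i \<noteq> j \<longrightarrow> g q (F i q) (F j q) = 0) \<and>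
    (\<forall>q\<in>V. \<forall>j<m. c j q * g q (F j q) (F j q) = 1)"
    using Suc.IH Suc.prems by simp
  then obtain F c V where V: "open V" "p \<in> V"
    and Fc: "\<forall>j<m. F j \<in> VF \<and> c j \<in> C \<and> F j p \<in> tv.span ((\<lambda>j. E j p) ` {..<m})"
    and rep': "\<forall>q\<in>V. \<forall>i<m. E i q = (\<Sum>j<m. tscale (c j q * g q (E i q) (F j q)) (F j q))"
    and orth': "\<forall>q\<in>V. \<forall>i<m. \<forall>j<m. i \<noteq> j \<longrightarrow> g q (F i q) (F j q) = 0"
    and norm': "\<forall>q\<in>V. \<forall>j<m. c j q * g q (F j q) (F j q) = 1"
    by (elim exE conjE) (rule that)
  have F: "F j \<in> VF" and c: "c j \<in> C" and span: "F j p \<in> tv.span ((\<lambda>j. E j p) ` {..<m})"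
    if "j < m" for j
    using Fc that by auto
  have rep: "E i q = (\<Sum>j<m. tscale (c j q * g q (E i q) (F j q)) (F j q))"
    if "q \<in> V" "i < m" for q i
    using rep' that by blast
  have orth: "g q (F i q) (F j q) = 0" if "q \<in> V" "i < m" "j < m" "i \<noteq> j" for q i j
    using orth' that by blast
  have norm: "c j q * g q (F j q) (F j q) = 1" if "q \<in> V" "j < m" for q j
    using norm' that by blast
  define P where "P = (\<Sum>j<m. fscale (c j * app2 g (E m) (F j)) (F j))"
  define G where "G = E m - P"
  have Em: "E i \<in> VF" if "i \<le> m" for i using Suc.prems(1) that by simp
  have P: "P \<in> VF" unfolding P_def using F c Em by (intro vfield_sum) auto
  have G: "G \<in> VF" unfolding G_def using P Em by simp
  have P_q: "P q = (\<Sum>j<m. tscale (c j q * g q (E m q) (F j q)) (F j q))" for q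
    by (simp add: P_def sum_fun_apply)
  have GF: "g q (G q) (F i q) = 0" if q: "q \<in> V" and i: "i < m" for q i
  proof -
    have "g q (P q) (F i q) = (\<Sum>j<m. c j q * g q (E m q) (F j q) * g q (F j q) (F i q))"
      unfolding P_q using F i by (subst g_sum_left) (auto simp: g_scale_left)
    also have "\<dots> = (\<Sum>j<m. if j = i then g q (E m q) (F i q) * (c i q * g q (F i q) (F i q)) else 0)"
      using orth[OF q _ i] by (intro sum.cong) auto
    also have "\<dots> = g q (E m q) (F i q)" using norm[OF q i] i by simp
    finally show ?thesis using P F[OF i] Em by (simp add: G_def g_diff_left)
  qed
  have sub: "tv.span ((\<lambda>j. E j p) ` {..<m}) \<subseteq> tv.span ((\<lambda>j. E j p) ` {..<Suc m})"
    by (intro tv.span_mono) auto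
  have Pp: "P p \<in> tv.span ((\<lambda>j. E j p) ` {..<m})"
    unfolding P_q by (intro tv.span_sum tv.span_scale span) simp
  then have "G p \<noteq> 0" using Suc.prems(2) by (auto simp: G_def)
  then have "app2 g G G p \<noteq> 0" using g_pos[of "G p" p] G by auto
  then obtain d W where d: "d \<in> C" "open W" "p \<in> W" "\<And>q. q \<in> W \<Longrightarrow> d q * app2 g G G q = 1"
    using local_inverse[of "app2 g G G" p] G by blast
  let ?F = "F(m := G)" and ?c = "c(m := d)"
  have "Em_span": "E m p \<in> tv.span ((\<lambda>j. E j p) ` {..<Suc m})" by (rule tv.span_base) auto
  have "?F j \<in> VF \<and> ?c j \<in> C \<and> ?F j p \<in> tv.span ((\<lambda>j. E j p) ` {..<Suc m})" if "j < Suc m" for j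
    using that F[of j] c[of j] span[of j] sub G d(1) Pp
      tv.span_diff[OF Em_span, of "P p"] by (cases "j = m") (auto simp: G_def)
  moreover have "E i q = (\<Sum>j<Suc m. tscale (?c j q * g q (E i q) (?F j q)) (?F j q))"
    if q: "q \<in> V \<inter> W" and i: "i < Suc m" for q i
  proof (cases "i = m")
    case True
    have "g q (P q) (G q) = 0"
    proof -
      have "g q (P q) (G q) = (\<Sum>j<m. c j q * g q (E m q) (F j q) * g q (F j q) (G q))"
        unfolding P_q using F G by (subst g_sum_left) (auto simp: g_scale_left)
      also have "\<dots> = 0"
        using GF[of q] F G q by (intro sum.neutral) (auto simp: g_sym[of "F _ q" q "G q"])
      finally show ?thesis .
    qed
    then have "d q * g q (E m q) (G q) = 1"
      using d(4)[of q] q Em[of m] G P by (simp add: G_def[THEN fun_cong] g_diff_left)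
    then show ?thesis using True by (simp add: P_q[symmetric] G_def tscale_def[of 1])
  next
    case False
    then have i: "i < m" using i by simp
    have "g q (E i q) (G q) = (\<Sum>j<m. c j q * g q (E i q) (F j q) * g q (F j q) (G q))"
      using F G q i by (subst rep, simp, simp, subst g_sum_left) (auto simp: g_scale_left)
    also have "\<dots> = 0"
      using GF[of q] F G q by (intro sum.neutral) (auto simp: g_sym[of "F _ q" q "G q"])
    finally show ?thesis using rep[of q i] q i by (simp add: tscale_def[of 0] zero_fun_def[symmetric])
  qed
  moreover have "g q (?F i q) (?F j q) = 0"
    if "q \<in> V \<inter> W" "i < Suc m" "j < Suc m" "i \<noteq> j" for q i j
    using that orth[of q i j] GF[of q] g_sym[of "F i q" q "G q"] F[of i] G
    by (auto simp: less_Suc_eq)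
  moreover have "?c j q * g q (?F j q) (?F j q) = 1" if "q \<in> V \<inter> W" "j < Suc m" for q j
    using that norm[of q j] d(4)[of q] by (auto simp: less_Suc_eq)
  ultimately show ?case
    using V d(2,3) by (intro exI[of _ ?F] exI[of _ ?c] exI[of _ "V \<inter> W"]) blast
qed

text \<open>
  Gram--Schmidt applied to a coordinate frame. Independence at \<open>p\<close> comes from the coordinate functions,
  on which the coordinate fields form a dual family.
\<close>

lemma reproducing_frame:
  obtains m :: nat and F c V where "open V" "p \<in> V" "\<And>j. j < m \<Longrightarrow> F j \<in> VF"
    "\<And>j. j < m \<Longrightarrow> c j \<in> C"
    "\<And>q v. q \<in> V \<Longrightarrow> v \<in> T q \<Longrightarrow> v = (\<Sum>j<m. tscale (c j q * g q v (F j q)) (F j q))"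
proof -
  obtain V X E' where V: "open V" "p \<in> V" and X: "\<And>b. X b \<in> C" and E': "\<And>b. E' b \<in> VF"
    and dual: "\<And>q b c. q \<in> V \<Longrightarrow> b \<in> Basis \<Longrightarrow> c \<in> Basis \<Longrightarrow>
      E' (b::'e) q (X c) = (if b = c then 1 else 0)"
    and spanning: "\<And>q v. q \<in> V \<Longrightarrow> v \<in> T q \<Longrightarrow> v = (\<Sum>b\<in>Basis. tscale (v (X b)) (E' b q))"
    by (rule coordinate_frame[of p]) (rule that; assumption)
  define m where "m = card (Basis :: 'e set)"
  obtain e :: "nat \<Rightarrow> 'e" where e: "bij_betw e {..<m} Basis"
    using ex_bij_betw_nat_finite[OF finite_Basis] unfolding m_def atLeast0LessThan by blast
  define E where "E i = E' (e i)" for i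
  have eB: "e i \<in> Basis" if "i < m" for i using e that by (auto simp: bij_betw_def)
  have indep: "E i p \<notin> tv.span ((\<lambda>j. E j p) ` {..<i})" if i: "i < m" for i
  proof
    assume "E i p \<in> tv.span ((\<lambda>j. E j p) ` {..<i})"
    moreover have "v (X (e i)) = 0" if "v \<in> tv.span ((\<lambda>j. E j p) ` {..<i})" for v
      using that
    proof (induction rule: tv.span_induct_alt)
      case base
      then show ?case by simp
    next
      case (step c u v)
      then obtain j where j: "j < i" "u = E j p" by auto
      then have "e j \<noteq> e i" using e i by (auto simp: bij_betw_def inj_on_def)
      then have "u (X (e i)) = 0" using dual[OF V(2) eB eB, of j i] i j by (simp add: E_def)
      then show ?case using step by (simp add: tscale_def)
    qed
    ultimately have "E i p (X (e i)) = 0" by blast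
    then show False using dual[OF V(2) eB eB, of i i] i by (simp add: E_def)
  qed
  have "\<forall>i<m. E i \<in> VF" using E' by (simp add: E_def)
  moreover have "\<forall>i<m. E i p \<notin> tv.span ((\<lambda>j. E j p) ` {..<i})" using indep by blast
  note gram_schmidt[OF calculation this]
  then obtain F c W where W: "open W" "p \<in> W"
    and Fc: "\<forall>j<m. F j \<in> VF \<and> c j \<in> C \<and> F j p \<in> tv.span ((\<lambda>j. E j p) ` {..<m})"
    and rep': "\<forall>q\<in>W. \<forall>i<m. E i q = (\<Sum>j<m. tscale (c j q * g q (E i q) (F j q)) (F j q))"
    by (elim exE conjE) (rule that; assumption)
  have F: "F j \<in> VF" and c: "c j \<in> C" if "j < m" for j
    using Fc that by auto
  have rep: "E i q = (\<Sum>j<m. tscale (c j q * g q (E i q) (F j q)) (F j q))"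
    if "q \<in> W" "i < m" for q i
    using rep' that by blast
  show thesis
  proof (rule that[of "V \<inter> W" m F c])
    fix q v assume q: "q \<in> V \<inter> W" and v: "v \<in> T q"
    let ?R = "\<lambda>v. \<Sum>j<m. tscale (c j q * g q v (F j q)) (F j q)"
    have Et: "E i q \<in> T q" for i using vfield_tangent[OF E'] by (simp add: E_def)
    have v_eq: "v = (\<Sum>i<m. tscale (v (X (e i))) (E i q))"
      using spanning[of q v] q v sum.reindex_bij_betw[OF e, of "\<lambda>b. tscale (v (X b)) (E' b q)"]
      by (simp add: E_def)
    have "g q v (F j q) = (\<Sum>i<m. v (X (e i)) * g q (E i q) (F j q))" if "j < m" for j
      by (subst v_eq, subst g_sum_left) (use F[OF that] Et in \<open>auto simp: g_scale_left\<close>)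
    then have "?R v = (\<Sum>j<m. \<Sum>i<m. tscale (v (X (e i)) * (c j q * g q (E i q) (F j q))) (F j q))"
      by (intro sum.cong) (auto simp: sum_distrib_left tv.scale_sum_left[symmetric] mult.left_commute)
    also have "\<dots> = (\<Sum>i<m. tscale (v (X (e i))) (?R (E i q)))"
      by (subst sum.swap) (simp add: tv.scale_sum_right tv.scale_scale)
    also have "\<dots> = (\<Sum>i<m. tscale (v (X (e i))) (E i q))"
      using rep[of q] q by (intro sum.cong) auto
    finally show "v = ?R v" using v_eq by simp
  qed (use V W F c in auto)
qed

text \<open>
  Near each point the representing field is \<open>\<Sum>\<^sub>j c\<^sub>j \<omega>(F\<^sub>j) F\<^sub>j\<close> for a reproducing frame, because
  \<open>Z - \<Sum>\<^sub>j c\<^sub>j g(Z, F\<^sub>j) F\<^sub>j\<close> vanishes there and \<open>\<omega>\<close> is local. The local fields agree on overlaps by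
  nondegeneracy of the metric.
\<close>

lemma riesz_vfield:
  assumes add: "\<And>X Y. X \<in> VF \<Longrightarrow> Y \<in> VF \<Longrightarrow> \<omega> (X + Y) = \<omega> X + \<omega> Y"
    and scale: "\<And>f X. f \<in> C \<Longrightarrow> X \<in> VF \<Longrightarrow> \<omega> (fscale f X) = f * \<omega> X"
    and smooth: "\<And>X. X \<in> VF \<Longrightarrow> \<omega> X \<in> C"
  obtains W where "W \<in> VF" "\<And>Z. Z \<in> VF \<Longrightarrow> app2 g W Z = \<omega> Z"
proof -
  have "\<exists>V W. open V \<and> p \<in> V \<and> W \<in> VF \<and> (\<forall>Z\<in>VF. \<forall>q\<in>V. g q (W q) (Z q) = \<omega> Z q)" for p
  proof -
    obtain m :: nat and F c V where V: "open V" "p \<in> V"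
      and F: "\<And>j. j < m \<Longrightarrow> F j \<in> VF" and c: "\<And>j. j < m \<Longrightarrow> c j \<in> C"
      and rep: "\<And>q v. q \<in> V \<Longrightarrow> v \<in> T q \<Longrightarrow> v = (\<Sum>j<m. tscale (c j q * g q v (F j q)) (F j q))"
      by (rule reproducing_frame[of p]) blast
    define W where "W = (\<Sum>j<m. fscale (c j * \<omega> (F j)) (F j))"
    have W: "W \<in> VF" unfolding W_def using F c smooth by (intro vfield_sum) auto
    have W_q: "W q = (\<Sum>j<m. tscale (c j q * \<omega> (F j) q) (F j q))" for q
      by (simp add: W_def sum_fun_apply)
    note W
    moreover have "g q (W q) (Z q) = \<omega> Z q" if Z: "Z \<in> VF" and q: "q \<in> V" for Z q
    proof -
      let ?S = "\<Sum>j<m. fscale (c j * app2 g Z (F j)) (F j)"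
      have S: "?S \<in> VF" using F c Z by (intro vfield_sum) auto
      have "\<omega> (Z - ?S) q = 0"
      proof (rule linear_form_vanishes_locally[OF scale _ V(1) q])
        show "(Z - ?S) r = 0" if "r \<in> V" for r
          using rep[OF that vfield_tangent[OF Z]] by (simp add: sum_fun_apply)
        show "Z - ?S \<in> VF" using Z S by (rule vfield_diff)
      qed
      moreover have "\<omega> Z = \<omega> (Z - ?S) + \<omega> ?S" using add[of "Z - ?S" ?S] Z S by simp
      moreover have "\<omega> ?S = (\<Sum>j<m. c j * app2 g Z (F j) * \<omega> (F j))"
        using F c Z scale by (subst vfield_additive_sum[where \<omega> = \<omega>, OF add]) auto
      ultimately have "\<omega> Z q = (\<Sum>j<m. c j q * g q (Z q) (F j q) * \<omega> (F j) q)"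
        by (simp add: sum_fun_apply)
      also have "\<dots> = (\<Sum>j<m. c j q * \<omega> (F j) q * g q (F j q) (Z q))"
        using F Z by (intro sum.cong) (auto simp: g_sym)
      also have "\<dots> = g q (W q) (Z q)"
        using F Z by (subst W_q, subst g_sum_left) (auto simp: g_scale_left)
      finally show ?thesis by simp
    qed
    ultimately show ?thesis using V by blast
  qed
  then obtain V W where V: "\<And>p. open (V p)" "\<And>p. p \<in> V p" and W: "\<And>p. W p \<in> VF"
    and rep: "\<And>p Z q. Z \<in> VF \<Longrightarrow> q \<in> V p \<Longrightarrow> g q (W p q) (Z q) = \<omega> Z q"
    by metis
  have eq: "W q q = W p q" if "q \<in> V p" for p q
  proof -
    let ?Z = "W q - W p"
    have "?Z \<in> VF" using W by simp
    then have "g q (?Z q) (?Z q) = 0"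
      using rep[of ?Z q q] rep[of ?Z q p] V(2)[of q] that W by (simp add: g_diff_left)
    then show ?thesis using g_pos[of "?Z q" q] W by force
  qed
  show thesis
  proof (rule that[of "\<lambda>q. W q q"])
    show "(\<lambda>q. W q q) \<in> VF"
      by (rule vfield_local) (metis V W eq)
    show "app2 g (\<lambda>q. W q q) Z = \<omega> Z" if "Z \<in> VF" for Z
      using rep[OF that V(2)] by (simp add: fun_eq_iff)
  qed
qed

end

section \<open>Three-forms and exterior derivatives of one-forms\<close>

context smooth_manifold
begin

context
  fixes t assumes t: "three_form A t"
begin

lemma three_form_swap12: "X \<in> VF \<Longrightarrow> Y \<in> VF \<Longrightarrow> Z \<in> VF \<Longrightarrow> t X Y Z = - t Y X Z"
  using t unfolding three_form_def by blast

lemma three_form_swap23: "X \<in> VF \<Longrightarrow> Y \<in> VF \<Longrightarrow> Z \<in> VF \<Longrightarrow> t X Y Z = - t X Z Y"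
  using t unfolding three_form_def by blast

lemma three_form_smooth: "X \<in> VF \<Longrightarrow> Y \<in> VF \<Longrightarrow> Z \<in> VF \<Longrightarrow> t X Y Z \<in> C"
  using t unfolding three_form_def by blast

lemma three_form_cycle: "X \<in> VF \<Longrightarrow> Y \<in> VF \<Longrightarrow> Z \<in> VF \<Longrightarrow> t X Y Z = t Z X Y"
  using three_form_swap12[of X Z Y] three_form_swap23[of X Y Z] by simp

lemma three_form_add1:
  "X \<in> VF \<Longrightarrow> X' \<in> VF \<Longrightarrow> Y \<in> VF \<Longrightarrow> Z \<in> VF \<Longrightarrow> t (X + X') Y Z = t X Y Z + t X' Y Z"
  using t unfolding three_form_def by blast

lemma three_form_scale1:
  "X \<in> VF \<Longrightarrow> Y \<in> VF \<Longrightarrow> Z \<in> VF \<Longrightarrow> f \<in> C \<Longrightarrow> t (fscale f X) Y Z = f * t X Y Z"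
  using t unfolding three_form_def by blast

lemma three_form_add2:
  "X \<in> VF \<Longrightarrow> Y \<in> VF \<Longrightarrow> Y' \<in> VF \<Longrightarrow> Z \<in> VF \<Longrightarrow> t X (Y + Y') Z = t X Y Z + t X Y' Z"
  using three_form_add1[of Y Y' Z X] three_form_cycle[of Y Z X] three_form_cycle[of Y' Z X]
    three_form_cycle[of "Y + Y'" Z X] by simp

lemma three_form_scale2:
  "X \<in> VF \<Longrightarrow> Y \<in> VF \<Longrightarrow> Z \<in> VF \<Longrightarrow> f \<in> C \<Longrightarrow> t X (fscale f Y) Z = f * t X Y Z"
  using three_form_scale1[of Y Z X f] three_form_cycle[of Y Z X]
    three_form_cycle[of "fscale f Y" Z X] by simp

lemma three_form_add3:
  "X \<in> VF \<Longrightarrow> Y \<in> VF \<Longrightarrow> Z \<in> VF \<Longrightarrow> Z' \<in> VF \<Longrightarrow> t X Y (Z + Z') = t X Y Z + t X Y Z'"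
  using three_form_add1[of Z Z' X Y] three_form_cycle[of X Y Z] three_form_cycle[of X Y Z']
    three_form_cycle[of X Y "Z + Z'"] by simp

lemma three_form_scale3:
  "X \<in> VF \<Longrightarrow> Y \<in> VF \<Longrightarrow> Z \<in> VF \<Longrightarrow> f \<in> C \<Longrightarrow> t X Y (fscale f Z) = f * t X Y Z"
  using three_form_scale1[of Z X Y f] three_form_cycle[of X Y Z]
    three_form_cycle[of X Y "fscale f Z"] by simp

end

lemma three_form_0: "three_form A (\<lambda>X Y Z. 0)"
  by (simp add: three_form_def)

lemma three_form_cong:
  assumes t: "three_form A t"
    and eq: "\<And>X Y Z. X \<in> VF \<Longrightarrow> Y \<in> VF \<Longrightarrow> Z \<in> VF \<Longrightarrow> u X Y Z = t X Y Z"
  shows "three_form A u"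
  unfolding three_form_def
proof (intro ballI conjI)
  fix X Y Z assume v: "X \<in> VF" "Y \<in> VF" "Z \<in> VF"
  show "u X Y Z \<in> C" using three_form_smooth[OF t v] by (simp only: eq v)
  show "u X Y Z = - u Y X Z" using three_form_swap12[OF t v] by (simp only: eq v)
  show "u X Y Z = - u X Z Y" using three_form_swap23[OF t v] by (simp only: eq v)
  show "u (X + W) Y Z = u X Y Z + u W Y Z" if "W \<in> VF" for W
    using three_form_add1[OF t v(1) that v(2,3)] v that by (simp only: eq vfield_add)
  show "u (fscale f X) Y Z = f * u X Y Z" if "f \<in> C" for f
    using three_form_scale1[OF t v that] v that by (simp only: eq vfield_fscale)
qed

lemma three_form_diff:
  assumes t: "three_form A t" and u: "three_form A u"
  shows "three_form A (\<lambda>X Y Z. t X Y Z - u X Y Z)"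
  unfolding three_form_def
proof (intro ballI conjI)
  fix X Y Z assume v: "X \<in> VF" "Y \<in> VF" "Z \<in> VF"
  show "t X Y Z - u X Y Z \<in> C" using three_form_smooth[OF t v] three_form_smooth[OF u v] by simp
  show "t X Y Z - u X Y Z = - (t Y X Z - u Y X Z)"
    using three_form_swap12[OF t v] three_form_swap12[OF u v] by simp
  show "t X Y Z - u X Y Z = - (t X Z Y - u X Z Y)"
    using three_form_swap23[OF t v] three_form_swap23[OF u v] by simp
  show "t (X + W) Y Z - u (X + W) Y Z = t X Y Z - u X Y Z + (t W Y Z - u W Y Z)" if "W \<in> VF" for W
    using v that by (simp add: three_form_add1[OF t] three_form_add1[OF u])
  show "t (fscale f X) Y Z - u (fscale f X) Y Z = f * (t X Y Z - u X Y Z)" if "f \<in> C" for f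
    using v that by (simp add: three_form_scale1[OF t] three_form_scale1[OF u] right_diff_distrib)
qed

lemma three_form_sum:
  assumes t: "\<And>i. i \<in> I \<Longrightarrow> three_form A (t i)"
  shows "three_form A (\<lambda>X Y Z. \<Sum>i\<in>I. t i X Y Z)"
  unfolding three_form_def
proof (intro ballI conjI)
  fix X Y Z assume v: "X \<in> VF" "Y \<in> VF" "Z \<in> VF"
  show "(\<Sum>i\<in>I. t i X Y Z) \<in> C" using three_form_smooth[OF t v] by (rule smooth_sum)
  show "(\<Sum>i\<in>I. t i X Y Z) = - (\<Sum>i\<in>I. t i Y X Z)"
    unfolding sum_negf[symmetric] using three_form_swap12[OF t v] by (rule sum.cong[OF refl])
  show "(\<Sum>i\<in>I. t i X Y Z) = - (\<Sum>i\<in>I. t i X Z Y)"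
    unfolding sum_negf[symmetric] using three_form_swap23[OF t v] by (rule sum.cong[OF refl])
  show "(\<Sum>i\<in>I. t i (X + W) Y Z) = (\<Sum>i\<in>I. t i X Y Z) + (\<Sum>i\<in>I. t i W Y Z)" if "W \<in> VF" for W
    unfolding sum.distrib[symmetric] using three_form_add1[OF t v(1) that v(2,3)]
    by (rule sum.cong[OF refl])
  show "(\<Sum>i\<in>I. t i (fscale f X) Y Z) = f * (\<Sum>i\<in>I. t i X Y Z)" if "f \<in> C" for f
    unfolding sum_distrib_left using three_form_scale1[OF t v that] by (rule sum.cong[OF refl])
qed

context
  fixes \<eta> assumes \<eta>: "one_form A \<eta>"
begin

lemma one_form_add: "u \<in> T p \<Longrightarrow> v \<in> T p \<Longrightarrow> \<eta> p (u + v) = \<eta> p u + \<eta> p v"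
  using \<eta> unfolding one_form_def by blast

lemma one_form_scale: "u \<in> T p \<Longrightarrow> \<eta> p (tscale c u) = c * \<eta> p u"
  using \<eta> unfolding one_form_def by blast

lemma one_form_smooth: "X \<in> VF \<Longrightarrow> app1 \<eta> X \<in> C"
  using \<eta> unfolding one_form_def by blast

lemma one_form_uminus: "u \<in> T p \<Longrightarrow> \<eta> p (- u) = - \<eta> p u"
  using one_form_scale[of u p "-1"] by (simp add: tscale_minus1)

lemma one_form_diff: "u \<in> T p \<Longrightarrow> v \<in> T p \<Longrightarrow> \<eta> p (u - v) = \<eta> p u - \<eta> p v"
  using one_form_add[of u p "- v"] one_form_uminus[of v p] by simp

lemma one_form_zero: "\<eta> p 0 = 0"
  using one_form_diff[of 0 p 0] by simp

lemma app1_add: "X \<in> VF \<Longrightarrow> Y \<in> VF \<Longrightarrow> app1 \<eta> (X + Y) = app1 \<eta> X + app1 \<eta> Y"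
  by (simp add: fun_eq_iff one_form_add)

lemma app1_diff: "X \<in> VF \<Longrightarrow> Y \<in> VF \<Longrightarrow> app1 \<eta> (X - Y) = app1 \<eta> X - app1 \<eta> Y"
  by (simp add: fun_eq_iff one_form_diff)

lemma app1_fscale: "X \<in> VF \<Longrightarrow> app1 \<eta> (fscale f X) = f * app1 \<eta> X"
  by (simp add: fun_eq_iff one_form_scale)

lemma app1_zero: "app1 \<eta> 0 = 0"
  by (simp add: fun_eq_iff one_form_zero)

lemma d1_smooth: "X \<in> VF \<Longrightarrow> Y \<in> VF \<Longrightarrow> d1 \<eta> X Y \<in> C"
  unfolding d1_def by (intro smooth_diff deriv_along_smooth one_form_smooth vfield_lie_bracket)

lemma d1_antisym:
  assumes "X \<in> VF" "Y \<in> VF"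
  shows "d1 \<eta> X Y = - d1 \<eta> Y X"
proof -
  have "app1 \<eta> (lie_bracket Y X) = - app1 \<eta> (lie_bracket X Y)"
    using assms by (simp add: fun_eq_iff lie_bracket_antisym[of Y] one_form_uminus)
  then show ?thesis by (simp add: d1_def)
qed

lemma d1_add_left:
  assumes "X \<in> VF" "X' \<in> VF" "Y \<in> VF"
  shows "d1 \<eta> (X + X') Y = d1 \<eta> X Y + d1 \<eta> X' Y"
  using assms
  by (simp add: d1_def lie_bracket_add_left app1_add deriv_along_add one_form_smooth
      deriv_along_add_left)

lemma d1_fscale_left:
  assumes "X \<in> VF" "Y \<in> VF" "f \<in> C"
  shows "d1 \<eta> (fscale f X) Y = f * d1 \<eta> X Y"
  using assms
  by (simp add: d1_def lie_bracket_fscale_left app1_diff app1_fscale deriv_along_mult one_form_smooth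
      deriv_along_fscale algebra_simps)

lemma three_form_wedge: "three_form A (wedge12 \<eta> (d1 \<eta>))"
  unfolding three_form_def
proof (intro ballI conjI)
  fix X Y Z assume v: "X \<in> VF" "Y \<in> VF" "Z \<in> VF"
  show "wedge12 \<eta> (d1 \<eta>) X Y Z \<in> C"
    using v unfolding wedge12_def
    by (intro smooth_diff smooth_add smooth_mult one_form_smooth d1_smooth)
  show "wedge12 \<eta> (d1 \<eta>) X Y Z = - wedge12 \<eta> (d1 \<eta>) Y X Z"
    using d1_antisym[OF v(1,2)] by (simp add: wedge12_def)
  show "wedge12 \<eta> (d1 \<eta>) X Y Z = - wedge12 \<eta> (d1 \<eta>) X Z Y"
    using d1_antisym[OF v(2,3)] by (simp add: wedge12_def)
  show "wedge12 \<eta> (d1 \<eta>) (X + W) Y Z = wedge12 \<eta> (d1 \<eta>) X Y Z + wedge12 \<eta> (d1 \<eta>) W Y Z"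
    if "W \<in> VF" for W
    using v that by (simp add: wedge12_def app1_add d1_add_left algebra_simps)
  show "wedge12 \<eta> (d1 \<eta>) (fscale f X) Y Z = f * wedge12 \<eta> (d1 \<eta>) X Y Z" if "f \<in> C" for f
    using v that by (simp add: wedge12_def app1_fscale d1_fscale_left algebra_simps)
qed

end

end

section \<open>Metric connections with prescribed skew torsion\<close>

context riemannian_manifold
begin

lemma app2_g_add:
  "X \<in> VF \<Longrightarrow> Y \<in> VF \<Longrightarrow> Z \<in> VF \<Longrightarrow> app2 g (X + Y) Z = app2 g X Z + app2 g Y Z"
  "X \<in> VF \<Longrightarrow> Y \<in> VF \<Longrightarrow> Z \<in> VF \<Longrightarrow> app2 g Z (X + Y) = app2 g Z X + app2 g Z Y"
  by (simp_all add: fun_eq_iff g_linear)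

lemma app2_g_diff:
  "X \<in> VF \<Longrightarrow> Y \<in> VF \<Longrightarrow> Z \<in> VF \<Longrightarrow> app2 g (X - Y) Z = app2 g X Z - app2 g Y Z"
  "X \<in> VF \<Longrightarrow> Y \<in> VF \<Longrightarrow> Z \<in> VF \<Longrightarrow> app2 g Z (X - Y) = app2 g Z X - app2 g Z Y"
  by (simp_all add: fun_eq_iff g_linear)

lemma app2_g_uminus:
  "X \<in> VF \<Longrightarrow> Y \<in> VF \<Longrightarrow> app2 g (- X) Y = - app2 g X Y"
  "X \<in> VF \<Longrightarrow> Y \<in> VF \<Longrightarrow> app2 g X (- Y) = - app2 g X Y"
  by (simp_all add: fun_eq_iff g_linear)

lemma app2_g_fscale:
  "X \<in> VF \<Longrightarrow> Y \<in> VF \<Longrightarrow> app2 g (fscale f X) Y = f * app2 g X Y"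
  "X \<in> VF \<Longrightarrow> Y \<in> VF \<Longrightarrow> app2 g X (fscale f Y) = f * app2 g X Y"
  by (simp_all add: fun_eq_iff g_linear)

lemma app2_g_zero: "X \<in> VF \<Longrightarrow> app2 g 0 X = 0"
  by (simp add: fun_eq_iff g_zero_left)

text \<open>
  The right-hand side of the Koszul formula, that is, twice \<open>g(D\<^sub>X Y, Z)\<close>, for a metric connection with
  torsion \<open>t\<close>.
\<close>

definition koszul where
  "koszul t X Y Z = deriv_along X (app2 g Y Z) + deriv_along Y (app2 g X Z) - deriv_along Z (app2 g X Y)
    + app2 g (lie_bracket X Y) Z - app2 g (lie_bracket X Z) Y - app2 g (lie_bracket Y Z) X + t X Y Z"

lemmas koszul_simps = koszul_def lie_bracket_add_left lie_bracket_add_right lie_bracket_fscale_left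
  lie_bracket_fscale_right app2_g_add app2_g_diff app2_g_fscale deriv_along_add deriv_along_mult
  deriv_along_add_left deriv_along_fscale

lemma koszul_add:
  assumes t: "three_form A t" and v: "X \<in> VF" "Y \<in> VF" "Z \<in> VF" "W \<in> VF"
  shows "koszul t (X + W) Y Z = koszul t X Y Z + koszul t W Y Z"
    "koszul t X (Y + W) Z = koszul t X Y Z + koszul t X W Z"
    "koszul t X Y (Z + W) = koszul t X Y Z + koszul t X Y W"
  using v by (simp_all add: koszul_simps three_form_add1[OF t] three_form_add2[OF t] three_form_add3[OF t])

lemma koszul_fscale:
  assumes t: "three_form A t" and v: "X \<in> VF" "Y \<in> VF" "Z \<in> VF" "f \<in> C"
  shows "koszul t (fscale f X) Y Z = f * koszul t X Y Z"
    "koszul t X (fscale f Y) Z = f * koszul t X Y Z + (\<lambda>_. 2) * (deriv_along X f * app2 g Y Z)"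
    "koszul t X Y (fscale f Z) = f * koszul t X Y Z"
  using v
  by (simp_all add: koszul_simps three_form_scale1[OF t] three_form_scale2[OF t] three_form_scale3[OF t])
     (simp_all add: fun_eq_iff g_sym[OF vfield_tangent[OF v(1)] vfield_tangent[OF v(2)]]
        g_sym[OF vfield_tangent[OF v(1)] vfield_tangent[OF v(3)]]
        g_sym[OF vfield_tangent[OF v(2)] vfield_tangent[OF v(3)]] algebra_simps)

lemma koszul_smooth:
  assumes t: "three_form A t" and v: "X \<in> VF" "Y \<in> VF" "Z \<in> VF"
  shows "koszul t X Y Z \<in> C"
  using v three_form_smooth[OF t v] by (simp add: koszul_def)

lemma metric_connectionD:
  assumes "metric_connection A g D" "X \<in> VF" "Y \<in> VF"
  shows "D X Y \<in> VF"
    and "Z \<in> VF \<Longrightarrow> deriv_along X (app2 g Y Z) = app2 g (D X Y) Z + app2 g Y (D X Z)"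
    and "Z \<in> VF \<Longrightarrow> app2 g (lie_bracket X Y) Z
      = app2 g (D X Y) Z - app2 g (D Y X) Z - app2 g (torsion D X Y) Z"
proof -
  have D: "D X Y \<in> VF" if "X \<in> VF" "Y \<in> VF" for X Y
    using assms(1) that unfolding metric_connection_def affine_connection_def by blast
  show "D X Y \<in> VF" using D assms by blast
  show "deriv_along X (app2 g Y Z) = app2 g (D X Y) Z + app2 g Y (D X Z)" if "Z \<in> VF"
  proof -
    have "cov_form2 D g X Y Z = 0" using assms that unfolding metric_connection_def by blast
    then show ?thesis by (simp add: cov_form2_def diff_eq_eq add.commute)
  qed
  show "app2 g (lie_bracket X Y) Z = app2 g (D X Y) Z - app2 g (D Y X) Z - app2 g (torsion D X Y) Z"
    if "Z \<in> VF"
    using assms(2,3) that D by (simp add: torsion_def app2_g_diff)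
qed

text \<open>
  Eliminate the Lie brackets through the torsion and the derivatives of \<open>g\<close> through metricity. The
  torsion contributes \<open>t(X, Z, Y) + t(Y, Z, X)\<close>, which is \<open>0\<close> for a 3-form.
\<close>

lemma metric_connection_koszul:
  assumes D: "metric_connection A g D" and t: "three_form A t"
    and tor: "\<And>X Y Z. X \<in> VF \<Longrightarrow> Y \<in> VF \<Longrightarrow> Z \<in> VF \<Longrightarrow> app2 g (torsion D X Y) Z = t X Y Z"
    and v: "X \<in> VF" "Y \<in> VF" "Z \<in> VF"
  shows "(\<lambda>_. 2) * app2 g (D X Y) Z = koszul t X Y Z"
proof -
  have sym: "app2 g U (D V W) = app2 g (D V W) U" if "U \<in> VF" "V \<in> VF" "W \<in> VF" for U V W
    using that metric_connectionD(1)[OF D] by (intro app2_g_sym)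
  have "koszul t X Y Z = app2 g (D X Y) Z + app2 g (D X Y) Z + (t X Z Y + t X Y Z + (t Y Z X - t X Y Z))"
    unfolding koszul_def using v
    by (simp add: metric_connectionD[OF D] tor sym)
  also have "t X Z Y + t X Y Z + (t Y Z X - t X Y Z) = 0"
    using three_form_swap23[OF t v] three_form_cycle[OF t v(2,3,1)] by simp
  finally show ?thesis by (simp add: fun_eq_iff)
qed

lemma skew_torsion_connection_unique:
  assumes D: "metric_connection A g D" "metric_connection A g D'" and t: "three_form A t"
    and tor: "\<And>X Y Z. X \<in> VF \<Longrightarrow> Y \<in> VF \<Longrightarrow> Z \<in> VF \<Longrightarrow> app2 g (torsion D X Y) Z = t X Y Z"
      "\<And>X Y Z. X \<in> VF \<Longrightarrow> Y \<in> VF \<Longrightarrow> Z \<in> VF \<Longrightarrow> app2 g (torsion D' X Y) Z = t X Y Z"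
  shows "D = D'"
proof (intro ext)
  fix X Y
  have "D X Y = D' X Y"
  proof (cases "X \<in> VF \<and> Y \<in> VF")
    case True
    then have v: "X \<in> VF" "Y \<in> VF" by auto
    show ?thesis
    proof (rule g_nondegenerate[OF metric_connectionD(1)[OF D(1) v] metric_connectionD(1)[OF D(2) v]])
      fix Z assume Z: "Z \<in> VF"
      have "(\<lambda>_. 2) * app2 g (D X Y) Z = (\<lambda>_. 2) * app2 g (D' X Y) Z"
        using metric_connection_koszul[OF D(1) t tor(1) v Z]
          metric_connection_koszul[OF D(2) t tor(2) v Z] by (simp only:)
      then show "app2 g (D X Y) Z = app2 g (D' X Y) Z" by (simp add: fun_eq_iff)
    qed
  next
    case False
    have "affine_connection A D" "affine_connection A D'" using D by (auto simp: metric_connection_def)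
    then show ?thesis using False unfolding affine_connection_def by auto
  qed
  then show "D X Y p f = D' X Y p f" for p f by simp
qed

text \<open>
  The Koszul expression is linear over the smooth functions in \<open>Z\<close>, hence represented by a field
  \<open>D X Y\<close>. The connection axioms hold because both sides have the same inner products.
\<close>

lemma skew_torsion_connection_exists:
  assumes t: "three_form A t"
  obtains D where "metric_connection A g D"
    "\<And>X Y Z. X \<in> VF \<Longrightarrow> Y \<in> VF \<Longrightarrow> Z \<in> VF \<Longrightarrow> app2 g (torsion D X Y) Z = t X Y Z"
proof -
  have "\<exists>W\<in>VF. \<forall>Z\<in>VF. app2 g W Z = (\<lambda>_. 1 / 2) * koszul t X Y Z" if v: "X \<in> VF" "Y \<in> VF" for X Y
  proof (rule riesz_vfield[of "\<lambda>Z. (\<lambda>_. 1 / 2) * koszul t X Y Z"])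
    show "(\<lambda>_. 1 / 2) * koszul t X Y (Z + W) = (\<lambda>_. 1 / 2) * koszul t X Y Z + (\<lambda>_. 1 / 2) * koszul t X Y W"
      if "Z \<in> VF" "W \<in> VF" for Z W
      using v that by (simp add: koszul_add[OF t] distrib_left)
    show "(\<lambda>_. 1 / 2) * koszul t X Y (fscale f Z) = f * ((\<lambda>_. 1 / 2) * koszul t X Y Z)"
      if "f \<in> C" "Z \<in> VF" for f Z
      using v that by (simp add: koszul_fscale[OF t] mult.left_commute)
    show "(\<lambda>_. 1 / 2) * koszul t X Y Z \<in> C" if "Z \<in> VF" for Z
      using v that by (intro smooth_mult smooth_const koszul_smooth[OF t])
  qed blast
  then obtain D0 where D0: "\<And>X Y. X \<in> VF \<Longrightarrow> Y \<in> VF \<Longrightarrow> D0 X Y \<in> VF"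
    "\<And>X Y Z. X \<in> VF \<Longrightarrow> Y \<in> VF \<Longrightarrow> Z \<in> VF \<Longrightarrow> app2 g (D0 X Y) Z = (\<lambda>_. 1 / 2) * koszul t X Y Z"
    by metis
  define D where "D X Y = (if X \<in> VF \<and> Y \<in> VF then D0 X Y else 0)" for X Y
  have D: "D X Y \<in> VF" if "X \<in> VF" "Y \<in> VF" for X Y
    using that D0 by (simp add: D_def)
  have gD: "app2 g (D X Y) Z = (\<lambda>_. 1 / 2) * koszul t X Y Z"
    if "X \<in> VF" "Y \<in> VF" "Z \<in> VF" for X Y Z
    using that D0 by (simp add: D_def)
  have "affine_connection A D"
    unfolding affine_connection_def
  proof (intro conjI ballI allI impI)
    fix X Y assume v: "X \<in> VF" "Y \<in> VF"
    show "D X Y \<in> VF" using D v .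
    show "D (X + X') Y = D X Y + D X' Y" if "X' \<in> VF" for X'
      using v that D
      by (intro g_nondegenerate) (simp_all add: gD app2_g_add koszul_add[OF t] distrib_left)
    show "D X (Y + Y') = D X Y + D X Y'" if "Y' \<in> VF" for Y'
      using v that D
      by (intro g_nondegenerate) (simp_all add: gD app2_g_add koszul_add[OF t] distrib_left)
    fix f assume f: "f \<in> C"
    show "D (fscale f X) Y = fscale f (D X Y)"
      using v f D
      by (intro g_nondegenerate)
         (simp_all add: gD app2_g_fscale koszul_fscale[OF t] mult.left_commute)
    show "D X (fscale f Y) = fscale (deriv_along X f) Y + fscale f (D X Y)"
    proof (rule g_nondegenerate)
      fix Z assume Z: "Z \<in> VF"
      show "app2 g (D X (fscale f Y)) Z = app2 g (fscale (deriv_along X f) Y + fscale f (D X Y)) Z"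
        using v Z f D
        by (simp add: gD app2_g_fscale app2_g_add koszul_fscale[OF t] del: app2_apply)
           (simp add: fun_eq_iff algebra_simps)
    qed (use v f D in auto)
  next
    fix X Y :: "'a vfield" assume "X \<notin> VF \<or> Y \<notin> VF"
    then show "D X Y = 0" by (auto simp: D_def)
  qed
  moreover have "cov_form2 D g X Y Z = 0" if v: "X \<in> VF" "Y \<in> VF" "Z \<in> VF" for X Y Z
  proof -
    have sym: "app2 g U V = app2 g V U" if "U \<in> VF" "V \<in> VF" for U V
      using that by (rule app2_g_sym)
    have br: "app2 g (lie_bracket Z Y) X = - app2 g (lie_bracket Y Z) X"
      using v by (simp add: lie_bracket_antisym[of Z Y] app2_g_uminus)
    have "app2 g Y (D X Z) = app2 g (D X Z) Y" by (rule sym[OF v(2) D[OF v(1,3)]])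
    moreover have "app2 g (D X Y) Z p + app2 g (D X Z) Y p = deriv_along X (app2 g Y Z) p" for p
      using fun_cong[OF three_form_swap23[OF t v], of p] fun_cong[OF br, of p]
      unfolding gD[OF v] gD[OF v(1,3,2)] koszul_def sym[OF v(3,2)]
      by (simp add: field_simps del: app2_apply deriv_along_apply)
    then have "app2 g (D X Y) Z + app2 g (D X Z) Y = deriv_along X (app2 g Y Z)"
      unfolding fun_eq_iff plus_fun_apply by blast
    ultimately show ?thesis unfolding cov_form2_def by (simp add: algebra_simps)
  qed
  ultimately have metric: "metric_connection A g D" by (simp add: metric_connection_def)
  have "app2 g (torsion D X Y) Z = t X Y Z" if v: "X \<in> VF" "Y \<in> VF" "Z \<in> VF" for X Y Z
  proof -
    have sym: "app2 g X Y = app2 g Y X" using v(1,2) by (rule app2_g_sym)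
    have br: "app2 g (lie_bracket Y X) Z = - app2 g (lie_bracket X Y) Z"
      using v by (simp add: lie_bracket_antisym[of Y X] app2_g_uminus)
    have "app2 g (D X Y) Z p - app2 g (D Y X) Z p = app2 g (lie_bracket X Y) Z p + t X Y Z p" for p
      using fun_cong[OF three_form_swap12[OF t v], of p] fun_cong[OF br, of p]
      unfolding gD[OF v] gD[OF v(2,1,3)] koszul_def sym
      by (simp add: field_simps del: app2_apply deriv_along_apply)
    moreover have "app2 g (torsion D X Y) Z = app2 g (D X Y) Z - app2 g (D Y X) Z - app2 g (lie_bracket X Y) Z"
      using v D by (simp add: torsion_def app2_g_diff)
    ultimately show ?thesis by (simp add: fun_eq_iff del: app2_apply)
  qed
  then show thesis using that metric by blast
qed

lemma levi_civita:
  shows "metric_connection A g (levi_civita A g)"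
    "\<And>X Y. X \<in> VF \<Longrightarrow> Y \<in> VF \<Longrightarrow> torsion (levi_civita A g) X Y = 0"
proof -
  obtain D where D: "metric_connection A g D"
    "\<And>X Y Z. X \<in> VF \<Longrightarrow> Y \<in> VF \<Longrightarrow> Z \<in> VF \<Longrightarrow> app2 g (torsion D X Y) Z = 0"
    by (rule skew_torsion_connection_exists[OF three_form_0]) blast
  have tD: "torsion D X Y = 0" if v: "X \<in> VF" "Y \<in> VF" for X Y
  proof (rule g_nondegenerate)
    show "torsion D X Y \<in> VF"
      using v metric_connectionD(1)[OF D(1)] by (simp add: torsion_def)
    show "app2 g (torsion D X Y) Z = app2 g 0 Z" if "Z \<in> VF" for Z
      using D(2)[OF v that] app2_g_zero[OF that] by simp
  qed simp
  have *: "\<exists>!D. metric_connection A g D \<and> (\<forall>X\<in>VF. \<forall>Y\<in>VF. torsion D X Y = 0)"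
  proof (rule ex1I[of _ D])
    fix D' assume D': "metric_connection A g D' \<and> (\<forall>X\<in>VF. \<forall>Y\<in>VF. torsion D' X Y = 0)"
    show "D' = D"
      by (rule skew_torsion_connection_unique[OF _ D(1) three_form_0])
         (use D D' in \<open>auto simp: app2_g_zero\<close>)
  qed (use D tD in blast)
  from theI'[OF this] show "metric_connection A g (levi_civita A g)"
    "\<And>X Y. X \<in> VF \<Longrightarrow> Y \<in> VF \<Longrightarrow> torsion (levi_civita A g) X Y = 0"
    unfolding levi_civita_def by blast+
qed

text \<open>
  The Koszul formulas for the torsions \<open>t\<close> and \<open>0\<close> differ by \<open>t\<close>.
\<close>

lemma skew_torsion_connection_levi_civita:
  assumes D: "metric_connection A g D" and t: "three_form A t"
    and tor: "\<And>X Y Z. X \<in> VF \<Longrightarrow> Y \<in> VF \<Longrightarrow> Z \<in> VF \<Longrightarrow> app2 g (torsion D X Y) Z = t X Y Z"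
    and v: "X \<in> VF" "Y \<in> VF" "Z \<in> VF"
  shows "g p (D X Y p) (Z p) = g p (levi_civita A g X Y p) (Z p) + 1 / 2 * t X Y Z p"
proof -
  have "app2 g (torsion (levi_civita A g) X Y) Z = 0" if "X \<in> VF" "Y \<in> VF" "Z \<in> VF" for X Y Z
    unfolding levi_civita(2)[OF that(1,2)] using that(3) by (rule app2_g_zero)
  from fun_cong[OF metric_connection_koszul[OF levi_civita(1) three_form_0 this v], of p]
    fun_cong[OF metric_connection_koszul[OF D t tor v], of p]
  show ?thesis by (simp add: koszul_def)
qed

end

section \<open>Metric f-manifolds\<close>

sublocale metric_f_manifold \<subseteq> riemannian_manifold A g
  by unfold_locales (rule metric)

context metric_f_manifold
begin

abbreviation (input) "\<Phi> \<equiv> appE \<phi>"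
abbreviation (input) "G \<equiv> app2 g"

lemma phi_tangent [simp, intro]: "v \<in> T p \<Longrightarrow> \<phi> p v \<in> T p"
  using phi_tensor[unfolded endo_field_def, THEN conjunct1] by blast

lemma phi_add: "u \<in> T p \<Longrightarrow> v \<in> T p \<Longrightarrow> \<phi> p (u + v) = \<phi> p u + \<phi> p v"
  using phi_tensor[unfolded endo_field_def, THEN conjunct2, THEN conjunct1] by blast

lemma phi_scale: "u \<in> T p \<Longrightarrow> \<phi> p (tscale c u) = tscale c (\<phi> p u)"
  using phi_tensor[unfolded endo_field_def, THEN conjunct2, THEN conjunct2, THEN conjunct1] by blast

lemma phi_vfield [simp, intro]: "X \<in> VF \<Longrightarrow> \<Phi> X \<in> VF"
  using phi_tensor[unfolded endo_field_def, THEN conjunct2, THEN conjunct2, THEN conjunct2] by blast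

lemma phi_uminus: "u \<in> T p \<Longrightarrow> \<phi> p (- u) = - \<phi> p u"
  using phi_scale[of u p "-1"] by (simp add: tscale_minus1)

lemma phi_diff: "u \<in> T p \<Longrightarrow> v \<in> T p \<Longrightarrow> \<phi> p (u - v) = \<phi> p u - \<phi> p v"
  using phi_add[of u p "- v"] phi_uminus[of v p] by simp

lemma phi_zero: "\<phi> p 0 = 0"
  using phi_diff[of 0 p 0] by simp

lemma xi_tangent [simp, intro]: "i \<in> {1..s} \<Longrightarrow> \<xi> i p \<in> T p"
  using xi_vfield by blast

lemma phi_xi: "i \<in> {1..s} \<Longrightarrow> \<phi> p (\<xi> i p) = 0"
  using phi_kernel[of p] tv.span_base[of "\<xi> i p" "(\<lambda>i. \<xi> i p) ` {1..s}"] by blast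

lemma Phi_xi: "i \<in> {1..s} \<Longrightarrow> \<Phi> (\<xi> i) = 0"
  using phi_xi by (intro ext) (simp add: zero_fun_def appE_def)

lemma Phi_zero: "\<Phi> 0 = 0"
  by (intro ext) (simp add: phi_zero)

text \<open>
  The compatibility of \<open>\<phi>\<close> and \<open>g\<close>, with \<open>\<xi>\<^sub>i\<close> in the first argument.
\<close>

lemma eta_eq_g:
  assumes i: "i \<in> {1..s}" and v: "v \<in> T p"
  shows "\<eta> i p v = g p (\<xi> i p) v"
proof -
  have "0 = g p (\<xi> i p) v - (\<Sum>j=1..s. \<eta> j p (\<xi> i p) * \<eta> j p v)"
    using phi_metric[of "\<xi> i p" p v] i v by (simp add: phi_xi g_zero_left)
  also have "(\<Sum>j=1..s. \<eta> j p (\<xi> i p) * \<eta> j p v) = (\<Sum>j=1..s. if j = i then \<eta> j p v else 0)"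
    using i by (intro sum.cong) (simp_all add: eta_xi)
  also have "\<dots> = \<eta> i p v" using i by simp
  finally show ?thesis by simp
qed

lemma app1_eta_eq_g:
  "i \<in> {1..s} \<Longrightarrow> X \<in> VF \<Longrightarrow> app1 (\<eta> i) X = G (\<xi> i) X"
  by (rule ext) (simp add: eta_eq_g)

lemma phi_skew:
  assumes u: "u \<in> T p" and v: "v \<in> T p"
  shows "g p (\<phi> p u) v = - g p u (\<phi> p v)"
proof -
  have "g p (\<phi> p u) (\<phi> p (\<phi> p v)) = g p u (\<phi> p v)"
    using phi_metric[of u p "\<phi> p v"] u v by (simp add: eta_phi)
  moreover have "g p (\<phi> p u) (\<Sum>i=1..s. tscale (\<eta> i p v) (\<xi> i p)) = 0"
  proof -
    have "g p (\<phi> p u) (\<Sum>i=1..s. tscale (\<eta> i p v) (\<xi> i p))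
        = (\<Sum>i=1..s. g p (tscale (\<eta> i p v) (\<xi> i p)) (\<phi> p u))"
      using u by (subst g_sym) (auto intro!: g_sum_left tangent_space_sum)
    also have "\<dots> = 0"
      using u by (intro sum.neutral) (simp add: g_scale_left eta_eq_g[symmetric] eta_phi)
    finally show ?thesis .
  qed
  moreover have "(\<Sum>i=1..s. tscale (\<eta> i p v) (\<xi> i p)) \<in> T p"
    by (intro tangent_space_sum) auto
  ultimately show ?thesis
    using u v by (simp add: phi_squared g_diff_right)
qed

lemma Phi_skew: "X \<in> VF \<Longrightarrow> Y \<in> VF \<Longrightarrow> G (\<Phi> X) Y = - G X (\<Phi> Y)"
  by (rule ext) (simp add: phi_skew)

lemma app1_eta_Phi: "i \<in> {1..s} \<Longrightarrow> X \<in> VF \<Longrightarrow> app1 (\<eta> i) (\<Phi> X) = 0"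
  by (rule ext) (simp add: eta_phi)

lemma vertical_zero:
  assumes v: "v \<in> T p" and "\<phi> p v = 0" "\<And>i. i \<in> {1..s} \<Longrightarrow> \<eta> i p v = 0"
  shows "v = 0"
proof -
  have "(\<Sum>i=1..s. tscale (\<eta> i p v) (\<xi> i p)) = 0"
    using assms(3) by (intro sum.neutral) (simp add: tscale_def zero_fun_def)
  then show ?thesis using phi_squared[OF v] assms(2) by (simp add: phi_zero)
qed

lemma Phi_squared:
  assumes "X \<in> VF"
  shows "\<Phi> (\<Phi> X) = - X + (\<Sum>i=1..s. fscale (app1 (\<eta> i) X) (\<xi> i))"
proof
  fix p
  have "\<phi> p (\<phi> p (X p)) = - X p + (\<Sum>i=1..s. tscale (\<eta> i p (X p)) (\<xi> i p))"
    using assms by (rule phi_squared[OF vfield_tangent])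
  also have "(\<Sum>i=1..s. tscale (\<eta> i p (X p)) (\<xi> i p)) = (\<Sum>i=1..s. fscale (app1 (\<eta> i) X) (\<xi> i)) p"
    by (subst sum_fun_apply) simp
  finally show "\<Phi> (\<Phi> X) p = (- X + (\<Sum>i=1..s. fscale (app1 (\<eta> i) X) (\<xi> i))) p"
    by (subst plus_fun_apply, subst uminus_apply, subst appE_apply, subst appE_apply)
qed

text \<open>
  This is how \<open>\<phi>\<^sup>2 = - Id + \<Sum>\<^sub>i \<eta>\<^sub>i \<otimes> \<xi>\<^sub>i\<close> is used in each slot of a tensor that is only known as a map on
  vector fields.
\<close>

lemma linear_Phi_squared:
  assumes add: "\<And>X Y. X \<in> VF \<Longrightarrow> Y \<in> VF \<Longrightarrow> \<omega> (X + Y) = \<omega> X + \<omega> Y"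
    and scale: "\<And>f X. f \<in> C \<Longrightarrow> X \<in> VF \<Longrightarrow> \<omega> (fscale f X) = f * \<omega> X"
    and X: "X \<in> VF"
  shows "\<omega> (\<Phi> (\<Phi> X)) = - \<omega> X + (\<Sum>i=1..s. app1 (\<eta> i) X * \<omega> (\<xi> i))"
proof -
  have "\<omega> (X + \<Phi> (\<Phi> X)) = \<omega> X + \<omega> (\<Phi> (\<Phi> X))" using X by (intro add) auto
  moreover have "\<omega> (X + \<Phi> (\<Phi> X)) = (\<Sum>i=1..s. app1 (\<eta> i) X * \<omega> (\<xi> i))"
  proof -
    have "X + \<Phi> (\<Phi> X) = (\<Sum>i=1..s. fscale (app1 (\<eta> i) X) (\<xi> i))"
      using Phi_squared[OF X] by simp
    then have "\<omega> (X + \<Phi> (\<Phi> X)) = (\<Sum>i=1..s. \<omega> (fscale (app1 (\<eta> i) X) (\<xi> i)))"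
      using vfield_additive_sum[where \<omega> = \<omega> and I = "{1..s}" and X = "\<lambda>i. fscale (app1 (\<eta> i) X) (\<xi> i)"] X add
      by (simp only: vfield_fscale xi_vfield one_form_smooth[OF eta_form])
    also have "\<dots> = (\<Sum>i=1..s. app1 (\<eta> i) X * \<omega> (\<xi> i))"
      using X by (intro sum.cong scale refl one_form_smooth eta_form xi_vfield)
    finally show ?thesis .
  qed
  ultimately show ?thesis by (simp add: algebra_simps)
qed

lemma G_Phi_squared:
  assumes "X \<in> VF" "Y \<in> VF"
  shows "G Y (\<Phi> (\<Phi> X)) = - G Y X + (\<Sum>i=1..s. app1 (\<eta> i) X * app1 (\<eta> i) Y)"
  using linear_Phi_squared[of "G Y" X] assms
  by (simp add: app2_g_add app2_g_fscale app1_eta_eq_g app2_g_sym[of Y "\<xi> _"] xi_vfield)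

text \<open>
  By nondegeneracy of \<open>g\<close>, the connection makes \<open>\<phi>\<close> parallel iff this tensor vanishes. Unlike \<open>D\<phi>\<close>
  itself it can be studied through its symmetries.
\<close>

definition phi_defect :: "'a connection \<Rightarrow> 'a vfield \<Rightarrow> 'a vfield \<Rightarrow> 'a vfield \<Rightarrow> 'a \<Rightarrow> real" where
  "phi_defect D X Y Z = app2 g (cov_endo D \<phi> X Y) Z"

definition torsion_form :: "'a connection \<Rightarrow> 'a vfield \<Rightarrow> 'a vfield \<Rightarrow> 'a vfield \<Rightarrow> 'a \<Rightarrow> real" where
  "torsion_form D X Y Z = app2 g (torsion D X Y) Z"

context
  fixes D assumes D: "metric_connection A g D"
begin

lemma D_vfield [simp, intro]: "X \<in> VF \<Longrightarrow> Y \<in> VF \<Longrightarrow> D X Y \<in> VF"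
  by (rule metric_connectionD(1)[OF D])

lemma cov_endo_vfield [simp, intro]: "X \<in> VF \<Longrightarrow> Y \<in> VF \<Longrightarrow> cov_endo D \<phi> X Y \<in> VF"
  by (simp add: cov_endo_def)

lemma phi_defect_eq:
  "X \<in> VF \<Longrightarrow> Y \<in> VF \<Longrightarrow> Z \<in> VF \<Longrightarrow>
    phi_defect D X Y Z = G (D X (\<Phi> Y)) Z + G (D X Y) (\<Phi> Z)"
  unfolding phi_defect_def cov_endo_def by (simp add: app2_g_diff Phi_skew)

text \<open>
  Differentiate \<open>g(\<phi>Y, Z) + g(Y, \<phi>Z) = 0\<close>.
\<close>

lemma phi_defect_skew:
  assumes v: "X \<in> VF" "Y \<in> VF" "Z \<in> VF"
  shows "phi_defect D X Z Y = - phi_defect D X Y Z"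
proof -
  have "G (\<Phi> Y) Z + G Y (\<Phi> Z) = 0" using v by (simp add: Phi_skew)
  then have "deriv_along X (G (\<Phi> Y) Z) + deriv_along X (G Y (\<Phi> Z)) = 0"
    using v deriv_along_add[of X "G (\<Phi> Y) Z" "G Y (\<Phi> Z)"] deriv_along_const[OF v(1), of 0]
    by (simp add: zero_fun_def)
  then have "phi_defect D X Y Z + phi_defect D X Z Y = 0"
    using v by (simp add: phi_defect_eq metric_connectionD(2)[OF D] app2_g_sym[of _ "D _ _"] algebra_simps)
  then show ?thesis by (simp add: eq_neg_iff_add_eq_0 add.commute)
qed

lemma bracket_torsion:
  "X \<in> VF \<Longrightarrow> Y \<in> VF \<Longrightarrow> Z \<in> VF \<Longrightarrow>
    G (lie_bracket X Y) Z = G (D X Y) Z - G (D Y X) Z - torsion_form D X Y Z"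
  unfolding torsion_form_def by (rule metric_connectionD(3)[OF D])

text \<open>
  For a \<open>\<phi>\<close>-connection the defect terms drop out, and \<open>dF = 0\<close> becomes an algebraic condition on the
  torsion. Conversely, if the torsion terms cancel, the cyclic sum of the defect vanishes.
\<close>

lemma d2_fundamental_form:
  assumes v: "X \<in> VF" "Y \<in> VF" "Z \<in> VF"
  shows "d2 (fundamental_form \<phi> g) X Y Z =
    - (phi_defect D X Y Z + phi_defect D Y Z X + phi_defect D Z X Y)
    + torsion_form D X Y (\<Phi> Z) - torsion_form D X Z (\<Phi> Y) + torsion_form D Y Z (\<Phi> X)"
proof -
  have F: "app2 (fundamental_form \<phi> g) U V = G U (\<Phi> V)" for U V
    by (rule ext) (simp add: fundamental_form_def)
  have sym: "G U (D V W) = G (D V W) U" if "U \<in> VF" "V \<in> VF" "W \<in> VF" for U V W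
    using that by (intro app2_g_sym) auto
  show ?thesis
    unfolding d2_def F
  proof
    fix p
    show "(deriv_along X (G Y (\<Phi> Z)) - deriv_along Y (G X (\<Phi> Z)) + deriv_along Z (G X (\<Phi> Y))
        - G (lie_bracket X Y) (\<Phi> Z) + G (lie_bracket X Z) (\<Phi> Y) - G (lie_bracket Y Z) (\<Phi> X)) p =
      (- (phi_defect D X Y Z + phi_defect D Y Z X + phi_defect D Z X Y)
        + torsion_form D X Y (\<Phi> Z) - torsion_form D X Z (\<Phi> Y) + torsion_form D Y Z (\<Phi> X)) p"
      using v fun_cong[OF phi_defect_skew[OF v], of p] fun_cong[OF phi_defect_skew[OF v(3,1,2)], of p]
      by (simp add: bracket_torsion metric_connectionD(2)[OF D] sym phi_defect_eq
          del: app2_apply deriv_along_apply)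
  qed
qed

text \<open>
  The Lie brackets in the Nijenhuis tensor are replaced by covariant derivatives and torsion; as for \<open>dF\<close>,
  the formula is read both for vanishing defect and for known torsion.
\<close>

lemma nijenhuis_torsion:
  assumes v: "X \<in> VF" "Y \<in> VF" "Z \<in> VF"
  shows "G (nijenhuis \<phi> X Y) Z =
    phi_defect D (\<Phi> X) Y Z - phi_defect D (\<Phi> Y) X Z
    + phi_defect D X Y (\<Phi> Z) - phi_defect D Y X (\<Phi> Z)
    - (torsion_form D (\<Phi> X) (\<Phi> Y) Z + torsion_form D X Y (\<Phi> (\<Phi> Z))
       + torsion_form D X (\<Phi> Y) (\<Phi> Z) + torsion_form D (\<Phi> X) Y (\<Phi> Z))"
  unfolding nijenhuis_def
  using v by (intro ext) (simp add: app2_g_diff app2_g_add Phi_skew bracket_torsion phi_defect_eq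
      del: app2_apply)

end

end

section \<open>Consequences of normality\<close>

context K_manifold
begin

lemma normality_component:
  assumes v: "X \<in> VF" "Y \<in> VF" "Z \<in> VF"
  shows "G (nijenhuis \<phi> X Y) Z + (\<Sum>i=1..s. d1 (\<eta> i) X Y * app1 (\<eta> i) Z) = 0"
proof -
  have N: "nijenhuis \<phi> X Y \<in> VF" using v by (simp add: nijenhuis_def)
  have S: "fscale (d1 (\<eta> i) X Y) (\<xi> i) \<in> VF" if "i \<in> {1..s}" for i
    using v that by (intro vfield_fscale d1_smooth eta_form xi_vfield)
  have S': "(\<Sum>i=1..s. fscale (d1 (\<eta> i) X Y) (\<xi> i)) \<in> VF"
    by (rule vfield_sum) (rule S)
  have "G (\<Sum>i=1..s. fscale (d1 (\<eta> i) X Y) (\<xi> i)) Z = (\<Sum>i=1..s. G (fscale (d1 (\<eta> i) X Y) (\<xi> i)) Z)"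
    by (rule vfield_additive_sum[where \<omega> = "\<lambda>X. G X Z"]) (simp_all only: app2_g_add(1) v S)
  also have "\<dots> = (\<Sum>i=1..s. d1 (\<eta> i) X Y * app1 (\<eta> i) Z)"
    using v by (intro sum.cong) (simp_all add: app2_g_fscale app1_eta_eq_g xi_vfield)
  finally show ?thesis
    using app2_g_add(1)[OF N S' v(3)] normal[OF v(1,2)] app2_g_zero[OF v(3)]
    by (simp add: normality_tensor_def)
qed

text \<open>
  The \<open>\<xi>\<^sub>j\<close>-component of \<open>N\<^sup>(\<^sup>1\<^sup>) = 0\<close>. Only the first bracket of the Nijenhuis tensor contributes, since
  \<open>\<eta>\<^sub>j \<circ> \<phi> = 0\<close>.
\<close>

lemma deta_Phi_Phi:
  assumes j: "j \<in> {1..s}" and v: "X \<in> VF" "Y \<in> VF"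
  shows "d1 (\<eta> j) (\<Phi> X) (\<Phi> Y) = d1 (\<eta> j) X Y"
proof -
  note e = eta_form[OF j]
  have S: "(\<Sum>i=1..s. d1 (\<eta> i) X Y * app1 (\<eta> i) (\<xi> j)) = d1 (\<eta> j) X Y"
  proof -
    have "(\<Sum>i=1..s. d1 (\<eta> i) X Y * app1 (\<eta> i) (\<xi> j)) = (\<Sum>i=1..s. if i = j then d1 (\<eta> i) X Y else 0)"
      using j by (intro sum.cong) (auto simp: fun_eq_iff eta_xi)
    then show ?thesis using j by simp
  qed
  have "G (nijenhuis \<phi> X Y) (\<xi> j) = G (lie_bracket (\<Phi> X) (\<Phi> Y)) (\<xi> j)"
  proof -
    have "G (\<Phi> U) (\<xi> j) = 0" if "U \<in> VF" for U
      using app1_eta_Phi[OF j that] that j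
      by (simp add: app1_eta_eq_g app2_g_sym[of "\<Phi> U" "\<xi> j"] xi_vfield)
    then show ?thesis using v j by (simp add: nijenhuis_def app2_g_add app2_g_diff xi_vfield)
  qed
  also have "\<dots> = app1 (\<eta> j) (lie_bracket (\<Phi> X) (\<Phi> Y))"
    using v j by (simp add: app1_eta_eq_g app2_g_sym[of _ "\<xi> j"] xi_vfield)
  also have "\<dots> = - d1 (\<eta> j) (\<Phi> X) (\<Phi> Y)"
    using v j deriv_along_const[OF phi_vfield[OF v(1)], of 0] deriv_along_const[OF phi_vfield[OF v(2)], of 0]
    by (simp add: d1_def app1_eta_Phi zero_fun_def[symmetric])
  finally show ?thesis
    using normality_component[OF v xi_vfield[OF j]] S by simp
qed

text \<open>
  Substitute \<open>\<phi>\<xi>\<^sub>i = 0\<close> into the previous identity.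
\<close>

lemma deta_xi:
  assumes "j \<in> {1..s}" "i \<in> {1..s}" "X \<in> VF"
  shows "d1 (\<eta> j) X (\<xi> i) = 0" "d1 (\<eta> j) (\<xi> i) X = 0"
proof -
  have "d1 (\<eta> j) (\<Phi> X) 0 = 0"
    using assms deriv_along_const[OF phi_vfield[OF assms(3)], of 0]
    by (simp add: d1_def app1_zero[OF eta_form] app1_eta_Phi zero_fun_def[symmetric] lie_bracket_zero
        deriv_along_0)
  then show "d1 (\<eta> j) X (\<xi> i) = 0"
    using deta_Phi_Phi[OF assms(1,3) xi_vfield[OF assms(2)]] assms(2) by (simp add: Phi_xi)
  then show "d1 (\<eta> j) (\<xi> i) X = 0"
    using d1_antisym[OF eta_form[OF assms(1)] xi_vfield[OF assms(2)] assms(3)] by simp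
qed

lemma deta_Phi:
  assumes j: "j \<in> {1..s}" and v: "X \<in> VF" "Y \<in> VF"
  shows "d1 (\<eta> j) (\<Phi> X) Y = - d1 (\<eta> j) X (\<Phi> Y)"
proof -
  note e = eta_form[OF j]
  have "d1 (\<eta> j) (\<Phi> (\<Phi> X)) (\<Phi> Y)
      = - d1 (\<eta> j) X (\<Phi> Y) + (\<Sum>i=1..s. app1 (\<eta> i) X * d1 (\<eta> j) (\<xi> i) (\<Phi> Y))"
    by (rule linear_Phi_squared[where \<omega> = "\<lambda>X. d1 (\<eta> j) X (\<Phi> Y)"])
       (use v in \<open>simp_all only: d1_add_left[OF e] d1_fscale_left[OF e] phi_vfield\<close>)
  moreover have "(\<Sum>i=1..s. app1 (\<eta> i) X * d1 (\<eta> j) (\<xi> i) (\<Phi> Y)) = 0"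
    using v j by (intro sum.neutral) (simp add: deta_xi)
  moreover have "d1 (\<eta> j) (\<Phi> (\<Phi> X)) (\<Phi> Y) = d1 (\<eta> j) (\<Phi> X) Y"
    using v by (intro deta_Phi_Phi[OF j]) auto
  ultimately show ?thesis by (simp only: add_0_right)
qed

text \<open>
  The flow of \<open>\<xi>\<^sub>i\<close> preserves \<open>\<phi>\<close>: \<open>N\<^sup>(\<^sup>1\<^sup>)(\<xi>\<^sub>i, X) = 0\<close> says that \<open>\<phi>\<close> annihilates the difference of the
  two sides, and \<open>d\<eta>\<^sub>j(\<xi>\<^sub>i, \<phi>X) = 0\<close> that every \<open>\<eta>\<^sub>j\<close> does.
\<close>

lemma lie_bracket_xi_Phi:
  assumes i: "i \<in> {1..s}" and X: "X \<in> VF"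
  shows "lie_bracket (\<xi> i) (\<Phi> X) = \<Phi> (lie_bracket (\<xi> i) X)"
proof (rule ext)
  fix p
  note xi = xi_vfield[OF i]
  let ?W = "lie_bracket (\<xi> i) (\<Phi> X) - \<Phi> (lie_bracket (\<xi> i) X)"
  have W: "?W \<in> VF" using xi X by simp
  have "nijenhuis \<phi> (\<xi> i) X + 0 = 0"
  proof -
    have "(\<Sum>j=1..s. fscale (d1 (\<eta> j) (\<xi> i) X) (\<xi> j)) = 0"
      using i X by (intro sum.neutral) (auto simp: deta_xi fun_eq_iff tscale_def)
    then show ?thesis using normal[OF xi X] by (simp add: normality_tensor_def)
  qed
  then have "nijenhuis \<phi> (\<xi> i) X p = 0" by simp
  then have hor: "\<phi> p (?W p) = 0"
    using i X xi by (simp add: nijenhuis_def Phi_xi lie_bracket_zero Phi_zero phi_diff phi_zero)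
  have ver: "\<eta> j p (?W p) = 0" if j: "j \<in> {1..s}" for j
  proof -
    note e = eta_form[OF j]
    have "app1 (\<eta> j) (\<xi> i) = (\<lambda>_. if j = i then 1 else 0)" using i j by (simp add: fun_eq_iff eta_xi)
    then have "app1 (\<eta> j) (lie_bracket (\<xi> i) (\<Phi> X)) = 0"
      using deta_xi(2)[OF j i phi_vfield[OF X]] X j
        deriv_along_const[OF phi_vfield[OF X]] deriv_along_const[OF xi, of 0]
      by (simp add: d1_def app1_eta_Phi zero_fun_def[symmetric])
    from fun_cong[OF this, of p] show ?thesis
      using X xi j by (simp add: one_form_diff[OF e] eta_phi)
  qed
  have "?W p = 0" by (rule vertical_zero[OF vfield_tangent[OF W] hor ver])
  then show "lie_bracket (\<xi> i) (\<Phi> X) p = \<Phi> (lie_bracket (\<xi> i) X) p" by simp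
qed

lemma lie_bracket_xi_xi:
  assumes i: "i \<in> {1..s}" and j: "j \<in> {1..s}"
  shows "lie_bracket (\<xi> i) (\<xi> j) = 0"
proof (rule ext)
  fix p
  note xi = xi_vfield[OF i] xi_vfield[OF j]
  have "\<Phi> (lie_bracket (\<xi> i) (\<xi> j)) = 0"
    using lie_bracket_xi_Phi[OF i xi(2)] j xi by (simp add: Phi_xi lie_bracket_zero)
  then have hor: "\<phi> p (lie_bracket (\<xi> i) (\<xi> j) p) = 0" by (metis appE_apply zero_fun_apply)
  have ver: "\<eta> k p (lie_bracket (\<xi> i) (\<xi> j) p) = 0" if k: "k \<in> {1..s}" for k
  proof -
    have "app1 (\<eta> k) (\<xi> l) = (\<lambda>_. if k = l then 1 else 0)" if "l \<in> {1..s}" for l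
      using that k by (simp add: fun_eq_iff eta_xi)
    then have "app1 (\<eta> k) (lie_bracket (\<xi> i) (\<xi> j)) = 0"
      using deta_xi(1)[OF k j xi(1)] i j xi by (simp add: d1_def deriv_along_const)
    from fun_cong[OF this, of p] show ?thesis by simp
  qed
  show "lie_bracket (\<xi> i) (\<xi> j) p = 0 p"
    using vertical_zero[OF vfield_tangent[OF vfield_lie_bracket[OF xi]] hor ver]
    by (simp only: zero_fun_apply)
qed

text \<open>
  The torsion of the connection to be constructed.
\<close>

definition eta_deta :: "'a vfield \<Rightarrow> 'a vfield \<Rightarrow> 'a vfield \<Rightarrow> 'a \<Rightarrow> real" where
  "eta_deta X Y Z = (\<Sum>j=1..s. wedge12 (\<eta> j) (d1 (\<eta> j)) X Y Z)"

lemma three_form_eta_deta: "three_form A eta_deta"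
  unfolding eta_deta_def[abs_def] by (intro three_form_sum three_form_wedge eta_form)

lemma eta_deta_xi:
  assumes i: "i \<in> {1..s}" and v: "X \<in> VF" "Y \<in> VF"
  shows "eta_deta X Y (\<xi> i) = d1 (\<eta> i) X Y"
proof -
  have "eta_deta X Y (\<xi> i) = (\<Sum>j=1..s. if j = i then d1 (\<eta> i) X Y else 0)"
    unfolding eta_deta_def wedge12_def using i v
    by (intro sum.cong) (auto simp: deta_xi fun_eq_iff eta_xi)
  then show ?thesis using i by simp
qed

lemma eta_deta_Phi_Phi:
  assumes v: "X \<in> VF" "Y \<in> VF" "Z \<in> VF"
  shows "eta_deta (\<Phi> X) (\<Phi> Y) Z = (\<Sum>j=1..s. app1 (\<eta> j) Z * d1 (\<eta> j) X Y)"
  unfolding eta_deta_def wedge12_def using v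
  by (intro sum.cong) (simp_all add: deta_Phi_Phi app1_eta_Phi)

lemma eta_deta_derivation:
  assumes v: "X \<in> VF" "Y \<in> VF" "Z \<in> VF"
  shows "eta_deta X Y (\<Phi> Z) + eta_deta X (\<Phi> Y) Z + eta_deta (\<Phi> X) Y Z = 0"
  unfolding eta_deta_def wedge12_def sum.distrib[symmetric] using v
  by (intro sum.neutral) (simp add: deta_Phi app1_eta_Phi)

lemma eta_deta_cycle_Phi_Phi:
  assumes v: "X \<in> VF" "Y \<in> VF" "Z \<in> VF"
  shows "eta_deta (\<Phi> X) (\<Phi> Y) Z + eta_deta X (\<Phi> Y) (\<Phi> Z) + eta_deta (\<Phi> X) Y (\<Phi> Z)
    = eta_deta X Y Z"
  unfolding eta_deta_def wedge12_def sum.distrib[symmetric] using v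
  by (intro sum.cong) (simp_all add: deta_Phi_Phi app1_eta_Phi)

section \<open>The torsion of an almost metric phi-connection\<close>

text \<open>
  The difference \<open>\<delta>\<close> of the two 3-forms vanishes on \<open>(\<phi>X, \<phi>Y, Z)\<close> and as soon as one argument is some
  \<open>\<xi>\<^sub>i\<close>. Replacing \<open>X\<close> and \<open>Y\<close> by \<open>- \<phi>\<^sup>2X\<close> and \<open>- \<phi>\<^sup>2Y\<close> therefore does not change \<open>\<delta>\<close> and makes it \<open>0\<close>.
\<close>

lemma skew_torsion_eq:
  assumes D: "almost_metric_phi_connection A s \<phi> \<xi> \<eta> g D" "has_skew_torsion A g D"
    and v: "X \<in> VF" "Y \<in> VF" "Z \<in> VF"
  shows "torsion_form D X Y Z = eta_deta X Y Z"
proof -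
  have m: "metric_connection A g D"
    and dphi: "\<And>X Y. X \<in> VF \<Longrightarrow> Y \<in> VF \<Longrightarrow> cov_endo D \<phi> X Y = 0"
    and deta: "\<And>i X Y. i \<in> {1..s} \<Longrightarrow> X \<in> VF \<Longrightarrow> Y \<in> VF \<Longrightarrow> cov_form1 D (\<eta> i) X Y = 0"
    using D(1) unfolding almost_metric_phi_connection_def by blast+
  let ?t = "torsion_form D"
  have t: "three_form A ?t"
    using D(2) unfolding has_skew_torsion_def torsion_form_def[abs_def] .
  note Dv = metric_connectionD(1)[OF m]
  have defect: "phi_defect D X Y Z = 0" if "X \<in> VF" "Y \<in> VF" "Z \<in> VF" for X Y Z
    using that dphi[of X Y] by (simp add: phi_defect_def app2_g_zero)
  have t_xi: "?t X Y (\<xi> i) = d1 (\<eta> i) X Y" if i: "i \<in> {1..s}" and v: "X \<in> VF" "Y \<in> VF" for i X Y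
  proof -
    have "deriv_along X (app1 (\<eta> i) Y) = app1 (\<eta> i) (D X Y)" if "X \<in> VF" "Y \<in> VF" for X Y
      using deta[OF i that] by (simp add: cov_form1_def)
    then have "d1 (\<eta> i) X Y = app1 (\<eta> i) (torsion D X Y)"
      using v Dv by (simp add: d1_def torsion_def app1_diff[OF eta_form[OF i]])
    also have "\<dots> = ?t X Y (\<xi> i)"
    proof -
      have "torsion D X Y \<in> VF" using v Dv by (simp add: torsion_def)
      then show ?thesis
        using i by (simp add: torsion_form_def app1_eta_eq_g app2_g_sym[of _ "\<xi> i"] xi_vfield)
    qed
    finally show ?thesis by simp
  qed
  have t_Phi_Phi: "?t (\<Phi> X) (\<Phi> Y) Z = (\<Sum>i=1..s. app1 (\<eta> i) Z * d1 (\<eta> i) X Y)"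
    if v: "X \<in> VF" "Y \<in> VF" "Z \<in> VF" for X Y Z
  proof -
    have N: "G (nijenhuis \<phi> X Y) Z = - (?t (\<Phi> X) (\<Phi> Y) Z + ?t X Y (\<Phi> (\<Phi> Z))
       + ?t X (\<Phi> Y) (\<Phi> Z) + ?t (\<Phi> X) Y (\<Phi> Z))"
      using nijenhuis_torsion[OF m v] v by (simp add: defect)
    \<comment> \<open>With \<open>\<phi>Z\<close> as third argument, \<open>dF = 0\<close> cancels all torsion terms of \<open>N\<close> but one.\<close>
    have "0 = ?t X Y (\<Phi> (\<Phi> Z)) - ?t X (\<Phi> Z) (\<Phi> Y) + ?t Y (\<Phi> Z) (\<Phi> X)"
      using d2_fundamental_form[OF m v(1,2) phi_vfield[OF v(3)]]
        fundamental_closed[OF v(1,2) phi_vfield[OF v(3)]] v by (simp add: defect)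
    then have F: "?t X Y (\<Phi> (\<Phi> Z)) + ?t X (\<Phi> Y) (\<Phi> Z) + ?t (\<Phi> X) Y (\<Phi> Z) = 0"
      using three_form_swap23[OF t v(1) phi_vfield[OF v(3)] phi_vfield[OF v(2)]]
        three_form_cycle[OF t v(2) phi_vfield[OF v(3)] phi_vfield[OF v(1)]] by simp
    have "G (nijenhuis \<phi> X Y) Z = - ?t (\<Phi> X) (\<Phi> Y) Z"
    proof
      show "G (nijenhuis \<phi> X Y) Z p = (- ?t (\<Phi> X) (\<Phi> Y) Z) p" for p
        using fun_cong[OF N, of p] fun_cong[OF F, of p] by (simp del: app2_apply)
    qed
    then show ?thesis using normality_component[OF v] by (simp add: mult.commute)
  qed
  define \<delta> where "\<delta> = (\<lambda>X Y Z. ?t X Y Z - eta_deta X Y Z)"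
  have \<delta>: "three_form A \<delta>" unfolding \<delta>_def by (rule three_form_diff[OF t three_form_eta_deta])
  have \<delta>_Phi: "\<delta> (\<Phi> X) (\<Phi> Y) Z = 0" if "X \<in> VF" "Y \<in> VF" "Z \<in> VF" for X Y Z
    using that by (simp add: \<delta>_def t_Phi_Phi eta_deta_Phi_Phi)
  have \<delta>_xi: "\<delta> (\<xi> i) Y Z = 0" if "i \<in> {1..s}" "Y \<in> VF" "Z \<in> VF" for i Y Z
  proof -
    have "\<delta> Y Z (\<xi> i) = 0" using that by (simp add: \<delta>_def t_xi eta_deta_xi)
    then show ?thesis using three_form_cycle[OF \<delta> that(2,3) xi_vfield[OF that(1)]] by simp
  qed
  have \<delta>_PhiPhi: "\<delta> (\<Phi> (\<Phi> X)) Y Z = - \<delta> X Y Z" if v: "X \<in> VF" "Y \<in> VF" "Z \<in> VF" for X Y Z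
  proof -
    have "\<delta> (\<Phi> (\<Phi> X)) Y Z = - \<delta> X Y Z + (\<Sum>i=1..s. app1 (\<eta> i) X * \<delta> (\<xi> i) Y Z)"
      by (rule linear_Phi_squared[where \<omega> = "\<lambda>X. \<delta> X Y Z"]) (use v three_form_add1[OF \<delta>] three_form_scale1[OF \<delta>] in auto)
    moreover have "(\<Sum>i=1..s. app1 (\<eta> i) X * \<delta> (\<xi> i) Y Z) = 0"
      using v by (intro sum.neutral) (simp add: \<delta>_xi)
    ultimately show ?thesis by (simp only: add_0_right)
  qed
  have "\<delta> X Y Z = - \<delta> Y X Z" by (rule three_form_swap12[OF \<delta> v])
  also have "\<dots> = \<delta> (\<Phi> (\<Phi> Y)) X Z" using v by (simp add: \<delta>_PhiPhi)
  also have "\<dots> = - \<delta> X (\<Phi> (\<Phi> Y)) Z" using v by (intro three_form_swap12[OF \<delta>]) auto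
  also have "\<dots> = \<delta> (\<Phi> (\<Phi> X)) (\<Phi> (\<Phi> Y)) Z" using v by (simp add: \<delta>_PhiPhi)
  also have "\<dots> = 0" using v by (intro \<delta>_Phi) auto
  finally show ?thesis by (simp add: \<delta>_def)
qed

section \<open>Existence of the connection\<close>

context
  fixes D
  assumes D: "metric_connection A g D"
    and tor: "\<And>X Y Z. X \<in> VF \<Longrightarrow> Y \<in> VF \<Longrightarrow> Z \<in> VF \<Longrightarrow> torsion_form D X Y Z = eta_deta X Y Z"
begin

text \<open>
  Let \<open>S(X, Y) = g(D\<^sub>X \<xi>\<^sub>i, Y)\<close>. Since \<open>t(X, Y, \<xi>\<^sub>i) = d\<eta>\<^sub>i(X, Y)\<close>, the torsion accounts for all of \<open>d\<eta>\<^sub>i\<close>, and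
  \<open>S\<close> is symmetric. Its symmetric part is half the Lie derivative of \<open>g\<close> along \<open>\<xi>\<^sub>i\<close>. That derivative
  vanishes on \<open>(X, \<phi>Y)\<close>, because \<open>\<xi>\<^sub>i\<close> preserves \<open>\<phi>\<close> and, by \<open>dF = 0\<close>, also \<open>F\<close>; it vanishes on
  \<open>(X, \<xi>\<^sub>j)\<close> because \<open>\<xi>\<^sub>i\<close> commutes with \<open>\<xi>\<^sub>j\<close> and \<open>d\<eta>\<^sub>j(\<xi>\<^sub>i, X) = 0\<close>.
\<close>

lemma parallel_xi:
  assumes i: "i \<in> {1..s}" and X: "X \<in> VF"
  shows "D X (\<xi> i) = 0"
proof -
  note xi = xi_vfield[OF i] and Dv = D_vfield[OF D]
  define S where "S X Y = G (D X (\<xi> i)) Y" for X Y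
  have S_sym: "S X Y = S Y X" if v: "X \<in> VF" "Y \<in> VF" for X Y
  proof -
    have br: "app1 (\<eta> i) (lie_bracket X Y) = G (D X Y) (\<xi> i) - G (D Y X) (\<xi> i) - d1 (\<eta> i) X Y"
      using bracket_torsion[OF D v xi] v i
      by (simp add: tor xi eta_deta_xi app1_eta_eq_g app2_g_sym[of "lie_bracket X Y" "\<xi> i"])
    have "d1 (\<eta> i) X Y = G (D X (\<xi> i)) Y + G (\<xi> i) (D X Y) - (G (D Y (\<xi> i)) X + G (\<xi> i) (D Y X))
        - app1 (\<eta> i) (lie_bracket X Y)"
      using v i xi by (simp add: d1_def app1_eta_eq_g[OF i v(1)] app1_eta_eq_g[OF i v(2)] metric_connectionD(2)[OF D])
    moreover note app2_g_sym[OF xi Dv[OF v]] app2_g_sym[OF xi Dv[OF v(2,1)]]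
    ultimately show ?thesis unfolding br S_def by (simp add: algebra_simps)
  qed
  have killing: "deriv_along (\<xi> i) (G X Y) = G (lie_bracket (\<xi> i) X) Y + G X (lie_bracket (\<xi> i) Y)
      + (S X Y + S Y X)" if v: "X \<in> VF" "Y \<in> VF" for X Y
  proof -
    note app2_g_sym[OF v(1) vfield_lie_bracket[OF xi v(2)]] app2_g_sym[OF v(1) Dv[OF xi v(2)]]
    moreover have "eta_deta (\<xi> i) X Y = - eta_deta (\<xi> i) Y X"
      by (rule three_form_swap23[OF three_form_eta_deta xi v])
    ultimately show ?thesis
      using v xi by (simp add: metric_connectionD(2)[OF D] bracket_torsion[OF D] tor S_def algebra_simps)
  qed
  have S_Phi: "S X (\<Phi> Y) = 0" if v: "X \<in> VF" "Y \<in> VF" for X Y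
  proof -
    have F: "app2 (fundamental_form \<phi> g) U V = G U (\<Phi> V)" for U V
      by (rule ext) (simp add: fundamental_form_def)
    have F0: "G (\<xi> i) (\<Phi> U) = 0" "G U (\<Phi> (\<xi> i)) = 0" if "U \<in> VF" for U
      using that i app1_eta_Phi[OF i that] xi
      by (simp_all add: app1_eta_eq_g Phi_xi app2_g_sym[of U 0] app2_g_zero)
    have "G (lie_bracket (\<xi> i) Y) (\<Phi> X) = - G X (lie_bracket (\<xi> i) (\<Phi> Y))"
      using v xi i by (simp add: lie_bracket_xi_Phi app2_g_sym[of X "\<Phi> _"] Phi_skew)
    moreover have "0 = deriv_along (\<xi> i) (G X (\<Phi> Y)) - G (lie_bracket (\<xi> i) X) (\<Phi> Y)
        + G (lie_bracket (\<xi> i) Y) (\<Phi> X)"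
      using fundamental_closed[OF xi v] v xi deriv_along_const[OF v(1), of 0] deriv_along_const[OF v(2), of 0]
      by (simp add: d2_def F F0 zero_fun_def[symmetric])
    ultimately have "S X (\<Phi> Y) + S (\<Phi> Y) X = 0"
      using killing[OF v(1) phi_vfield[OF v(2)]] by simp
    then show ?thesis using S_sym[OF v(1) phi_vfield[OF v(2)]] by (simp add: fun_eq_iff)
  qed
  have S_xi: "S X (\<xi> j) = 0" if X: "X \<in> VF" and j: "j \<in> {1..s}" for X j
  proof -
    note xj = xi_vfield[OF j]
    have eq: "G X (\<xi> j) = app1 (\<eta> j) X" "G (lie_bracket (\<xi> i) X) (\<xi> j) = app1 (\<eta> j) (lie_bracket (\<xi> i) X)"
      using X xi xj j by (simp_all add: app1_eta_eq_g app2_g_sym[of _ "\<xi> j"])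
    have "app1 (\<eta> j) (\<xi> i) = (\<lambda>_. if j = i then 1 else 0)" using i j by (simp add: fun_eq_iff eta_xi)
    then have "deriv_along (\<xi> i) (app1 (\<eta> j) X) = app1 (\<eta> j) (lie_bracket (\<xi> i) X)"
      using deta_xi(2)[OF j i X] X by (simp add: d1_def deriv_along_const)
    then have "S X (\<xi> j) + S (\<xi> j) X = 0"
      using killing[OF X xj] X lie_bracket_xi_xi[OF i j] unfolding eq
      by (simp add: app2_g_sym[of X 0] app2_g_zero)
    then show ?thesis using S_sym[OF X xj] by (simp add: fun_eq_iff)
  qed
  let ?W = "D X (\<xi> i)"
  have W: "?W \<in> VF" using Dv X xi by blast
  show ?thesis
  proof (rule g_nondegenerate[OF W vfield_zero])
    fix Z assume Z: "Z \<in> VF"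
    have "G ?W (\<Phi> (\<Phi> Z)) = 0" using S_Phi[OF X phi_vfield[OF Z]] by (simp add: S_def)
    moreover have "app1 (\<eta> j) ?W = 0" if "j \<in> {1..s}" for j
      using S_xi[OF X that] W that by (simp add: S_def app1_eta_eq_g app2_g_sym[of ?W "\<xi> j"] xi_vfield)
    ultimately show "G ?W Z = G 0 Z" using G_Phi_squared[OF Z W] Z by (simp add: app2_g_zero)
  qed
qed

lemma parallel_eta:
  assumes i: "i \<in> {1..s}" and v: "X \<in> VF" "Y \<in> VF"
  shows "deriv_along X (app1 (\<eta> i) Y) = app1 (\<eta> i) (D X Y)"
  using v xi_vfield[OF i] D_vfield[OF D v] parallel_xi[OF i v(1)]
  by (simp add: app1_eta_eq_g[OF i] metric_connectionD(2)[OF D] app2_g_zero)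

text \<open>
  The vertical projection \<open>\<Sum>\<^sub>i \<eta>\<^sub>i \<otimes> \<xi>\<^sub>i\<close> is parallel, hence so is \<open>\<phi>\<^sup>2\<close>.
\<close>

lemma parallel_Phi_Phi:
  assumes v: "X \<in> VF" "Y \<in> VF"
  shows "D X (\<Phi> (\<Phi> Y)) = \<Phi> (\<Phi> (D X Y))"
proof -
  have aff: "affine_connection A D" using D by (simp add: metric_connection_def)
  note Dv = D_vfield[OF D]
  have add: "D X (U + V) = D X U + D X V" if "U \<in> VF" "V \<in> VF" for U V
    using aff v(1) that unfolding affine_connection_def by blast
  have leib: "D X (fscale f U) = fscale (deriv_along X f) U + fscale f (D X U)" if "f \<in> C" "U \<in> VF" for f U
    using aff v(1) that unfolding affine_connection_def by blast
  have "D X (Y + \<Phi> (\<Phi> Y)) = D X Y + D X (\<Phi> (\<Phi> Y))" using v by (intro add) auto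
  moreover have "Y + \<Phi> (\<Phi> Y) = (\<Sum>i=1..s. fscale (app1 (\<eta> i) Y) (\<xi> i))"
    using Phi_squared[OF v(2)] by simp
  moreover have "D X (\<Sum>i=1..s. fscale (app1 (\<eta> i) Y) (\<xi> i)) = (\<Sum>i=1..s. D X (fscale (app1 (\<eta> i) Y) (\<xi> i)))"
    using v by (intro vfield_additive_sum add vfield_fscale one_form_smooth eta_form xi_vfield)
  moreover have "\<dots> = (\<Sum>i=1..s. fscale (app1 (\<eta> i) (D X Y)) (\<xi> i))"
  proof (rule sum.cong[OF refl])
    fix i assume i: "i \<in> {1..s}"
    have "fscale f 0 = 0" for f :: "'a \<Rightarrow> real" by (simp add: fun_eq_iff tscale_def)
    then show "D X (fscale (app1 (\<eta> i) Y) (\<xi> i)) = fscale (app1 (\<eta> i) (D X Y)) (\<xi> i)"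
      using leib[OF one_form_smooth[OF eta_form[OF i] v(2)] xi_vfield[OF i]]
      by (simp add: parallel_xi[OF i v(1)] parallel_eta[OF i v])
  qed
  ultimately have "D X Y + D X (\<Phi> (\<Phi> Y)) = (\<Sum>i=1..s. fscale (app1 (\<eta> i) (D X Y)) (\<xi> i))" by simp
  then have "D X Y + D X (\<Phi> (\<Phi> Y)) = D X Y + \<Phi> (\<Phi> (D X Y))"
    using Phi_squared[OF Dv[OF v]] by simp
  then show ?thesis by (simp only: add_left_cancel)
qed

lemma phi_defect_move:
  assumes v: "X \<in> VF" "Y \<in> VF" "Z \<in> VF"
  shows "phi_defect D X (\<Phi> Y) Z = phi_defect D X Y (\<Phi> Z)"
  using v D_vfield[OF D] by (simp add: phi_defect_eq[OF D] parallel_Phi_Phi Phi_skew)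

text \<open>
  Write \<open>b\<close> for the defect. By normality \<open>c(X, Y, Z) = b(\<phi>X, Y, Z) + b(X, Y, \<phi>Z)\<close> is symmetric in \<open>X, Y\<close>,
  and it is skew in \<open>Y, Z\<close>, so \<open>c = 0\<close>: a factor \<open>\<phi>\<close> moves out of the first argument with a minus sign
  and between the other two without one. Adding the cyclic identity for \<open>b\<close> with \<open>\<phi>\<close> on \<open>X\<close> and with
  \<open>\<phi>\<close> on \<open>Y\<close> then leaves \<open>2 b(Z, \<phi>X, Y) = 0\<close>. The vertical components vanish because \<open>D\<xi>\<^sub>j = 0\<close>.
\<close>

lemma parallel_phi:
  assumes v: "X \<in> VF" "Y \<in> VF"
  shows "cov_endo D \<phi> X Y = 0"
proof -
  let ?b = "phi_defect D"
  note skew = phi_defect_skew[OF D] and Dv = D_vfield[OF D]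
  have cyc: "?b X Y Z + ?b Y Z X + ?b Z X Y = 0" if v: "X \<in> VF" "Y \<in> VF" "Z \<in> VF" for X Y Z
  proof -
    have "eta_deta X Y (\<Phi> Z) - eta_deta X Z (\<Phi> Y) + eta_deta Y Z (\<Phi> X) = 0"
      using eta_deta_derivation[OF v] three_form_swap23[OF three_form_eta_deta v(1) phi_vfield[OF v(2)] v(3)]
        three_form_cycle[OF three_form_eta_deta v(2,3) phi_vfield[OF v(1)]] by simp
    then show ?thesis
      using d2_fundamental_form[OF D v] fundamental_closed[OF v] v
      by (simp add: tor algebra_simps)
  qed
  have N: "?b (\<Phi> X) Y Z + ?b X Y (\<Phi> Z) = ?b (\<Phi> Y) X Z + ?b Y X (\<Phi> Z)"
    if v: "X \<in> VF" "Y \<in> VF" "Z \<in> VF" for X Y Z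
  proof -
    have "eta_deta X Y (\<Phi> (\<Phi> Z)) = - eta_deta X Y Z + (\<Sum>i=1..s. app1 (\<eta> i) Z * eta_deta X Y (\<xi> i))"
      by (rule linear_Phi_squared[where \<omega> = "eta_deta X Y"])
         (use v three_form_add3[OF three_form_eta_deta] three_form_scale3[OF three_form_eta_deta] in auto)
    moreover have "(\<Sum>i=1..s. app1 (\<eta> i) Z * eta_deta X Y (\<xi> i)) = (\<Sum>i=1..s. d1 (\<eta> i) X Y * app1 (\<eta> i) Z)"
      using v by (intro sum.cong) (simp_all add: eta_deta_xi mult.commute)
    ultimately have vert: "eta_deta X Y (\<Phi> (\<Phi> Z)) = - eta_deta X Y Z + (\<Sum>i=1..s. d1 (\<eta> i) X Y * app1 (\<eta> i) Z)"
      by (simp only:)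
    show ?thesis
    proof
      fix p
      show "(?b (\<Phi> X) Y Z + ?b X Y (\<Phi> Z)) p = (?b (\<Phi> Y) X Z + ?b Y X (\<Phi> Z)) p"
        using fun_cong[OF nijenhuis_torsion[OF D v], of p] fun_cong[OF normality_component[OF v], of p]
          fun_cong[OF eta_deta_cycle_Phi_Phi[OF v], of p] fun_cong[OF vert, of p] v
        by (simp add: tor del: app2_apply)
    qed
  qed
  define c where "c X Y Z = ?b (\<Phi> X) Y Z + ?b X Y (\<Phi> Z)" for X Y Z
  have c_sym: "c X Y Z = c Y X Z" if "X \<in> VF" "Y \<in> VF" "Z \<in> VF" for X Y Z
    unfolding c_def by (rule N[OF that])
  have c_skew: "c X Z Y = - c X Y Z" if "X \<in> VF" "Y \<in> VF" "Z \<in> VF" for X Y Z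
    using that skew[of "\<Phi> X" Y Z] skew[of X "\<Phi> Y" Z] phi_defect_move[of X Y Z]
    by (simp add: c_def)
  have c0: "c X Y Z = 0" if v: "X \<in> VF" "Y \<in> VF" "Z \<in> VF" for X Y Z
  proof -
    have "c X Y Z = - c X Z Y" using c_skew[OF v] by simp
    also have "c X Z Y = c Z X Y" by (rule c_sym[OF v(1,3,2)])
    also have "\<dots> = - c Z Y X" using c_skew[OF v(3,2,1)] .
    also have "c Z Y X = c Y Z X" by (rule c_sym[OF v(3,2,1)])
    also have "\<dots> = - c Y X Z" using c_skew[OF v(2,1,3)] .
    also have "c Y X Z = c X Y Z" by (rule c_sym[OF v(2,1,3)])
    finally show ?thesis by (simp add: fun_eq_iff)
  qed
  have b_first: "?b (\<Phi> X) Y Z = - ?b X Y (\<Phi> Z)" if "X \<in> VF" "Y \<in> VF" "Z \<in> VF" for X Y Z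
    using c0[OF that] unfolding c_def by (simp add: eq_neg_iff_add_eq_0)
  have b_Phi: "?b Z (\<Phi> X) Y = 0" if v: "X \<in> VF" "Y \<in> VF" "Z \<in> VF" for X Y Z
  proof -
    have e: "?b (\<Phi> X) Y Z + ?b Y Z (\<Phi> X) + ?b Z (\<Phi> X) Y = 0"
      "?b X (\<Phi> Y) Z + ?b (\<Phi> Y) Z X + ?b Z X (\<Phi> Y) = 0"
      using v by (auto intro!: cyc)
    show ?thesis
    proof
      fix p
      show "?b Z (\<Phi> X) Y p = 0 p"
        using fun_cong[OF e(1), of p] fun_cong[OF e(2), of p]
        by (simp add: b_first[OF v] b_first[OF v(2,3,1)] phi_defect_move[OF v] phi_defect_move[OF v(3,1,2)])
    qed
  qed
  show ?thesis
  proof (rule g_nondegenerate)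
    fix Z assume Z: "Z \<in> VF"
    have B: "cov_endo D \<phi> X Y \<in> VF" using cov_endo_vfield[OF D v] .
    have "G (cov_endo D \<phi> X Y) (\<Phi> (\<Phi> Z)) = 0"
      using b_Phi[OF v(2) phi_vfield[OF Z] v(1)] phi_defect_move[OF v phi_vfield[OF Z]]
      by (simp add: phi_defect_def)
    moreover have "app1 (\<eta> j) (cov_endo D \<phi> X Y) = 0" if j: "j \<in> {1..s}" for j
    proof -
      have "?b X (\<xi> j) Y = 0"
        using phi_defect_eq[OF D v(1) xi_vfield[OF j] v(2)] parallel_xi[OF j v(1)] j v
          D_vfield[OF D] parallel_Phi_Phi[OF v(1) xi_vfield[OF j]]
        by (simp add: Phi_xi Phi_zero app2_g_zero)
      then show ?thesis
        using skew[OF v(1) v(2) xi_vfield[OF j]] B j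
        by (simp add: phi_defect_def app1_eta_eq_g app2_g_sym[of _ "\<xi> j"] xi_vfield)
    qed
    ultimately show "G (cov_endo D \<phi> X Y) Z = G 0 Z"
      using G_Phi_squared[OF Z B] Z by (simp add: app2_g_zero)
  qed (use cov_endo_vfield[OF D v] in auto)
qed

lemma almost_metric_phi_connection_of_torsion:
  "almost_metric_phi_connection A s \<phi> \<xi> \<eta> g D"
  unfolding almost_metric_phi_connection_def
  using D parallel_phi parallel_xi parallel_eta by (auto simp: cov_form1_def)

end

end

theorem proposition4p2:
  fixes A :: "('a::{t2_space, second_countable_topology}, 'e::euclidean_space) chart set"
    and n s :: nat
    and \<phi> :: "'a endo"
    and \<xi> :: "nat \<Rightarrow> 'a vfield"
    and \<eta> :: "nat \<Rightarrow> 'a form1"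
    and g :: "'a form2"
  assumes "K_manifold A n s \<phi> \<xi> \<eta> g"
    and "s \<ge> 1"
  shows "(\<exists>!D. almost_metric_phi_connection A s \<phi> \<xi> \<eta> g D \<and> has_skew_torsion A g D) \<and>
    (\<forall>D. almost_metric_phi_connection A s \<phi> \<xi> \<eta> g D \<and> has_skew_torsion A g D \<longrightarrow>
      (\<forall>X\<in>vector_fields A. \<forall>Y\<in>vector_fields A. \<forall>Z\<in>vector_fields A. \<forall>p.
        g p (D X Y p) (Z p) =
          g p (levi_civita A g X Y p) (Z p)
          + 1 / 2 * (\<Sum>j=1..s. wedge12 (\<eta> j) (d1 (\<eta> j)) X Y Z p)))"
proof -
  interpret K_manifold A n s \<phi> \<xi> \<eta> g by fact
  let ?P = "\<lambda>D. almost_metric_phi_connection A s \<phi> \<xi> \<eta> g D \<and> has_skew_torsion A g D"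
  have metric: "metric_connection A g D" if "?P D" for D
    using that unfolding almost_metric_phi_connection_def by blast
  have tor: "app2 g (torsion D X Y) Z = eta_deta X Y Z"
    if "?P D" "X \<in> vector_fields A" "Y \<in> vector_fields A" "Z \<in> vector_fields A" for D X Y Z
    using skew_torsion_eq[of D X Y Z] that by (simp add: torsion_form_def)
  obtain D where D: "metric_connection A g D"
    "\<And>X Y Z. X \<in> vector_fields A \<Longrightarrow> Y \<in> vector_fields A \<Longrightarrow> Z \<in> vector_fields A \<Longrightarrow>
      torsion_form D X Y Z = eta_deta X Y Z"
    by (rule skew_torsion_connection_exists[OF three_form_eta_deta]) (simp add: torsion_form_def)
  have "has_skew_torsion A g D"
    unfolding has_skew_torsion_def
    by (rule three_form_cong[OF three_form_eta_deta D(2)[unfolded torsion_form_def]])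
  then have "?P D" using almost_metric_phi_connection_of_torsion[OF D] by simp
  moreover have "D' = D" if "?P D'" for D'
    by (rule skew_torsion_connection_unique[OF metric metric three_form_eta_deta])
       (use that \<open>?P D\<close> tor in auto)
  moreover have "g p (D X Y p) (Z p) = g p (levi_civita A g X Y p) (Z p)
      + 1 / 2 * (\<Sum>j=1..s. wedge12 (\<eta> j) (d1 (\<eta> j)) X Y Z p)"
    if "?P D" "X \<in> vector_fields A" "Y \<in> vector_fields A" "Z \<in> vector_fields A" for D X Y Z p
    using skew_torsion_connection_levi_civita[OF metric[OF that(1)] three_form_eta_deta
        tor[OF that(1)] that(2-4), of p]
    by (simp add: eta_deta_def sum_fun_apply)
  ultimately show ?thesis by blast
qed

end
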